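(* Let $G$ be a connected graph and let $\mathcal{T}$ be the family of cycles in $G$ that are geodesic triangles. Then $G$ is $\delta$-hyperbolic for some $\delta\ge0$ if and only if there exist constants $\varepsilon>0$ and $k,m\in\mathbb{N}$ (with $k\ge4$ and $k\ge2m$) such that $G$ is $\varepsilon$-densely $(k,m)$-chordal on $\mathcal{T}$.
   Context: Every edge of the connected graph $G$ has length $1$, interior points of edges are points of $G$, and $d$ is the induced shortest-path (length) metric on $G$, making $G$ a geodesic metric space. A geodesic triangle in $G$ is the union of three geodesics $[x_1x_2],[x_2x_3],[x_3x_1]$, where $x_1,x_2,x_3$ are arbitrary points of $G$ (not necessarily vertices); it is $\delta$-thin if each side is contained in the $\delta$-neighborhood of the union of the other two sides. $G$ is $\delta$-hyperbolic if every geodesic triangle in $G$ is $\delta$-thin. Paths are finite and simple. A cycle is a simple closed curve, given by a sequence of vertices all different except that the first and last coincide. $L(\cdot)$ denotes length. For a cycle $C$, $d_C$ denotes the length metric on $C$. A shortcut in $C$ is a path $\sigma$ in $G$ joining two vertices $p,q$ of $C$ with $L(\sigma)<d_C(p,q)$; it is strict if $\sigma\cap C=\{p,q\}$, and then $p,q$ are the shortcut vertices associated to $\sigma$. A subset $A$ of a metric space $(X,\rho)$ is $\varepsilon$-dense if for every $x\in X$ there is $a\in A$ with $\rho(a,x)<\varepsilon$. Given a family $\mathcal{F}$ of cycles, $G$ is $\varepsilon$-densely $(k,m)$-chordal on $\mathcal{F}$ if for every $C\in\mathcal{F}$ with $L(C)\ge k$ there exist strict shortcuts $\sigma_1,\dots,\sigma_r$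 in $C$ with $L(\sigma_i)\le m$ for all $i$ whose associated shortcut vertices form an $\varepsilon$-dense subset of $(C,d_C)$. *)

theory Defs
  imports Complex_Main
begin

section \<open>Geodesics and hyperbolicity in a metric space\<close>

definition geodesic_between ::
  "'p set \<Rightarrow> ('p \<Rightarrow> 'p \<Rightarrow> real) \<Rightarrow> 'p \<Rightarrow> 'p \<Rightarrow> 'p set \<Rightarrow> bool" where
  "geodesic_between X \<rho> x y S \<longleftrightarrow>
     (\<exists>\<gamma>. \<gamma> 0 = x \<and> \<gamma> (\<rho> x y) = y \<and> \<gamma> ` {0..\<rho> x y} = S \<and> S \<subseteq> X \<and>
        (\<forall>s\<in>{0..\<rho> x y}. \<forall>t\<in>{0..\<rho> x y}. \<rho> (\<gamma> s) (\<gamma> t) = \<bar>s - t\<bar>))"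

text \<open>The three sides are recorded separately; the triangle itself is their union.\<close>

definition geodesic_triangle ::
  "'p set \<Rightarrow> ('p \<Rightarrow> 'p \<Rightarrow> real) \<Rightarrow> 'p set \<Rightarrow> 'p set \<Rightarrow> 'p set \<Rightarrow> bool" where
  "geodesic_triangle X \<rho> S1 S2 S3 \<longleftrightarrow>
     (\<exists>x1\<in>X. \<exists>x2\<in>X. \<exists>x3\<in>X.
        geodesic_between X \<rho> x1 x2 S1 \<and>
        geodesic_between X \<rho> x2 x3 S2 \<and>
        geodesic_between X \<rho> x3 x1 S3)"

definition neighborhood ::
  "'p set \<Rightarrow> ('p \<Rightarrow> 'p \<Rightarrow> real) \<Rightarrow> real \<Rightarrow> 'p set \<Rightarrow> 'p set" where
  "neighborhood X \<rho> \<delta> A = {x \<in> X. \<exists>a\<in>A. \<rho> x a \<le> \<delta>}"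

definition thin_triangle ::
  "'p set \<Rightarrow> ('p \<Rightarrow> 'p \<Rightarrow> real) \<Rightarrow> real \<Rightarrow> 'p set \<Rightarrow> 'p set \<Rightarrow> 'p set \<Rightarrow> bool" where
  "thin_triangle X \<rho> \<delta> S1 S2 S3 \<longleftrightarrow>
     S1 \<subseteq> neighborhood X \<rho> \<delta> (S2 \<union> S3) \<and>
     S2 \<subseteq> neighborhood X \<rho> \<delta> (S3 \<union> S1) \<and>
     S3 \<subseteq> neighborhood X \<rho> \<delta> (S1 \<union> S2)"

definition hyperbolic :: "'p set \<Rightarrow> ('p \<Rightarrow> 'p \<Rightarrow> real) \<Rightarrow> real \<Rightarrow> bool" where
  "hyperbolic X \<rho> \<delta> \<longleftrightarrow>
     (\<forall>S1 S2 S3. geodesic_triangle X \<rho> S1 S2 S3 \<longrightarrow> thin_triangle X \<rho> \<delta> S1 S2 S3)"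

definition eps_dense ::
  "'p set \<Rightarrow> ('p \<Rightarrow> 'p \<Rightarrow> real) \<Rightarrow> real \<Rightarrow> 'p set \<Rightarrow> bool" where
  "eps_dense X \<rho> \<epsilon> A \<longleftrightarrow> A \<subseteq> X \<and> (\<forall>x\<in>X. \<exists>a\<in>A. \<rho> a x < \<epsilon>)"

section \<open>Graphs, paths and cycles\<close>

text \<open>Graphs are undirected and simple, but may be infinite and need not be locally finite.\<close>

definition simple_graph :: "'v set \<Rightarrow> 'v set set \<Rightarrow> bool" where
  "simple_graph V E \<longleftrightarrow> (\<forall>e\<in>E. \<exists>u\<in>V. \<exists>v\<in>V. u \<noteq> v \<and> e = {u, v})"

definition path_edges :: "'v list \<Rightarrow> 'v set set" where
  "path_edges xs = {{xs ! i, xs ! Suc i} | i. Suc i < length xs}"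

text \<open>Number of edges of a path or of a cycle; in a cycle the first vertex is repeated at the end.\<close>

definition path_length :: "'v list \<Rightarrow> nat" where
  "path_length xs = length xs - 1"

definition is_path :: "'v set \<Rightarrow> 'v set set \<Rightarrow> 'v list \<Rightarrow> bool" where
  "is_path V E xs \<longleftrightarrow> xs \<noteq> [] \<and> distinct xs \<and> set xs \<subseteq> V \<and> path_edges xs \<subseteq> E"

text \<open>At least three distinct vertices: \<open>[u, v, u]\<close> is not a simple closed curve.\<close>

definition is_cycle :: "'v set \<Rightarrow> 'v set set \<Rightarrow> 'v list \<Rightarrow> bool" where
  "is_cycle V E c \<longleftrightarrow>
     3 \<le> path_length c \<and> hd c = last c \<and> distinct (tl c) \<and> set c \<subseteq> V \<and> path_edges c \<subseteq> E"

definition connected_graph :: "'v set \<Rightarrow> 'v set set \<Rightarrow> bool" where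
  "connected_graph V E \<longleftrightarrow> simple_graph V E \<and> V \<noteq> {} \<and>
     (\<forall>u\<in>V. \<forall>v\<in>V. \<exists>xs. is_path V E xs \<and> hd xs = u \<and> last xs = v)"

section \<open>The metric graph\<close>

text \<open>
  Points are given by barycentric coordinates: a vertex is the indicator of itself, and
  \<open>edge_point u v t\<close> is the point of the edge \<open>{u, v}\<close> at distance \<open>t\<close> from \<open>u\<close>.
  Thus \<open>edge_point u v t = edge_point v u (1 - t)\<close> for \<open>u \<noteq> v\<close>, and the end points of an edge
  are vertex points, so every point has exactly one representation as a function.
\<close>

definition vertex_point :: "'v \<Rightarrow> 'v \<Rightarrow> real" where
  "vertex_point v = (\<lambda>w. if w = v then 1 else 0)"

definition edge_point :: "'v \<Rightarrow> 'v \<Rightarrow> real \<Rightarrow> 'v \<Rightarrow> real" where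
  "edge_point u v t = (\<lambda>w. if w = u then 1 - t else if w = v then t else 0)"

definition points :: "'v set \<Rightarrow> 'v set set \<Rightarrow> ('v \<Rightarrow> real) set" where
  "points V E = vertex_point ` V \<union> {edge_point u v t | u v t. {u, v} \<in> E \<and> 0 \<le> t \<and> t \<le> 1}"

lemma edge_point_0: "edge_point u v 0 = vertex_point u"
  by (auto simp: edge_point_def vertex_point_def)

lemma edge_point_1: "u \<noteq> v \<Longrightarrow> edge_point u v 1 = vertex_point v"
  by (auto simp: edge_point_def vertex_point_def)

lemma edge_point_commute: "u \<noteq> v \<Longrightarrow> edge_point u v t = edge_point v u (1 - t)"
  by (auto simp: edge_point_def)

text \<open>
  \<open>pl_joined F x y l\<close>: some piecewise linear curve of length \<open>l\<close>, with each linear piece inside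
  a single closed edge of \<open>F\<close>, runs from \<open>x\<close> to \<open>y\<close>.
\<close>

inductive pl_joined :: "'v set set \<Rightarrow> ('v \<Rightarrow> real) \<Rightarrow> ('v \<Rightarrow> real) \<Rightarrow> real \<Rightarrow> bool"
  for F where
  pl_refl: "pl_joined F x x 0"
| pl_step: "pl_joined F x (edge_point u v s) l \<Longrightarrow> {u, v} \<in> F \<Longrightarrow>
    0 \<le> s \<Longrightarrow> s \<le> 1 \<Longrightarrow> 0 \<le> t \<Longrightarrow> t \<le> 1 \<Longrightarrow>
    pl_joined F x (edge_point u v t) (l + \<bar>s - t\<bar>)"

text \<open>
  The length metric of the graph with edge set \<open>F\<close>. It is used both for the whole graph and, with
  \<open>F\<close> the edge set of a cycle, for the length metric of that cycle.
\<close>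

definition length_dist :: "'v set set \<Rightarrow> ('v \<Rightarrow> real) \<Rightarrow> ('v \<Rightarrow> real) \<Rightarrow> real" where
  "length_dist F x y = Inf {l. pl_joined F x y l}"

definition hyperbolic_graph :: "'v set \<Rightarrow> 'v set set \<Rightarrow> real \<Rightarrow> bool" where
  "hyperbolic_graph V E \<delta> \<longleftrightarrow> hyperbolic (points V E) (length_dist E) \<delta>"

text \<open>The subset of the metric graph traced out by a path or a cycle.\<close>

definition trace :: "'v list \<Rightarrow> ('v \<Rightarrow> real) set" where
  "trace xs = points (set xs) (path_edges xs)"

definition triangle_cycles :: "'v set \<Rightarrow> 'v set set \<Rightarrow> 'v list set" where
  "triangle_cycles V E =
     {c. is_cycle V E c \<and>
        (\<exists>S1 S2 S3. geodesic_triangle (points V E) (length_dist E) S1 S2 S3 \<and>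
           trace c = S1 \<union> S2 \<union> S3)}"

section \<open>Shortcuts and dense chordality\<close>

definition cycle_dist :: "'v list \<Rightarrow> ('v \<Rightarrow> real) \<Rightarrow> ('v \<Rightarrow> real) \<Rightarrow> real" where
  "cycle_dist c = length_dist (path_edges c)"

definition shortcut :: "'v set \<Rightarrow> 'v set set \<Rightarrow> 'v list \<Rightarrow> 'v list \<Rightarrow> bool" where
  "shortcut V E c \<sigma> \<longleftrightarrow>
     is_path V E \<sigma> \<and> hd \<sigma> \<in> set c \<and> last \<sigma> \<in> set c \<and>
     real (path_length \<sigma>) < cycle_dist c (vertex_point (hd \<sigma>)) (vertex_point (last \<sigma>))"

definition shortcut_vertices :: "'v list \<Rightarrow> ('v \<Rightarrow> real) set" where
  "shortcut_vertices \<sigma> = {vertex_point (hd \<sigma>), vertex_point (last \<sigma>)}"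

definition strict_shortcut :: "'v set \<Rightarrow> 'v set set \<Rightarrow> 'v list \<Rightarrow> 'v list \<Rightarrow> bool" where
  "strict_shortcut V E c \<sigma> \<longleftrightarrow>
     shortcut V E c \<sigma> \<and> trace \<sigma> \<inter> trace c = shortcut_vertices \<sigma>"

definition densely_chordal_on ::
  "'v set \<Rightarrow> 'v set set \<Rightarrow> real \<Rightarrow> nat \<Rightarrow> nat \<Rightarrow> 'v list set \<Rightarrow> bool" where
  "densely_chordal_on V E \<epsilon> k m \<F> \<longleftrightarrow>
     (\<forall>c\<in>\<F>. k \<le> path_length c \<longrightarrow>
        (\<exists>\<Sigma>. finite \<Sigma> \<and>
           (\<forall>\<sigma>\<in>\<Sigma>. strict_shortcut V E c \<sigma> \<and> path_length \<sigma> \<le> m) \<and>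
           eps_dense (trace c) (cycle_dist c) \<epsilon> (\<Union>\<sigma>\<in>\<Sigma>. shortcut_vertices \<sigma>)))"

end

theory Submission imports Defs "HOL-Analysis.Topology_Euclidean_Space" begin

text \<open>
  Everything rests on one observation: a side of a geodesic triangle that is a cycle \<open>C\<close> is also a shortest
  curve of \<open>C\<close> between its points (\<open>cycle_dist_isometric_le\<close>), so no shortcut of \<open>C\<close> joins two points
  of the same side.

  If shortcuts of length at most \<open>m\<close> are \<open>\<epsilon>\<close>-dense on \<open>C\<close>, then every point \<open>p\<close> of a side has a shortcut vertex
  within \<open>\<epsilon>\<close>; it, or the other end of the shortcut, lies on another side, so \<open>p\<close> is at distance at most \<open>\<epsilon> + m\<close>
  from the other sides. An arbitrary triangle reduces to this case
  (\<open>triangle_cycle_through_side\<close>): if \<open>p\<close> is far from the other sides, take the maximal piece \<open>[a, b]\<close>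
  around \<open>p\<close> that avoids them, and follow the other sides from \<open>a\<close> and \<open>b\<close> to their first common point \<open>c\<close>. The three
  pieces meet only in \<open>a\<close>, \<open>b\<close>, \<open>c\<close> and form a simple closed curve. Since geodesics cross the
  interior of an edge at unit speed without turning, that curve traverses whole edges, one per unit of time, which
  makes it a cycle of the graph (\<open>closed_arc_is_cycle\<close>).

  Conversely, let triangles be \<open>\<delta>\<close>-thin and let \<open>C\<close> be a long cycle that is a geodesic triangle. On the circle
  of length \<open>n = L(C)\<close> the sides are arcs of length at most \<open>n / 2\<close> that together cover it, hence three consecutive
  arcs (\<open>triangle_on_circle\<close>). Near any point of \<open>C\<close> there is a point \<open>p\<close> at distance at least \<open>R\<close> from all
  corners, and thinness gives a point \<open>q\<close> of another side with \<open>d(p, q) \<le> \<delta>\<close>, although \<open>q\<close> is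
  at least \<open>R\<close> away along \<open>C\<close> (\<open>thin_pair_near\<close>). A shortest path from \<open>p\<close> to \<open>q\<close>, up to passing to vertices, then
  saves length against \<open>C\<close>, so it does on some stretch between consecutive visits to \<open>C\<close>. Such a stretch is
  a strict shortcut, and one of them starts close to \<open>p\<close> (\<open>strict_shortcut_on_path\<close>).

  Points are functions of barycentric coordinates, and each coordinate is 1-Lipschitz. This gives lower bounds
  on distances and describes small balls: a point with two positive coordinates determines its edge.
\<close>

section \<open>Piecewise linear curves and the length metric\<close>

lemma pl_joined_edge:
  assumes "{u, v} \<in> F" "0 \<le> s" "s \<le> 1" "0 \<le> t" "t \<le> 1"
  shows "pl_joined F (edge_point u v s) (edge_point u v t) \<bar>s - t\<bar>"
  using pl_step[OF pl_refl assms] by simp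

lemma pl_joined_trans:
  assumes "pl_joined F x y l" "pl_joined F y z l'"
  shows "pl_joined F x z (l + l')"
  using assms(2,1)
proof (induction arbitrary: l rule: pl_joined.induct)
  case (pl_step y u v s l1 t)
  from pl_joined.pl_step[OF pl_step.IH[OF pl_step.prems] pl_step.hyps(2-6)]
  show ?case by (simp add: add.assoc)
qed auto

lemma pl_joined_sym: "pl_joined F x y l \<Longrightarrow> pl_joined F y x l"
proof (induction rule: pl_joined.induct)
  case (pl_step x u v s l t)
  have "pl_joined F (edge_point u v t) (edge_point u v s) \<bar>t - s\<bar>"
    by (rule pl_joined_edge) (use pl_step in auto)
  from pl_joined_trans[OF this pl_step.IH] show ?case by (simp add: abs_minus_commute add.commute)
qed (rule pl_joined.pl_refl)

lemma pl_joined_nonneg: "pl_joined F x y l \<Longrightarrow> 0 \<le> l"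
  by (induction rule: pl_joined.induct) auto

lemma pl_joined_mono: "pl_joined F x y l \<Longrightarrow> F \<subseteq> F' \<Longrightarrow> pl_joined F' x y l"
  by (induction rule: pl_joined.induct) (auto intro: pl_joined.intros)

text \<open>
  The source of lower bounds on distances: a function that is 1-Lipschitz along every edge is
  1-Lipschitz along every curve. It is applied to coordinates and to combinatorial distances.
\<close>

lemma pl_joined_lipschitz:
  fixes \<phi> :: "('v \<Rightarrow> real) \<Rightarrow> real"
  assumes "pl_joined F x y l"
    and "\<And>u v s t. {u, v} \<in> F \<Longrightarrow> 0 \<le> s \<Longrightarrow> s \<le> 1 \<Longrightarrow> 0 \<le> t \<Longrightarrow> t \<le> 1 \<Longrightarrow>
      \<bar>\<phi> (edge_point u v s) - \<phi> (edge_point u v t)\<bar> \<le> \<bar>s - t\<bar>"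
  shows "\<bar>\<phi> x - \<phi> y\<bar> \<le> l"
  using assms(1)
proof (induction rule: pl_joined.induct)
  case (pl_step x u v s l t)
  then show ?case using assms(2)[of u v s t] by linarith
qed auto

lemma pl_joined_coordinate: "pl_joined F x y l \<Longrightarrow> \<bar>x w - y w\<bar> \<le> l"
  by (erule pl_joined_lipschitz[where \<phi> = "\<lambda>z. z w"]) (auto simp: edge_point_def)

lemma pl_joined_path:
  assumes "xs \<noteq> []" "path_edges xs \<subseteq> F" "\<And>u v. {u, v} \<in> F \<Longrightarrow> u \<noteq> v"
  shows "pl_joined F (vertex_point (hd xs)) (vertex_point (last xs)) (real (path_length xs))"
  using assms(1,2)
proof (induction xs rule: induct_list012)
  case (3 x y zs)
  have edges: "path_edges (x # y # zs) = insert {x, y} (path_edges (y # zs))"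
  proof (intro set_eqI iffI)
    fix e assume "e \<in> path_edges (x # y # zs)"
    then obtain i where "e = {(x # y # zs) ! i, (y # zs) ! i}" "i < Suc (length zs)"
      by (auto simp: path_edges_def)
    then show "e \<in> insert {x, y} (path_edges (y # zs))"
      by (cases i) (auto simp: path_edges_def)
  next
    fix e assume "e \<in> insert {x, y} (path_edges (y # zs))"
    then consider "e = {x, y}" | i where "e = {(y # zs) ! i, zs ! i}" "i < length zs"
      by (auto simp: path_edges_def)
    then show "e \<in> path_edges (x # y # zs)"
    proof cases
      case 1
      then show ?thesis unfolding path_edges_def by (auto intro!: exI[of _ 0])
    next
      case 2
      then show ?thesis unfolding path_edges_def by (auto intro!: exI[of _ "Suc i"])
    qed
  qed
  then have xy: "{x, y} \<in> F" using 3 by blast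
  have "pl_joined F (vertex_point y) (vertex_point (last (y # zs))) (real (path_length (y # zs)))"
    using 3 edges by simp
  moreover have "pl_joined F (vertex_point x) (vertex_point y) 1"
    using pl_joined_edge[OF xy, of 0 1] assms(3)[OF xy] by (simp add: edge_point_0 edge_point_1)
  ultimately show ?case
    using pl_joined_trans[of F "vertex_point x" "vertex_point y" 1] by (fastforce simp: path_length_def)
qed (auto simp: path_length_def pl_refl)

lemma length_dist_le: "pl_joined F x y l \<Longrightarrow> length_dist F x y \<le> l"
  unfolding length_dist_def by (rule cInf_lower) (auto intro!: bdd_belowI[of _ 0] dest: pl_joined_nonneg)

lemma length_dist_greatest:
  assumes "pl_joined F x y l0" "\<And>l. pl_joined F x y l \<Longrightarrow> b \<le> l"
  shows "b \<le> length_dist F x y"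
  unfolding length_dist_def by (rule cInf_greatest) (use assms in auto)

text \<open>
  A set of points any two of which are joined by a curve in \<open>F\<close>; it is instantiated both by the whole
  graph and by a cycle with its own length metric. Without such curves the infimum of lengths
  would be over the empty set.
\<close>

locale joined_points =
  fixes X :: "('v \<Rightarrow> real) set" and F :: "'v set set"
  assumes joined: "x \<in> X \<Longrightarrow> y \<in> X \<Longrightarrow> \<exists>l. pl_joined F x y l"
begin

lemma dist_nonneg: "x \<in> X \<Longrightarrow> y \<in> X \<Longrightarrow> 0 \<le> length_dist F x y"
  using joined length_dist_greatest pl_joined_nonneg by blast

lemma dist_coordinate:
  assumes "x \<in> X" "y \<in> X" shows "\<bar>x w - y w\<bar> \<le> length_dist F x y"
  using joined[OF assms] length_dist_greatest pl_joined_coordinate by metis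

lemma dist_refl: "x \<in> X \<Longrightarrow> length_dist F x x = 0"
  using dist_nonneg length_dist_le[OF pl_refl] by (metis order_antisym)

lemma dist_commute: "length_dist F x y = length_dist F y x"
proof -
  have "{l. pl_joined F x y l} = {l. pl_joined F y x l}"
    using pl_joined_sym by blast
  then show ?thesis by (simp add: length_dist_def)
qed

lemma dist_less:
  assumes "x \<in> X" "y \<in> X" "length_dist F x y < b"
  obtains l where "l < b" "pl_joined F x y l"
proof -
  have "\<not> (\<forall>l. pl_joined F x y l \<longrightarrow> b \<le> l)"
    using joined[OF assms(1,2)] length_dist_greatest assms(3) by (meson not_le)
  then show ?thesis using that by (auto simp: not_le)
qed

lemma dist_triangle:
  assumes "x \<in> X" "y \<in> X" "z \<in> X"
  shows "length_dist F x z \<le> length_dist F x y + length_dist F y z"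
proof (rule field_le_epsilon)
  fix e :: real assume "0 < e"
  obtain l where l: "l < length_dist F x y + e / 2" "pl_joined F x y l"
    using dist_less[OF assms(1,2), of "length_dist F x y + e / 2"] \<open>0 < e\<close> by auto
  obtain l' where l': "l' < length_dist F y z + e / 2" "pl_joined F y z l'"
    using dist_less[OF assms(2,3), of "length_dist F y z + e / 2"] \<open>0 < e\<close> by auto
  show "length_dist F x z \<le> length_dist F x y + length_dist F y z + e"
    using length_dist_le[OF pl_joined_trans[OF l(2) l'(2)]] l(1) l'(1) by linarith
qed

lemma dist_zero_iff:
  assumes "x \<in> X" "y \<in> X" shows "length_dist F x y = 0 \<longleftrightarrow> x = y"
proof
  assume "length_dist F x y = 0"
  then have "\<bar>x w - y w\<bar> \<le> 0" for w using dist_coordinate[OF assms] by metis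
  then show "x = y" by (auto simp: fun_eq_iff)
qed (use dist_refl assms in simp)

end

section \<open>The metric graph near a point\<close>

lemma vertex_point_eq_iff [simp]: "vertex_point u = vertex_point v \<longleftrightarrow> u = v"
  by (auto simp: vertex_point_def fun_eq_iff split: if_splits)

lemma edge_point_coordinates [simp]:
  "u \<noteq> v \<Longrightarrow> edge_point u v t u = 1 - t" "u \<noteq> v \<Longrightarrow> edge_point u v t v = t"
  "w \<noteq> u \<Longrightarrow> w \<noteq> v \<Longrightarrow> edge_point u v t w = 0"
  by (auto simp: edge_point_def)

lemma vertex_point_coordinates [simp]: "vertex_point u u = 1" "w \<noteq> u \<Longrightarrow> vertex_point u w = 0"
  by (auto simp: vertex_point_def)

lemma simple_graph_edge: "simple_graph V E \<Longrightarrow> {u, v} \<in> E \<Longrightarrow> u \<noteq> v \<and> u \<in> V \<and> v \<in> V"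
  unfolding simple_graph_def by (metis doubleton_eq_iff)

lemma edge_pointI: "{u, v} \<in> E \<Longrightarrow> 0 \<le> t \<Longrightarrow> t \<le> 1 \<Longrightarrow> edge_point u v t \<in> points V E"
  by (auto simp: points_def)

lemma vertex_pointI: "v \<in> V \<Longrightarrow> vertex_point v \<in> points V E"
  by (auto simp: points_def)

lemma points_mono: "V \<subseteq> V' \<Longrightarrow> E \<subseteq> E' \<Longrightarrow> points V E \<subseteq> points V' E'"
  unfolding points_def by blast

lemma points_cases:
  assumes "simple_graph V E" "z \<in> points V E"
  obtains (vertex) v where "v \<in> V" "z = vertex_point v"
  | (edge) u v t where "{u, v} \<in> E" "u \<noteq> v" "0 < t" "t < 1" "z = edge_point u v t"
proof -
  from assms(2) consider (a) v where "v \<in> V" "z = vertex_point v"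
    | (b) u v t where "{u, v} \<in> E" "0 \<le> t" "t \<le> 1" "z = edge_point u v t"
    unfolding points_def by blast
  then show thesis
  proof cases
    case (b u v t)
    note uv = simple_graph_edge[OF assms(1) b(1)]
    then show ?thesis using b vertex[of u] vertex[of v] edge[of u v t] edge_point_0 edge_point_1
      by (metis order_le_less)
  qed (rule vertex)
qed

lemma vertex_point_in_points_iff:
  assumes "simple_graph V E" shows "vertex_point v \<in> points V E \<longleftrightarrow> v \<in> V"
proof
  assume "vertex_point v \<in> points V E"
  with assms show "v \<in> V"
  proof (cases rule: points_cases)
    case (edge u w t)
    have "vertex_point v u = 1 - t" "vertex_point v w = t" using edge by auto
    then show ?thesis using edge by (auto simp: vertex_point_def split: if_splits)
  qed simp
qed (rule vertex_pointI)

text \<open>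
  A point is determined by its barycentric coordinates, and two positive coordinates already
  single out the edge. As coordinates are 1-Lipschitz, this describes small balls.
\<close>

lemma points_two_coordinates:
  assumes "simple_graph V E" "z \<in> points V E" "u \<noteq> v" "0 < z u" "0 < z v"
  obtains t where "{u, v} \<in> E" "0 < t" "t < 1" "z = edge_point u v t"
  using assms(1,2)
proof (cases rule: points_cases)
  case (vertex w)
  then show ?thesis using assms(3-5) by (auto simp: vertex_point_def split: if_splits)
next
  case (edge a b t)
  then have "u = a \<and> v = b \<or> u = b \<and> v = a"
    using assms(3-5) by (auto simp: edge_point_def split: if_splits)
  then show ?thesis using edge edge_point_commute[of a b t] that[of t] that[of "1 - t"]
    by (auto simp: insert_commute)
qed

lemma points_one_coordinate:
  assumes "simple_graph V E" "z \<in> points V E" "0 < z u" "z \<noteq> vertex_point u"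
  obtains v t where "u \<noteq> v" "{u, v} \<in> E" "0 < t" "t < 1" "z = edge_point u v t"
  using assms(1,2)
proof (cases rule: points_cases)
  case (vertex w)
  then show ?thesis using assms(3-4) by (auto simp: vertex_point_def split: if_splits)
next
  case (edge a b t)
  then consider "u = a" | "u = b"
    using assms(3) by (auto simp: edge_point_def split: if_splits)
  then show ?thesis
  proof cases
    case 1
    then show ?thesis using edge by (intro that[of b t]) auto
  next
    case 2
    then show ?thesis using edge edge_point_commute[of a b t]
      by (intro that[of a "1 - t"]) (auto simp: insert_commute)
  qed
qed

text \<open>
  The length metric of a subgraph is at most the coordinate metric, in a neighbourhood of each point.
\<close>

lemma pl_joined_near:
  assumes "simple_graph W F" "z \<in> points W F" "z' \<in> points W F"
    and "\<And>w. 0 < z w \<Longrightarrow> 0 < z' w"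
  shows "\<exists>w. pl_joined F z z' \<bar>z w - z' w\<bar>"
  using assms(1,2)
proof (cases rule: points_cases)
  case (vertex u)
  show ?thesis
  proof (cases "z' = vertex_point u")
    case True
    then show ?thesis using vertex pl_refl[of F z] by (intro exI[of _ u]) auto
  next
    case False
    have "0 < z' u" using assms(4)[of u] vertex by simp
    from points_one_coordinate[OF assms(1,3) this False] obtain v t where
      v: "u \<noteq> v" "{u, v} \<in> F" "0 < t" "t < 1" "z' = edge_point u v t"
      by blast
    have "pl_joined F (edge_point u v 0) (edge_point u v t) \<bar>0 - t\<bar>"
      by (rule pl_joined_edge) (use v in auto)
    then have "pl_joined F z z' \<bar>z v - z' v\<bar>"
      using v vertex by (simp add: edge_point_0)
    then show ?thesis by blast
  qed
next
  case (edge u v t)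
  have "0 < z' u" "0 < z' v" using assms(4)[of u] assms(4)[of v] edge by auto
  from points_two_coordinates[OF assms(1,3) edge(2) this]
  obtain t' where z': "0 < t'" "t' < 1" "z' = edge_point u v t'" by blast
  have "pl_joined F (edge_point u v t) (edge_point u v t') \<bar>t - t'\<bar>"
    by (rule pl_joined_edge) (use edge z' in auto)
  then have "pl_joined F z z' \<bar>z v - z' v\<bar>"
    using edge z' by simp
  then show ?thesis by blast
qed

text \<open>
  A curve that moves at most at unit speed has length at most the elapsed time, and it stays in whatever
  subgraph contains its points. Hence a geodesic of the graph that lies in a cycle is a geodesic of that cycle.
\<close>

lemma pl_joined_curve:
  fixes f :: "real \<Rightarrow> 'v \<Rightarrow> real"
  assumes "simple_graph W F" "a \<le> b" "f ` {a..b} \<subseteq> points W F"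
    and lip: "\<And>s t w. s \<in> {a..b} \<Longrightarrow> t \<in> {a..b} \<Longrightarrow> \<bar>f s w - f t w\<bar> \<le> \<bar>s - t\<bar>"
  shows "\<exists>l\<le>b - a. pl_joined F (f a) (f b) l"
proof -
  define P where "P = (\<lambda>s t. a \<le> s \<longrightarrow> t \<le> b \<longrightarrow> (\<exists>l\<le>t - s. pl_joined F (f s) (f t) l))"
  from assms(2) have "P a b"
  proof (induct rule: Bolzano)
    case (trans r s t)
    show ?case unfolding P_def
    proof (intro impI)
      assume "a \<le> r" "t \<le> b"
      moreover from this trans have "a \<le> s" "s \<le> b" by auto
      ultimately obtain l l' where l: "l \<le> s - r" "pl_joined F (f r) (f s) l"
        "l' \<le> t - s" "pl_joined F (f s) (f t) l'"
        using trans unfolding P_def by blast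
      show "\<exists>l\<le>t - r. pl_joined F (f r) (f t) l"
        by (rule exI[of _ "l + l'"]) (use l pl_joined_trans[OF l(2,4)] in auto)
    qed
  next
    case (local x)
    have fx: "f x \<in> points W F" using local assms(3) by auto
    have "finite {w. 0 < f x w} \<and> {w. 0 < f x w} \<noteq> {}"
      using assms(1) fx
    proof (cases rule: points_cases)
      case (vertex v)
      then have "{w. 0 < f x w} = {v}" by (auto simp: vertex_point_def)
      then show ?thesis by simp
    next
      case (edge u v t)
      then have "{w. 0 < f x w} = {u, v}" by (auto simp: edge_point_def)
      then show ?thesis by simp
    qed
    then have fin: "finite {w. 0 < f x w}" "{w. 0 < f x w} \<noteq> {}" by auto
    \<comment> \<open>Within distance \<open>d\<close> no positive coordinate of \<open>f x\<close> vanishes.\<close>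
    define d where "d = Min (f x ` {w. 0 < f x w})"
    have d: "0 < d" "\<And>w. 0 < f x w \<Longrightarrow> d \<le> f x w"
      unfolding d_def using fin by (auto intro: Min_le)
    have near: "\<exists>l\<le>\<bar>x - y\<bar>. pl_joined F (f x) (f y) l" if y: "y \<in> {a..b}" "\<bar>x - y\<bar> < d" for y
    proof -
      have xI: "x \<in> {a..b}" using local by simp
      have pos: "0 < f y w" if "0 < f x w" for w
        using lip[OF xI y(1), of w] d(2)[OF that] y(2) by linarith
      have "f y \<in> points W F" using assms(3) y by blast
      from pl_joined_near[OF assms(1) fx this pos] obtain w
        where "pl_joined F (f x) (f y) \<bar>f x w - f y w\<bar>" by blast
      then show ?thesis using lip[OF xI y(1), of w] by blast
    qed
    show ?case
    proof (intro exI[of _ d] conjI allI impI)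
      fix s t assume st: "s \<le> x \<and> x \<le> t \<and> t - s < d"
      show "P s t" unfolding P_def
      proof (intro impI)
        assume "a \<le> s" "t \<le> b"
        with st local have "s \<in> {a..b}" "\<bar>x - s\<bar> < d" "t \<in> {a..b}" "\<bar>x - t\<bar> < d" by auto
        from near[OF this(1,2)] near[OF this(3,4)] st obtain l l'
          where l: "l \<le> x - s" "pl_joined F (f x) (f s) l" "l' \<le> t - x" "pl_joined F (f x) (f t) l'"
          by auto
        show "\<exists>l\<le>t - s. pl_joined F (f s) (f t) l"
          by (rule exI[of _ "l + l'"]) (use l pl_joined_trans[OF pl_joined_sym[OF l(2)] l(4)] in auto)
      qed
    qed (rule d(1))
  qed
  then show ?thesis by (simp add: P_def)
qed

section \<open>Paths realise the distance of vertices\<close>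

lemma connected_joined:
  assumes "connected_graph V E" shows "joined_points (points V E) E"
proof
  have sg: "simple_graph V E" using assms by (simp add: connected_graph_def)
  have to_vertex: "\<exists>v\<in>V. \<exists>l. pl_joined E z (vertex_point v) l" if "z \<in> points V E" for z
    using sg that
  proof (cases rule: points_cases)
    case (vertex v)
    then show ?thesis using pl_refl by blast
  next
    case (edge u v t)
    then show ?thesis using pl_joined_edge[OF edge(1), of t 0] simple_graph_edge[OF sg edge(1)]
      by (auto simp: edge_point_0)
  qed
  fix x y assume "x \<in> points V E" "y \<in> points V E"
  then obtain u v l l' where uv: "u \<in> V" "v \<in> V" "pl_joined E x (vertex_point u) l" "pl_joined E y (vertex_point v) l'"
    using to_vertex[of x] to_vertex[of y] by blast
  obtain xs where "is_path V E xs" "hd xs = u" "last xs = v"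
    using assms uv unfolding connected_graph_def by blast
  then have "pl_joined E (vertex_point u) (vertex_point v) (real (path_length xs))"
    using pl_joined_path[of xs E] simple_graph_edge[OF sg] by (auto simp: is_path_def)
  then show "\<exists>l. pl_joined E x y l"
    using pl_joined_trans[OF pl_joined_trans[OF uv(3)] pl_joined_sym[OF uv(4)]] by blast
qed

lemma path_edges_append_single:
  "xs \<noteq> [] \<Longrightarrow> path_edges (xs @ [b]) = insert {last xs, b} (path_edges xs)"
proof -
  assume ne: "xs \<noteq> []"
  have "\<exists>i. {last xs, b} = {(xs @ [b]) ! i, (xs @ [b]) ! Suc i} \<and> Suc i < length (xs @ [b])"
    using ne by (intro exI[of _ "length xs - 1"]) (auto simp: nth_append last_conv_nth)
  moreover have "{(xs @ [b]) ! i, (xs @ [b]) ! Suc i} \<in> insert {last xs, b} (path_edges xs)"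
    if "Suc i < length (xs @ [b])" for i
  proof (cases "Suc i < length xs")
    case True
    then show ?thesis by (auto simp: path_edges_def nth_append)
  next
    case False
    with that have "i = length xs - 1" by simp
    then show ?thesis using ne by (auto simp: nth_append last_conv_nth)
  qed
  moreover have "{xs ! i, xs ! Suc i} \<in> path_edges (xs @ [b])" if "Suc i < length xs" for i
    using that unfolding path_edges_def by (force simp: nth_append)
  ultimately show ?thesis unfolding path_edges_def by blast
qed

lemma path_edges_map_upt: "path_edges (map x [0..<Suc n]) = {{x i, x (Suc i)} | i. i < n}"
proof (intro equalityI subsetI)
  fix e assume "e \<in> path_edges (map x [0..<Suc n])"
  then obtain i where "e = {map x [0..<Suc n] ! i, map x [0..<Suc n] ! Suc i}" "i < n"
    unfolding path_edges_def by auto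
  then have "e = {x i, x (Suc i)}" by (simp only: nth_map_upt) (simp add: nth_append)
  then show "e \<in> {{x i, x (Suc i)} | i. i < n}" using \<open>i < n\<close> by blast
next
  fix e assume "e \<in> {{x i, x (Suc i)} | i. i < n}"
  then obtain i where i: "e = {x i, x (Suc i)}" "i < n" by blast
  then have "e = {map x [0..<Suc n] ! i, map x [0..<Suc n] ! Suc i}"
    by (simp del: upt_Suc)
  then show "e \<in> path_edges (map x [0..<Suc n])" unfolding path_edges_def using i(2) by auto
qed

lemma is_path_segment:
  assumes "is_path V E P" "i \<le> j" "j < length P" and Q: "Q = take (Suc (j - i)) (drop i P)"
  shows "is_path V E Q"
    and "length Q = Suc (j - i)" and "\<And>k. k \<le> j - i \<Longrightarrow> Q ! k = P ! (i + k)"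
proof -
  show len: "length Q = Suc (j - i)" using assms(2,3) by (simp add: Q)
  show nth: "Q ! k = P ! (i + k)" if "k \<le> j - i" for k using that assms(2,3) by (simp add: Q)
  have "path_edges Q \<subseteq> path_edges P"
  proof
    fix e assume "e \<in> path_edges Q"
    then obtain k where k: "Suc k < length Q" "e = {Q ! k, Q ! Suc k}" unfolding path_edges_def by blast
    then have "e = {P ! (i + k), P ! Suc (i + k)}" using nth[of k] nth[of "Suc k"] len by simp
    moreover have "Suc (i + k) < length P" using k(1) len assms(2,3) by simp
    ultimately show "e \<in> path_edges P" unfolding path_edges_def by blast
  qed
  moreover have "set Q \<subseteq> set P" unfolding Q by (meson set_drop_subset set_take_subset subset_trans)
  moreover have "Q \<noteq> []" using len by auto
  moreover have "distinct Q" unfolding Q using assms(1) by (simp add: is_path_def)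
  ultimately show "is_path V E Q" using assms(1) unfolding is_path_def by auto
qed

text \<open>
  The combinatorial distance from \<open>u\<close>, extended linearly over the edges, is 1-Lipschitz along edges;
  so no curve from \<open>u\<close> to \<open>v\<close> is shorter than the shortest path.
\<close>

lemma shortest_path_exists:
  assumes "connected_graph V E" "u \<in> V" "v \<in> V"
  obtains xs where "is_path V E xs" "hd xs = u" "last xs = v"
    "real (path_length xs) \<le> length_dist E (vertex_point u) (vertex_point v)"
proof -
  interpret joined_points "points V E" E by (rule connected_joined[OF assms(1)])
  have sg: "simple_graph V E" using assms by (simp add: connected_graph_def)
  define Q where "Q = (\<lambda>w n. \<exists>xs. is_path V E xs \<and> hd xs = u \<and> last xs = w \<and> path_length xs = n)"
  define N where "N = (\<lambda>w. LEAST n. Q w n)"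
  have Q_ex: "\<exists>n. Q w n" if "w \<in> V" for w
    using assms that unfolding Q_def connected_graph_def by blast
  have QN: "Q w (N w)" if "w \<in> V" for w
    unfolding N_def using Q_ex[OF that] by (rule LeastI_ex)
  have N_le: "N b \<le> N a + 1" if ab: "{a, b} \<in> E" for a b
  proof -
    note abV = simple_graph_edge[OF sg ab]
    obtain xs where xs: "is_path V E xs" "hd xs = u" "last xs = a" "path_length xs = N a"
      using QN[of a] abV unfolding Q_def by blast
    have "\<exists>n\<le>N a + 1. Q b n"
    proof (cases "b \<in> set xs")
      case True
      then obtain i where i: "i < length xs" "xs ! i = b" by (auto simp: in_set_conv_nth)
      let ?ys = "take (Suc i) xs"
      have "path_edges ?ys \<subseteq> path_edges xs" using i by (force simp: path_edges_def)
      then have "is_path V E ?ys" using xs(1) set_take_subset[of "Suc i" xs] by (auto simp: is_path_def)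
      moreover have "hd ?ys = u" "last ?ys = b" "path_length ?ys \<le> N a + 1"
        using xs i by (auto simp: take_Suc_conv_app_nth path_length_def hd_append
          is_path_def hd_conv_nth)
      ultimately show ?thesis unfolding Q_def by blast
    next
      case False
      have "xs \<noteq> []" using xs by (simp add: is_path_def)
      then have "is_path V E (xs @ [b])" "hd (xs @ [b]) = u" "last (xs @ [b]) = b"
        using xs False abV ab by (auto simp: is_path_def path_edges_append_single)
      moreover have "path_length (xs @ [b]) = N a + 1"
        using xs \<open>xs \<noteq> []\<close> by (cases xs) (auto simp: path_length_def)
      ultimately show ?thesis unfolding Q_def by blast
    qed
    then show ?thesis unfolding N_def by (meson Least_le order_trans)
  qed
  have N_diff: "\<bar>real (N a) - real (N b)\<bar> \<le> 1" if "{a, b} \<in> E" for a b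
    using N_le[OF that] N_le[of b a] that by (simp add: insert_commute abs_le_iff)
  define \<phi> where "\<phi> = (\<lambda>z. \<Sum>w | z w \<noteq> 0. z w * real (N w))"
  have \<phi>_edge: "\<phi> (edge_point a b s) = (1 - s) * real (N a) + s * real (N b)"
    if "a \<noteq> b" "0 \<le> s" "s \<le> 1" for a b s
  proof -
    have "\<phi> (edge_point a b s) = (\<Sum>w\<in>{a, b}. edge_point a b s w * real (N w))"
      unfolding \<phi>_def by (rule sum.mono_neutral_left) (auto simp: edge_point_def)
    then show ?thesis using that by simp
  qed
  have \<phi>_vertex: "\<phi> (vertex_point w) = real (N w)" for w
  proof -
    have "{x. vertex_point w x \<noteq> 0} = {w}" by (auto simp: vertex_point_def)
    then show ?thesis by (simp add: \<phi>_def)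
  qed
  have "\<bar>\<phi> (vertex_point u) - \<phi> (vertex_point v)\<bar> \<le> l"
    if "pl_joined E (vertex_point u) (vertex_point v) l" for l
    using that
  proof (rule pl_joined_lipschitz)
    fix a b and s t :: real
    assume *: "{a, b} \<in> E" "0 \<le> s" "s \<le> 1" "0 \<le> t" "t \<le> 1"
    have "\<phi> (edge_point a b s) - \<phi> (edge_point a b t) = (s - t) * (real (N b) - real (N a))"
      using * simple_graph_edge[OF sg *(1)] by (simp add: \<phi>_edge algebra_simps)
    then have "\<bar>\<phi> (edge_point a b s) - \<phi> (edge_point a b t)\<bar> = \<bar>s - t\<bar> * \<bar>real (N b) - real (N a)\<bar>"
      by (simp add: abs_mult)
    also have "\<dots> \<le> \<bar>s - t\<bar> * 1"
      using N_diff[OF *(1)] by (intro mult_left_mono) (auto simp: abs_minus_commute)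
    finally show "\<bar>\<phi> (edge_point a b s) - \<phi> (edge_point a b t)\<bar> \<le> \<bar>s - t\<bar>" by simp
  qed
  moreover have "N u = 0"
  proof -
    have "Q u 0" unfolding Q_def using assms(2)
      by (intro exI[of _ "[u]"]) (auto simp: is_path_def path_length_def path_edges_def)
    then show ?thesis unfolding N_def by simp
  qed
  ultimately have "real (N v) \<le> l" if "pl_joined E (vertex_point u) (vertex_point v) l" for l
    using that by (fastforce simp: \<phi>_vertex)
  then have "real (N v) \<le> length_dist E (vertex_point u) (vertex_point v)"
    using joined[OF vertex_pointI vertex_pointI, OF assms(2,3)] length_dist_greatest by blast
  moreover obtain xs where "is_path V E xs" "hd xs = u" "last xs = v" "path_length xs = N v"
    using QN[OF assms(3)] unfolding Q_def by blast
  ultimately show ?thesis using that by auto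
qed

section \<open>Simple closed curves made of geodesics are cycles\<close>

lemma geodesic_triangle_rotate: "geodesic_triangle X \<rho> S1 S2 S3 \<Longrightarrow> geodesic_triangle X \<rho> S2 S3 S1"
  unfolding geodesic_triangle_def by blast

lemma geodesic_triangle_in_points: "geodesic_triangle X \<rho> S1 S2 S3 \<Longrightarrow> S1 \<subseteq> X"
  unfolding geodesic_triangle_def geodesic_between_def by (elim bexE conjE exE)

text \<open>
  At a point in the interior of an edge the curve runs through at unit speed without turning back.
  This is a local condition, so it survives concatenation as soon as it holds at the junction.
\<close>

definition straight_at :: "(real \<Rightarrow> 'v \<Rightarrow> real) \<Rightarrow> real \<Rightarrow> real \<Rightarrow> bool" where
  "straight_at f A \<tau> \<longleftrightarrow>
     (\<forall>u v s. u \<noteq> v \<longrightarrow> 0 < s \<longrightarrow> s < 1 \<longrightarrow> f \<tau> = edge_point u v s \<longrightarrow>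
        (\<exists>\<sigma>\<in>{-1, 1}. \<exists>\<eta>>0. \<forall>h. \<bar>h\<bar> < \<eta> \<longrightarrow> \<tau> + h \<in> {0..A} \<longrightarrow> f (\<tau> + h) = edge_point u v (s + \<sigma> * h)))"

lemma straight_atD:
  assumes "straight_at f A \<tau>" "u \<noteq> v" "0 < s" "s < 1" "f \<tau> = edge_point u v s"
  shows "\<exists>\<sigma>\<in>{-1, 1}. \<exists>\<eta>>0. \<forall>h. \<bar>h\<bar> < \<eta> \<longrightarrow> \<tau> + h \<in> {0..A} \<longrightarrow> f (\<tau> + h) = edge_point u v (s + \<sigma> * h)"
  using assms unfolding straight_at_def by simp

definition concat_at :: "real \<Rightarrow> (real \<Rightarrow> 'v \<Rightarrow> real) \<Rightarrow> (real \<Rightarrow> 'v \<Rightarrow> real) \<Rightarrow> real \<Rightarrow> 'v \<Rightarrow> real" where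
  "concat_at A f g t = (if t \<le> A then f t else g (t - A))"

lemma concat_at_image:
  assumes "0 \<le> A" "0 \<le> B" "f A = g 0"
  shows "concat_at A f g ` {0..A + B} = f ` {0..A} \<union> g ` {0..B}"
proof (intro equalityI subsetI)
  fix z assume "z \<in> concat_at A f g ` {0..A + B}"
  then obtain t where t: "t \<in> {0..A + B}" "z = concat_at A f g t" by blast
  show "z \<in> f ` {0..A} \<union> g ` {0..B}"
  proof (cases "t \<le> A")
    case True
    then show ?thesis using t by (auto simp: concat_at_def)
  next
    case False
    then have "t - A \<in> {0..B}" "z = g (t - A)" using t by (auto simp: concat_at_def)
    then show ?thesis by blast
  qed
next
  fix z assume "z \<in> f ` {0..A} \<union> g ` {0..B}"
  then consider t where "t \<in> {0..A}" "z = f t" | t where "t \<in> {0..B}" "z = g t" by blast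
  then show "z \<in> concat_at A f g ` {0..A + B}"
  proof cases
    case (1 t)
    then show ?thesis using assms by (intro image_eqI[of _ _ t]) (auto simp: concat_at_def)
  next
    case (2 t)
    then show ?thesis using assms by (intro image_eqI[of _ _ "t + A"]) (auto simp: concat_at_def)
  qed
qed

lemma concat_at_cases:
  assumes "0 \<le> t" "t < A + B"
  obtains "t \<le> A" "concat_at A f g t = f t"
  | "0 < t - A" "t - A < B" "concat_at A f g t = g (t - A)"
  using assms by (cases "t \<le> A") (auto simp: concat_at_def)

lemma concat_at_start: "0 \<le> A \<Longrightarrow> concat_at A f g 0 = f 0"
  by (simp add: concat_at_def)

lemma concat_at_end: "0 \<le> B \<Longrightarrow> f A = g 0 \<Longrightarrow> concat_at A f g (A + B) = g B"
  by (auto simp: concat_at_def)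

locale metric_graph =
  fixes V :: "'v set" and E :: "'v set set"
  assumes connected: "connected_graph V E"
begin

sublocale joined_points "points V E" E
  by (rule connected_joined[OF connected])

abbreviation "X \<equiv> points V E"
abbreviation "d \<equiv> length_dist E"

lemma simple: "simple_graph V E"
  using connected by (simp add: connected_graph_def)

definition isometric :: "(real \<Rightarrow> 'v \<Rightarrow> real) \<Rightarrow> real \<Rightarrow> bool" where
  "isometric f A \<longleftrightarrow> 0 \<le> A \<and> f ` {0..A} \<subseteq> X \<and> (\<forall>s\<in>{0..A}. \<forall>t\<in>{0..A}. d (f s) (f t) = \<bar>s - t\<bar>)"

text \<open>Injectivity leaves out the end of the interval so that closed curves are included.\<close>

definition simple_arc :: "(real \<Rightarrow> 'v \<Rightarrow> real) \<Rightarrow> real \<Rightarrow> bool" where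
  "simple_arc f A \<longleftrightarrow> 0 \<le> A \<and> f ` {0..A} \<subseteq> X \<and>
     (\<forall>s\<in>{0..A}. \<forall>t\<in>{0..A}. \<forall>w. \<bar>f s w - f t w\<bar> \<le> \<bar>s - t\<bar>) \<and>
     inj_on f {0..<A} \<and> (\<forall>\<tau>\<in>{0..A}. straight_at f A \<tau>)"

text \<open>
  Near an inner point of an edge the position along that edge is an isometric function of time, hence
  of slope \<open>1\<close> or \<open>-1\<close>.
\<close>

lemma isometric_straight_at:
  assumes f: "isometric f A" and \<tau>: "\<tau> \<in> {0..A}"
  shows "straight_at f A \<tau>"
  unfolding straight_at_def
proof (intro allI impI)
  fix u v s assume uv: "u \<noteq> v" "0 < s" "s < 1" "f \<tau> = edge_point u v s"
  define \<eta> where "\<eta> = min s (1 - s)"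
  have X: "f t \<in> X" if "t \<in> {0..A}" for t using f that by (auto simp: isometric_def)
  have D: "d (f t) (f t') = \<bar>t - t'\<bar>" if "t \<in> {0..A}" "t' \<in> {0..A}" for t t'
    using f that by (auto simp: isometric_def)
  have on_edge: "{u, v} \<in> E \<and> 0 < f (\<tau> + h) v \<and> f (\<tau> + h) v < 1 \<and> f (\<tau> + h) = edge_point u v (f (\<tau> + h) v)"
    if h: "\<bar>h\<bar> < \<eta>" "\<tau> + h \<in> {0..A}" for h
  proof -
    have "\<bar>f \<tau> w - f (\<tau> + h) w\<bar> \<le> \<bar>h\<bar>" for w
      using dist_coordinate[OF X[OF \<tau>] X[OF h(2)], of w] D[OF \<tau> h(2)] by simp
    from this[of u] this[of v] have "0 < f (\<tau> + h) u" "0 < f (\<tau> + h) v"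
      using uv h(1) unfolding \<eta>_def by auto
    from points_two_coordinates[OF simple X[OF h(2)] uv(1) this] obtain t
      where "{u, v} \<in> E" "0 < t" "t < 1" "f (\<tau> + h) = edge_point u v t" by blast
    then show ?thesis using uv(1) by simp
  qed
  define r where "r = (\<lambda>h. f (\<tau> + h) v)"
  have r: "\<bar>r h - r h'\<bar> = \<bar>h - h'\<bar>"
    if h: "\<bar>h\<bar> < \<eta>" "\<tau> + h \<in> {0..A}" and h': "\<bar>h'\<bar> < \<eta>" "\<tau> + h' \<in> {0..A}" for h h'
  proof -
    have "pl_joined E (edge_point u v (r h)) (edge_point u v (r h')) \<bar>r h - r h'\<bar>"
      by (rule pl_joined_edge) (use on_edge[OF h] on_edge[OF h'] in \<open>auto simp: r_def\<close>)
    then have "pl_joined E (f (\<tau> + h)) (f (\<tau> + h')) \<bar>r h - r h'\<bar>"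
      using on_edge[OF h] on_edge[OF h'] by (metis r_def)
    then have "d (f (\<tau> + h)) (f (\<tau> + h')) \<le> \<bar>r h - r h'\<bar>" by (rule length_dist_le)
    moreover have "\<bar>r h - r h'\<bar> \<le> d (f (\<tau> + h)) (f (\<tau> + h'))"
      unfolding r_def by (rule dist_coordinate[OF X[OF h(2)] X[OF h'(2)]])
    ultimately show ?thesis using D[OF h(2) h'(2)] by simp
  qed
  have \<eta>: "0 < \<eta>" using uv by (auto simp: \<eta>_def)
  have r0: "r 0 = s" using uv by (simp add: r_def)
  have ex: "\<exists>\<sigma>\<in>{-1, 1}. \<forall>h. \<bar>h\<bar> < \<eta> \<longrightarrow> \<tau> + h \<in> {0..A} \<longrightarrow> r h = s + \<sigma> * h"
  proof (cases "\<exists>h. \<bar>h\<bar> < \<eta> \<and> \<tau> + h \<in> {0..A} \<and> h \<noteq> 0 \<and> r h = s + h")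
    case True
    then obtain k where k: "\<bar>k\<bar> < \<eta>" "\<tau> + k \<in> {0..A}" "k \<noteq> 0" "r k = s + k" by blast
    have "r h = s + h" if "\<bar>h\<bar> < \<eta>" "\<tau> + h \<in> {0..A}" for h
      using r[OF that k(1,2)] r[OF that, of 0] r0 \<tau> \<eta> k(3,4) by (auto simp: abs_if split: if_splits)
    then show ?thesis by auto
  next
    case False
    have "r h = s - h" if "\<bar>h\<bar> < \<eta>" "\<tau> + h \<in> {0..A}" for h
      using r[OF that, of 0] r0 \<tau> \<eta> False that by (auto simp: abs_if split: if_splits)
    then show ?thesis by auto
  qed
  then obtain \<sigma> where "\<sigma> \<in> {-1, 1}" "\<And>h. \<bar>h\<bar> < \<eta> \<Longrightarrow> \<tau> + h \<in> {0..A} \<Longrightarrow> r h = s + \<sigma> * h" by blast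
  moreover from this have "f (\<tau> + h) = edge_point u v (s + \<sigma> * h)" if "\<bar>h\<bar> < \<eta>" "\<tau> + h \<in> {0..A}" for h
    using on_edge[OF that] that by (metis r_def)
  ultimately show "\<exists>\<sigma>\<in>{-1, 1}. \<exists>\<eta>>0. \<forall>h. \<bar>h\<bar> < \<eta> \<longrightarrow> \<tau> + h \<in> {0..A} \<longrightarrow> f (\<tau> + h) = edge_point u v (s + \<sigma> * h)"
    using \<eta> by blast
qed

lemma isometric_in: "isometric f A \<Longrightarrow> t \<in> {0..A} \<Longrightarrow> f t \<in> X"
  by (auto simp: isometric_def)

lemma isometric_dist: "isometric f A \<Longrightarrow> s \<in> {0..A} \<Longrightarrow> t \<in> {0..A} \<Longrightarrow> d (f s) (f t) = \<bar>s - t\<bar>"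
  by (auto simp: isometric_def)

lemma isometric_inj:
  assumes "isometric f A" shows "inj_on f {0..A}"
proof (rule inj_onI)
  fix s t assume st: "s \<in> {0..A}" "t \<in> {0..A}" "f s = f t"
  then have "d (f s) (f t) = 0" using isometric_in[OF assms] by (simp add: dist_refl)
  then show "s = t" using isometric_dist[OF assms st(1,2)] by simp
qed

lemma isometric_simple_arc:
  assumes "isometric f A" shows "simple_arc f A"
  unfolding simple_arc_def
proof (intro conjI ballI allI)
  fix s t w assume st: "s \<in> {0..A}" "t \<in> {0..A}"
  then show "\<bar>f s w - f t w\<bar> \<le> \<bar>s - t\<bar>"
    using dist_coordinate[of "f s" "f t" w] isometric_in[OF assms] isometric_dist[OF assms st] by simp
next
  show "inj_on f {0..<A}" using isometric_inj[OF assms] by (rule inj_on_subset) auto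
qed (use assms isometric_straight_at in \<open>auto simp: isometric_def\<close>)

text \<open>
  If the junction lies inside an edge, the second piece has to leave in the direction in which the
  first one arrives, since otherwise the two would overlap.
\<close>

lemma simple_arc_concat:
  assumes f: "isometric f A" and g: "simple_arc g B" and fg: "f A = g 0"
    and disj: "\<And>s t. s \<in> {0..A} \<Longrightarrow> t \<in> {0..<B} \<Longrightarrow> f s = g t \<Longrightarrow> s = A"
  shows "simple_arc (concat_at A f g) (A + B)"
  unfolding simple_arc_def
proof (intro conjI ballI allI)
  let ?c = "concat_at A f g"
  note fa = isometric_simple_arc[OF f]
  have A: "0 \<le> A" and B: "0 \<le> B" using f g by (auto simp: isometric_def simple_arc_def)
  have cf: "?c t = f t" if "t \<le> A" for t using that by (simp add: concat_at_def)
  have cg: "?c t = g (t - A)" if "A \<le> t" for t using that fg by (auto simp: concat_at_def)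
  show "0 \<le> A + B" using A B by simp
  show "?c ` {0..A + B} \<subseteq> X"
    using concat_at_image[of A B f g, OF A B fg] fa g by (auto simp: simple_arc_def)
  have lf: "\<bar>f s w - f t w\<bar> \<le> \<bar>s - t\<bar>" if "s \<in> {0..A}" "t \<in> {0..A}" for s t w
    using fa that by (auto simp: simple_arc_def)
  have lg: "\<bar>g s w - g t w\<bar> \<le> \<bar>s - t\<bar>" if "s \<in> {0..B}" "t \<in> {0..B}" for s t w
    using g that by (auto simp: simple_arc_def)
  have le: "\<bar>?c s w - ?c t w\<bar> \<le> t - s" if st: "0 \<le> s" "s \<le> t" "t \<le> A + B" for s t w
  proof -
    consider "t \<le> A" | "A \<le> s" | "s \<le> A" "A \<le> t" by linarith
    then show ?thesis
    proof cases
      case 1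
      then show ?thesis using lf[of s t w] st by (simp add: cf)
    next
      case 2
      then show ?thesis using lg[of "s - A" "t - A" w] st by (simp add: cg)
    next
      case 3
      then show ?thesis using lf[of s A w] lg[of 0 "t - A" w] st A by (simp add: cf cg fg)
    qed
  qed
  show "\<bar>?c s w - ?c t w\<bar> \<le> \<bar>s - t\<bar>" if "s \<in> {0..A + B}" "t \<in> {0..A + B}" for s t w
    using le[of s t w] le[of t s w] that by (cases "s \<le> t") (auto simp: abs_minus_commute)
  have gi: "inj_on g {0..<B}" using g by (simp add: simple_arc_def)
  have cross: False if "s \<in> {0..A}" "t \<in> {A<..<A + B}" "f s = g (t - A)" for s t
  proof -
    have "s = A" using disj[of s "t - A"] that by auto
    then have "g 0 = g (t - A)" using that fg by simp
    then show False using inj_onD[OF gi, of 0 "t - A"] that by auto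
  qed
  show "inj_on ?c {0..<A + B}"
  proof (rule inj_onI)
    fix s t assume st: "s \<in> {0..<A + B}" "t \<in> {0..<A + B}" "?c s = ?c t"
    consider "s \<le> A" "t \<le> A" | "A < s" "A < t" | "s \<le> A" "A < t" | "A < s" "t \<le> A" by linarith
    then show "s = t"
    proof cases
      case 1
      then show ?thesis using inj_onD[OF isometric_inj[OF f], of s t] st by (simp add: cf)
    next
      case 2
      then show ?thesis using inj_onD[OF gi, of "s - A" "t - A"] st by (simp add: cg)
    next
      case 3
      then show ?thesis using cross[of s t] st by (simp add: cf cg)
    next
      case 4
      then show ?thesis using cross[of t s] st by (simp add: cf cg)
    qed
  qed
  fix \<tau> assume \<tau>: "\<tau> \<in> {0..A + B}"
  show "straight_at ?c (A + B) \<tau>"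
    unfolding straight_at_def
  proof (intro allI impI)
    fix u v s assume uv: "u \<noteq> v" "0 < s" "s < 1" "?c \<tau> = edge_point u v s"
    have fs: "\<exists>\<sigma>\<in>{-1, 1}. \<exists>\<eta>>0. \<forall>h. \<bar>h\<bar> < \<eta> \<longrightarrow> \<tau> + h \<in> {0..A} \<longrightarrow> f (\<tau> + h) = edge_point u v (s + \<sigma> * h)"
      if "\<tau> \<le> A"
      using isometric_straight_at[OF f, of \<tau>] that \<tau> uv cf[OF that] unfolding straight_at_def by auto
    have gs: "\<exists>\<sigma>\<in>{-1, 1}. \<exists>\<eta>>0. \<forall>h. \<bar>h\<bar> < \<eta> \<longrightarrow> \<tau> - A + h \<in> {0..B} \<longrightarrow> g (\<tau> - A + h) = edge_point u v (s + \<sigma> * h)"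
      if "A \<le> \<tau>"
    proof -
      have "straight_at g B (\<tau> - A)" using g that \<tau> by (auto simp: simple_arc_def)
      then show ?thesis using that \<tau> uv cg[OF that] unfolding straight_at_def by auto
    qed
    let ?goal = "\<exists>\<sigma>\<in>{-1, 1}. \<exists>\<eta>>0. \<forall>h. \<bar>h\<bar> < \<eta> \<longrightarrow> \<tau> + h \<in> {0..A + B} \<longrightarrow> ?c (\<tau> + h) = edge_point u v (s + \<sigma> * h)"
    have from_f: ?goal if \<tau>A: "\<tau> \<le> A" "\<tau> < A \<or> B = 0"
    proof -
      obtain \<sigma> \<eta> where *: "\<sigma> \<in> {-1, 1}" "0 < \<eta>"
        "\<And>h. \<bar>h\<bar> < \<eta> \<Longrightarrow> \<tau> + h \<in> {0..A} \<Longrightarrow> f (\<tau> + h) = edge_point u v (s + \<sigma> * h)"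
        using fs[OF \<tau>A(1)] by blast
      define \<eta>' where "\<eta>' = (if B = 0 then \<eta> else min \<eta> (A - \<tau>))"
      have "0 < \<eta>'" using * \<tau>A by (auto simp: \<eta>'_def)
      moreover have "?c (\<tau> + h) = edge_point u v (s + \<sigma> * h)" if "\<bar>h\<bar> < \<eta>'" "\<tau> + h \<in> {0..A + B}" for h
      proof -
        have "\<bar>h\<bar> < \<eta>" "\<tau> + h \<in> {0..A}" using that B by (auto simp: \<eta>'_def split: if_splits)
        then show ?thesis using *(3)[of h] cf[of "\<tau> + h"] by simp
      qed
      ultimately show ?thesis using *(1) by blast
    qed
    have from_g: ?goal if \<tau>A: "A \<le> \<tau>" "A < \<tau> \<or> A = 0"
    proof -
      obtain \<sigma> \<eta> where *: "\<sigma> \<in> {-1, 1}" "0 < \<eta>"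
        "\<And>h. \<bar>h\<bar> < \<eta> \<Longrightarrow> \<tau> - A + h \<in> {0..B} \<Longrightarrow> g (\<tau> - A + h) = edge_point u v (s + \<sigma> * h)"
        using gs[OF \<tau>A(1)] by blast
      define \<eta>' where "\<eta>' = (if A = 0 then \<eta> else min \<eta> (\<tau> - A))"
      have "0 < \<eta>'" using * \<tau>A by (auto simp: \<eta>'_def)
      moreover have "?c (\<tau> + h) = edge_point u v (s + \<sigma> * h)" if "\<bar>h\<bar> < \<eta>'" "\<tau> + h \<in> {0..A + B}" for h
      proof -
        have "\<bar>h\<bar> < \<eta>" "\<tau> - A + h \<in> {0..B}" using that A \<open>A \<le> \<tau>\<close> by (auto simp: \<eta>'_def split: if_splits)
        then show ?thesis using *(3)[of h] cg[of "\<tau> + h"] by (simp add: algebra_simps)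
      qed
      ultimately show ?thesis using *(1) by blast
    qed
    have junction: ?goal if \<tau>A: "\<tau> = A" "0 < A" "0 < B"
    proof -
      obtain \<sigma> \<eta> where *: "\<sigma> \<in> {-1, 1}" "0 < \<eta>"
        "\<And>h. \<bar>h\<bar> < \<eta> \<Longrightarrow> A + h \<in> {0..A} \<Longrightarrow> f (A + h) = edge_point u v (s + \<sigma> * h)"
        using fs[unfolded \<tau>A(1), OF order_refl] by blast
      obtain \<sigma>' \<eta>' where **: "\<sigma>' \<in> {-1, 1}" "0 < \<eta>'"
        "\<And>h. \<bar>h\<bar> < \<eta>' \<Longrightarrow> h \<in> {0..B} \<Longrightarrow> g h = edge_point u v (s + \<sigma>' * h)"
        using gs[unfolded \<tau>A(1) diff_self add_0_left, OF order_refl] by blast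
      have "\<sigma> = \<sigma>'"
      proof (rule ccontr)
        assume "\<sigma> \<noteq> \<sigma>'"
        then have "\<sigma>' = - \<sigma>" using *(1) **(1) by auto
        define k where "k = min (min \<eta> \<eta>') (min A B) / 2"
        have k: "0 < k" "k < \<eta>" "k < \<eta>'" "k < A" "k < B"
          using \<tau>A *(2) **(2) unfolding k_def by (auto simp: min_def)
        have "f (A + - k) = g k"
          using *(3)[of "- k"] **(3)[of k] k \<open>\<sigma>' = - \<sigma>\<close> by simp
        then show False using disj[of "A + - k" k] k by auto
      qed
      have "?c (\<tau> + h) = edge_point u v (s + \<sigma> * h)" if "\<bar>h\<bar> < min \<eta> \<eta>'" "\<tau> + h \<in> {0..A + B}" for h
      proof (cases "h \<le> 0")
        case True
        then have "?c (\<tau> + h) = f (A + h)" using cf[of "A + h"] \<tau>A(1) by simp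
        also have "\<dots> = edge_point u v (s + \<sigma> * h)" using *(3)[of h] that True \<tau>A(1) by simp
        finally show ?thesis .
      next
        case False
        then have "?c (\<tau> + h) = g h" using cg[of "A + h"] \<tau>A(1) by simp
        also have "\<dots> = edge_point u v (s + \<sigma> * h)"
          using **(3)[of h] that False \<tau>A(1) \<open>\<sigma> = \<sigma>'\<close> by simp
        finally show ?thesis .
      qed
      moreover have "0 < min \<eta> \<eta>'" using *(2) **(2) by simp
      ultimately show ?thesis using *(1) by blast
    qed
    show ?goal
    proof -
      consider "\<tau> \<le> A \<and> (\<tau> < A \<or> B = 0)" | "A \<le> \<tau> \<and> (A < \<tau> \<or> A = 0)" | "\<tau> = A \<and> 0 < A \<and> 0 < B"
        using A B by linarith
      then show ?thesis using from_f from_g junction by cases blast+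
    qed
  qed
qed

text \<open>
  A curve that has just left the vertex \<open>u\<close> is inside an edge at \<open>u\<close>, with a locally constant other
  end and a locally constant direction; by connectedness it traverses that edge completely.
\<close>

lemma simple_arc_edge:
  assumes f: "simple_arc f L" and t: "0 \<le> t" "t < L" and ft: "f t = vertex_point u" and fL: "f L = vertex_point w"
  shows "t + 1 \<le> L \<and> (\<exists>v. {u, v} \<in> E \<and> (\<forall>h\<in>{0..1}. f (t + h) = edge_point u v h))"
proof -
  have X: "f s \<in> X" if "s \<in> {0..L}" for s using f that by (auto simp: simple_arc_def)
  have lip: "\<bar>f s z - f s' z\<bar> \<le> \<bar>s - s'\<bar>" if "s \<in> {0..L}" "s' \<in> {0..L}" for s s' z
    using f that by (auto simp: simple_arc_def)
  define T where "T = min (t + 1) L"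
  define I where "I = {t<..<T}"
  have T: "t < T" "T \<le> t + 1" "T \<le> L" using t by (auto simp: T_def)
  define G where "G = (\<lambda>\<tau> (v, \<sigma>, c). u \<noteq> v \<and> {u, v} \<in> E \<and> \<sigma> \<in> {-1, 1::real} \<and>
    (\<exists>\<eta>>0. \<forall>\<tau>'\<in>I. \<bar>\<tau>' - \<tau>\<bar> < \<eta> \<longrightarrow> f \<tau>' = edge_point u v (c + \<sigma> * \<tau>')))"
  have inner: "\<exists>v s. u \<noteq> v \<and> {u, v} \<in> E \<and> 0 < s \<and> s < 1 \<and> f \<tau> = edge_point u v s" if \<tau>: "\<tau> \<in> I" for \<tau>
  proof -
    have \<tau>L: "\<tau> \<in> {0..L}" "\<tau> \<noteq> t" using \<tau> T t by (auto simp: I_def)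
    have "0 < f \<tau> u" using lip[OF \<tau>L(1), of t u] ft t T \<tau> by (auto simp: I_def)
    moreover have "f \<tau> \<noteq> vertex_point u"
    proof
      assume "f \<tau> = vertex_point u"
      moreover have "inj_on f {0..<L}" using f by (simp add: simple_arc_def)
      ultimately show False using ft t T \<tau> inj_onD[of f "{0..<L}" \<tau> t] by (auto simp: I_def)
    qed
    ultimately obtain v s where "u \<noteq> v" "{u, v} \<in> E" "0 < s" "s < 1" "f \<tau> = edge_point u v s"
      using points_one_coordinate[OF simple X[OF \<tau>L(1)]] by blast
    then show ?thesis by blast
  qed
  have G_ex: "\<exists>x. G \<tau> x" if \<tau>: "\<tau> \<in> I" for \<tau>
  proof -
    obtain v s where v: "u \<noteq> v" "{u, v} \<in> E" "0 < s" "s < 1" "f \<tau> = edge_point u v s"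
      using inner[OF \<tau>] by blast
    have "\<tau> \<in> {0..L}" using \<tau> T t by (simp add: I_def)
    then have "straight_at f L \<tau>" using f by (simp add: simple_arc_def)
    then obtain \<sigma> \<eta> where \<sigma>: "\<sigma> \<in> {-1, 1}" "0 < \<eta>"
      "\<And>h. \<bar>h\<bar> < \<eta> \<Longrightarrow> \<tau> + h \<in> {0..L} \<Longrightarrow> f (\<tau> + h) = edge_point u v (s + \<sigma> * h)"
      using straight_atD[of f L \<tau> u v s] v by blast
    have "f \<tau>' = edge_point u v (s - \<sigma> * \<tau> + \<sigma> * \<tau>')" if "\<tau>' \<in> I" "\<bar>\<tau>' - \<tau>\<bar> < \<eta>" for \<tau>'
    proof -
      have "\<tau> + (\<tau>' - \<tau>) \<in> {0..L}" using that t T by (simp add: I_def)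
      moreover have "s - \<sigma> * \<tau> + \<sigma> * \<tau>' = s + \<sigma> * (\<tau>' - \<tau>)" by (simp add: right_diff_distrib)
      moreover have "f \<tau>' = f (\<tau> + (\<tau>' - \<tau>))" by simp
      ultimately show ?thesis using \<sigma>(3)[OF that(2)] by (simp only:)
    qed
    then have "\<exists>\<eta>>0. \<forall>\<tau>'\<in>I. \<bar>\<tau>' - \<tau>\<bar> < \<eta> \<longrightarrow> f \<tau>' = edge_point u v (s - \<sigma> * \<tau> + \<sigma> * \<tau>')"
      using \<sigma>(2) by blast
    then have "G \<tau> (v, \<sigma>, s - \<sigma> * \<tau>)" using v(1,2) \<sigma>(1) unfolding G_def prod.case by blast
    then show ?thesis by blast
  qed
  \<comment> \<open>The triple \<open>(v, \<sigma>, c)\<close> is the germ of the curve: the edge it is on, and its position there as an affine function of time.\<close>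
  have G_uniq: "x = y" if \<tau>: "\<tau> \<in> I" and x: "G \<tau> x" and y: "G \<tau> y" for \<tau> x y
  proof -
    obtain v \<sigma> c where x': "x = (v, \<sigma>, c)" by (cases x) auto
    obtain v' \<sigma>' c' where y': "y = (v', \<sigma>', c')" by (cases y) auto
    obtain \<eta> \<eta>' where e: "0 < \<eta>" "0 < \<eta>'"
      "\<And>\<tau>'. \<tau>' \<in> I \<Longrightarrow> \<bar>\<tau>' - \<tau>\<bar> < \<eta> \<Longrightarrow> f \<tau>' = edge_point u v (c + \<sigma> * \<tau>')"
      "\<And>\<tau>'. \<tau>' \<in> I \<Longrightarrow> \<bar>\<tau>' - \<tau>\<bar> < \<eta>' \<Longrightarrow> f \<tau>' = edge_point u v' (c' + \<sigma>' * \<tau>')"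
      using x y unfolding x' y' G_def by auto
    have uv: "u \<noteq> v" "u \<noteq> v'" using x y unfolding x' y' G_def by auto
    obtain b s where b: "u \<noteq> b" "0 < s" "s < 1" "f \<tau> = edge_point u b s"
      using inner[OF \<tau>] by blast
    have "v = b"
      using e(1,3) \<tau> b uv edge_point_coordinates(3)[of b u v "c + \<sigma> * \<tau>"] edge_point_coordinates(2)[of u b s]
      by (metis abs_zero cancel_comm_monoid_add_class.diff_cancel less_irrefl)
    moreover have "v' = b"
      using e(2,4) \<tau> b uv edge_point_coordinates(3)[of b u v' "c' + \<sigma>' * \<tau>"] edge_point_coordinates(2)[of u b s]
      by (metis abs_zero cancel_comm_monoid_add_class.diff_cancel less_irrefl)
    ultimately have vv: "v' = v" by simp
    have eq: "c + \<sigma> * \<tau>' = c' + \<sigma>' * \<tau>'" if "\<tau>' \<in> I" "\<bar>\<tau>' - \<tau>\<bar> < \<eta>" "\<bar>\<tau>' - \<tau>\<bar> < \<eta>'" for \<tau>'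
      using e(3)[OF that(1,2)] e(4)[OF that(1,3)] edge_point_coordinates(2)[OF uv(1)] unfolding vv by metis
    define k where "k = min (min \<eta> \<eta>') (T - \<tau>) / 2"
    have k: "0 < k" "k < \<eta>" "k < \<eta>'" "\<tau> + k < T"
    proof -
      have "0 < k" using e(1,2) \<tau> by (simp add: I_def k_def)
      moreover have "2 * k \<le> \<eta>" "2 * k \<le> \<eta>'" "2 * k \<le> T - \<tau>" unfolding k_def by simp_all
      ultimately show "0 < k" "k < \<eta>" "k < \<eta>'" "\<tau> + k < T" by linarith+
    qed
    have "c + \<sigma> * \<tau> = c' + \<sigma>' * \<tau>" using eq[of \<tau>] \<tau> e by simp
    moreover have "c + \<sigma> * (\<tau> + k) = c' + \<sigma>' * (\<tau> + k)" using eq[of "\<tau> + k"] \<tau> k by (auto simp: I_def)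
    ultimately have "\<sigma> * k = \<sigma>' * k" unfolding distrib_left by linarith
    then have "\<sigma> = \<sigma>'" using k by simp
    with \<open>c + \<sigma> * \<tau> = c' + \<sigma>' * \<tau>\<close> show ?thesis by (simp add: x' y' vv)
  qed
  define F where "F = (\<lambda>\<tau>. SOME x. G \<tau> x)"
  have F: "G \<tau> (F \<tau>)" if "\<tau> \<in> I" for \<tau> unfolding F_def using G_ex[OF that] by (rule someI_ex)
  have loc: "\<forall>a\<in>I. eventually (\<lambda>b. F a = F b) (at a within I)"
  proof
    fix a assume a: "a \<in> I"
    obtain v \<sigma> c where x: "F a = (v, \<sigma>, c)" by (cases "F a") auto
    from F[OF a] obtain \<eta> where \<eta>: "0 < \<eta>"
      "\<And>\<tau>'. \<tau>' \<in> I \<Longrightarrow> \<bar>\<tau>' - a\<bar> < \<eta> \<Longrightarrow> f \<tau>' = edge_point u v (c + \<sigma> * \<tau>')"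
      unfolding x G_def by auto
    have "F a = F b" if b: "b \<in> I" "\<bar>b - a\<bar> < \<eta>" for b
    proof -
      have "\<forall>\<tau>'\<in>I. \<bar>\<tau>' - b\<bar> < \<eta> - \<bar>b - a\<bar> \<longrightarrow> f \<tau>' = edge_point u v (c + \<sigma> * \<tau>')"
        using \<eta>(2) by (smt (verit))
      then have "\<exists>\<eta>>0. \<forall>\<tau>'\<in>I. \<bar>\<tau>' - b\<bar> < \<eta> \<longrightarrow> f \<tau>' = edge_point u v (c + \<sigma> * \<tau>')"
        using b by (intro exI[of _ "\<eta> - \<bar>b - a\<bar>"]) auto
      then have "G b (v, \<sigma>, c)" using F[OF a] unfolding x G_def by auto
      then show ?thesis using G_uniq[OF b(1) _ F[OF b(1)]] x by simp
    qed
    then show "eventually (\<lambda>b. F a = F b) (at a within I)"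
      unfolding eventually_at using \<eta>(1) by (auto simp: dist_real_def)
  qed
  define m where "m = (t + T) / 2"
  have m: "m \<in> I" using T by (auto simp: m_def I_def)
  obtain v \<sigma> c where vc: "F m = (v, \<sigma>, c)" by (cases "F m") auto
  have conI: "connected I" unfolding I_def by (rule connected_Ioo)
  have "F \<tau> = (v, \<sigma>, c)" if "\<tau> \<in> I" for \<tau>
    using connected_local_const[OF conI that m loc] vc by simp
  then have G: "G \<tau> (v, \<sigma>, c)" if "\<tau> \<in> I" for \<tau> using F[OF that] that by simp
  have v: "u \<noteq> v" "{u, v} \<in> E" "\<sigma> \<in> {-1, 1}" using G[OF m] unfolding G_def by auto
  have fI: "f \<tau> = edge_point u v (c + \<sigma> * \<tau>)" if "\<tau> \<in> I" for \<tau>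
    using G[OF that] that unfolding G_def by force
  have bounds: "0 < c + \<sigma> * \<tau>" "c + \<sigma> * \<tau> \<le> \<tau> - t" if \<tau>: "\<tau> \<in> I" for \<tau>
  proof -
    obtain b s where b: "u \<noteq> b" "0 < s" "s < 1" "f \<tau> = edge_point u b s"
      using inner[OF \<tau>] by blast
    have "f \<tau> u = 1 - s" using b(1,4) by simp
    moreover have "f \<tau> u = 1 - (c + \<sigma> * \<tau>)" using fI[OF \<tau>] v(1) by simp
    ultimately have "c + \<sigma> * \<tau> = s" by simp
    then show "0 < c + \<sigma> * \<tau>" using b by simp
    have "\<bar>f \<tau> v - f t v\<bar> \<le> \<bar>\<tau> - t\<bar>" by (rule lip) (use \<tau> t T in \<open>auto simp: I_def\<close>)
    then show "c + \<sigma> * \<tau> \<le> \<tau> - t" using fI[OF \<tau>] v ft \<tau> by (auto simp: I_def)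
  qed
  have \<sigma>: "\<sigma> = 1"
  proof (rule ccontr)
    assume "\<sigma> \<noteq> 1"
    then have "\<sigma> = -1" using v by auto
    have "t + (T - t) / 8 \<in> I" using T by (auto simp: I_def field_simps)
    from bounds(2)[OF this] bounds(1)[OF m] show False
      using T unfolding \<open>\<sigma> = -1\<close> m_def by (simp add: field_simps)
  qed
  have c: "c = - t"
  proof (rule ccontr)
    assume "c \<noteq> - t"
    moreover have "c \<le> - t" using bounds(2)[OF m] \<sigma> by simp
    ultimately have ct: "c < - t" by simp
    define k where "k = min (T - t) (- t - c) / 2"
    have "0 < k" using T ct by (simp add: k_def)
    moreover have "2 * k \<le> T - t" "2 * k \<le> - t - c" unfolding k_def by simp_all
    ultimately have k: "0 < k" "t + k < T" "c + (t + k) < 0" by linarith+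
    then show False using bounds(1)[of "t + k"] \<sigma> by (auto simp: I_def)
  qed
  have fI': "f \<tau> = edge_point u v (\<tau> - t)" if "\<tau> \<in> I" for \<tau> using fI[OF that] \<sigma> c by simp
  have fT: "f T = edge_point u v (T - t)"
  proof
    fix z
    have "\<bar>f T z - edge_point u v (T - t) z\<bar> \<le> 0 + e" if e: "0 < e" for e
    proof -
      define k where "k = min (T - t) e / 2"
      have "0 < k" using T e by (simp add: k_def)
      moreover have "2 * k \<le> T - t" "2 * k \<le> e" unfolding k_def by simp_all
      ultimately have k: "0 < k" "t < T - k" "2 * k \<le> e" by linarith+
      then have kI: "T - k \<in> I" by (auto simp: I_def)
      have "\<bar>f T z - f (T - k) z\<bar> \<le> \<bar>T - (T - k)\<bar>" by (rule lip) (use t T k in auto)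
      moreover have "\<bar>f (T - k) z - edge_point u v (T - t) z\<bar> \<le> k"
        using fI'[OF kI] k v by (auto simp: edge_point_def)
      ultimately show ?thesis using k by simp
    qed
    then have "\<bar>f T z - edge_point u v (T - t) z\<bar> \<le> 0" by (rule field_le_epsilon)
    then show "f T z = edge_point u v (T - t) z" by simp
  qed
  have "t + 1 \<le> L"
  proof (rule ccontr)
    assume "\<not> t + 1 \<le> L"
    then have "T = L" "T - t < 1" by (auto simp: T_def)
    then have "vertex_point w v = T - t" using fT fL v by simp
    then show False using \<open>T - t < 1\<close> T by (auto simp: vertex_point_def split: if_splits)
  qed
  moreover from this have "T = t + 1" by (simp add: T_def)
  moreover have "f (t + h) = edge_point u v h" if "h \<in> {0..1}" for h
  proof -
    have "h = 0 \<or> t + h \<in> I \<or> t + h = T" using that \<open>T = t + 1\<close> by (auto simp: I_def)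
    then consider "h = 0" | "t + h \<in> I" | "t + h = T" by blast
    then show ?thesis
    proof cases
      case 1
      then show ?thesis using ft by (simp add: edge_point_0)
    next
      case 2
      then show ?thesis using fI'[of "t + h"] by simp
    next
      case 3
      then show ?thesis using fT by (simp flip: 3)
    qed
  qed
  ultimately show ?thesis using v by blast
qed

text \<open>
  Starting at a vertex, the curve is at a vertex exactly at the integer times, so its length is an
  integer and these vertices form the cycle. Injectivity excludes length 2, where an edge
  would be traversed back and forth.
\<close>

theorem closed_arc_is_cycle:
  assumes f: "simple_arc f L" and L: "0 < L" and f0: "f 0 = vertex_point w" and fL: "f L = vertex_point w"
  obtains c where "is_cycle V E c" "trace c = f ` {0..L}" "real (path_length c) = L"
proof -
  define n where "n = nat \<lfloor>L\<rfloor>"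
  have n: "real n \<le> L" "L < real n + 1" using L by (auto simp: n_def)
  have vert: "i \<le> n \<Longrightarrow> \<exists>u. f (real i) = vertex_point u" for i
  proof (induction i)
    case 0
    then show ?case using f0 by auto
  next
    case (Suc i)
    then obtain u where u: "f (real i) = vertex_point u" by auto
    have "real i < L" using Suc.prems n by simp
    from simple_arc_edge[OF f _ this u fL] obtain v where
      v: "{u, v} \<in> E" "\<forall>h\<in>{0..1}. f (real i + h) = edge_point u v h" by auto
    then have "f (real i + 1) = edge_point u v 1" by simp
    then show ?case using simple_graph_edge[OF simple v(1)] by (auto simp: edge_point_1 add.commute)
  qed
  have Ln: "L = real n"
  proof (rule ccontr)
    assume "L \<noteq> real n"
    then have "real n < L" using n by simp
    moreover obtain u where "f (real n) = vertex_point u" using vert by blast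
    ultimately show False using simple_arc_edge[OF f _ _ _ fL, of "real n"] n by auto
  qed
  define x where "x = (\<lambda>i. SOME u. f (real i) = vertex_point u)"
  have x: "f (real i) = vertex_point (x i)" if "i \<le> n" for i
    unfolding x_def using vert[OF that] by (rule someI_ex)
  have step: "{x i, x (Suc i)} \<in> E \<and> x i \<noteq> x (Suc i) \<and>
      (\<forall>h\<in>{0..1}. f (real i + h) = edge_point (x i) (x (Suc i)) h)"
    if i: "i < n" for i
  proof -
    have "real i < L" using i Ln by simp
    from simple_arc_edge[OF f _ this x fL] i obtain v where
      v: "{x i, v} \<in> E" "\<forall>h\<in>{0..1}. f (real i + h) = edge_point (x i) v h" by auto
    then have "f (real i + 1) = edge_point (x i) v 1" by simp
    then have "vertex_point (x (Suc i)) = vertex_point v"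
      using simple_graph_edge[OF simple v(1)] x[of "Suc i"] i by (simp add: edge_point_1 add.commute)
    then have "v = x (Suc i)" by simp
    then show ?thesis using v simple_graph_edge[OF simple v(1)] by simp
  qed
  have x0n: "x 0 = w" "x n = w" using x[of 0] x[of n] f0 fL Ln by auto
  have inj: "i = j" if "i < n" "j < n" "x i = x j" for i j
  proof -
    have "inj_on f {0..<L}" using f by (simp add: simple_arc_def)
    moreover have "f (real i) = f (real j)" using x[of i] x[of j] that by simp
    ultimately show ?thesis using that Ln inj_onD[of f "{0..<L}" "real i" "real j"] by simp
  qed
  have "n \<noteq> 0" using L Ln by simp
  moreover have "n \<noteq> 1" using step[of 0] x0n by auto
  moreover have "n \<noteq> 2"
  proof
    assume "n = 2"
    have "f (1/2) = edge_point (x 0) (x 1) (1/2)" using step[of 0] \<open>n = 2\<close> by simp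
    moreover have "f (1 + 1/2) = edge_point (x 1) (x 0) (1/2)"
    proof -
      have "\<forall>h\<in>{0..1}. f (real 1 + h) = edge_point (x 1) (x (Suc 1)) h" using step[of 1] \<open>n = 2\<close> by simp
      from bspec[OF this, of "1/2"] show ?thesis using \<open>n = 2\<close> x0n by (simp add: numeral_2_eq_2)
    qed
    moreover have "edge_point (x 1) (x 0) (1/2) = edge_point (x 0) (x 1) (1/2)"
      by (auto simp: edge_point_def)
    ultimately have "f (1/2) = f (1 + 1/2)" by simp
    moreover have "inj_on f {0..<L}" using f by (simp add: simple_arc_def)
    ultimately show False using Ln \<open>n = 2\<close> inj_onD[of f "{0..<L}" "1/2" "1 + 1/2"] by simp
  qed
  ultimately have n3: "3 \<le> n" by simp
  define c where "c = map x [0..<Suc n]"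
  have len: "path_length c = n" by (simp add: c_def path_length_def)
  have "hd c = x 0" "last c = x n" by (simp_all add: c_def hd_map del: upt_Suc) (simp add: last_map)
  moreover have "distinct (tl c)"
  proof -
    have "tl c = map x [1..<Suc n]" by (simp add: c_def map_tl[symmetric] del: upt_Suc)
    moreover have "inj_on x {1..<Suc n}"
    proof (rule inj_onI)
      fix i j assume ij: "i \<in> {1..<Suc n}" "j \<in> {1..<Suc n}" "x i = x j"
      show "i = j"
      proof (cases "i = n \<or> j = n")
        case True
        then show ?thesis using ij x0n inj[of i 0] inj[of 0 j] n3 by fastforce
      next
        case False
        then show ?thesis using ij inj[of i j] by simp
      qed
    qed
    ultimately show ?thesis by (simp add: distinct_map del: upt_Suc)
  qed
  moreover have "set c \<subseteq> V"
  proof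
    fix v assume "v \<in> set c"
    then obtain i where i: "i \<le> n" "v = x i" unfolding c_def by (auto simp: less_Suc_eq_le simp del: upt_Suc)
    have "f (real i) \<in> X" using f i Ln by (auto simp: simple_arc_def)
    then show "v \<in> V" using x i vertex_point_in_points_iff[OF simple] by simp
  qed
  moreover have "path_edges c \<subseteq> E" using step unfolding c_def path_edges_map_upt by auto
  ultimately have cyc: "is_cycle V E c" using n3 len x0n by (simp add: is_cycle_def)
  have tr: "trace c = f ` {0..L}"
  proof (intro equalityI subsetI)
    fix z assume "z \<in> trace c"
    then consider i where "i \<le> n" "z = vertex_point (x i)"
      | u v t i where "{u, v} = {x i, x (Suc i)}" "i < n" "0 \<le> t" "t \<le> 1" "z = edge_point u v t"
      unfolding trace_def points_def c_def path_edges_map_upt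
      by (auto simp: less_Suc_eq_le simp del: upt_Suc)
    then show "z \<in> f ` {0..L}"
    proof cases
      case (1 i)
      then have "z = f (real i)" using x[of i] by simp
      then show ?thesis by (rule image_eqI) (use 1 Ln in auto)
    next
      case (2 u v t i)
      note s = step[OF 2(2)]
      from 2(1) consider "u = x i" "v = x (Suc i)" | "v = x i" "u = x (Suc i)"
        by (auto simp: doubleton_eq_iff)
      then show ?thesis
      proof cases
        case 1
        then have "z = f (real i + t)" using s 2(3-5) by simp
        then show ?thesis by (rule image_eqI) (use 2(2-4) Ln in auto)
      next
        case swapped: 2
        then have "z = edge_point (x i) (x (Suc i)) (1 - t)"
          using s 2(5) edge_point_commute[of u v t] by metis
        then have "z = f (real i + (1 - t))" using s 2(3,4) by simp
        then show ?thesis by (rule image_eqI) (use 2(2-4) Ln in auto)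
      qed
    qed
  next
    fix z assume "z \<in> f ` {0..L}"
    then obtain t where t: "0 \<le> t" "t \<le> real n" "z = f t" using Ln by auto
    show "z \<in> trace c"
    proof (cases "t = real n")
      case True
      then have "z = vertex_point (x n)" using x[of n] t by simp
      then show ?thesis unfolding trace_def c_def points_def by (auto simp del: upt_Suc)
    next
      case False
      define i where "i = nat \<lfloor>t\<rfloor>"
      define h where "h = t - real i"
      have "real i \<le> t" "t < real i + 1" using t(1) unfolding i_def by linarith+
      then have i: "i < n" "h \<in> {0..1}" using t(2) False by (auto simp: h_def)
      then have "f (real i + h) = edge_point (x i) (x (Suc i)) h" using step[of i] by blast
      then have "z = edge_point (x i) (x (Suc i)) h" using t(3) by (simp add: h_def)
      moreover have "{x i, x (Suc i)} \<in> path_edges c" using i unfolding c_def path_edges_map_upt by blast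
      ultimately show ?thesis using i unfolding trace_def points_def by auto
    qed
  qed
  show ?thesis using that[OF cyc tr] len Ln by simp
qed

end

section \<open>A cycle as a circle\<close>

locale cycle_in_graph =
  fixes V :: "'v set" and E :: "'v set set" and c :: "'v list"
  assumes simple: "simple_graph V E" and cycle: "is_cycle V E c"
begin

abbreviation n :: nat where "n \<equiv> path_length c"
abbreviation dC :: "('v \<Rightarrow> real) \<Rightarrow> ('v \<Rightarrow> real) \<Rightarrow> real" where "dC \<equiv> cycle_dist c"

lemma n_ge_3: "3 \<le> n" using cycle by (simp add: is_cycle_def)

lemma length_c: "length c = Suc n" using n_ge_3 by (simp add: path_length_def)

lemma nth_n: "c ! n = c ! 0"
proof -
  have "c \<noteq> []" using length_c by auto
  then show ?thesis using cycle by (simp add: is_cycle_def hd_conv_nth last_conv_nth path_length_def)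
qed

lemma nth_inj: assumes "i < n" "j < n" "c ! i = c ! j" shows "i = j"
proof -
  have tl: "c ! i = tl c ! (if i = 0 then n - 1 else i - 1)" if "i < n" for i
    using that nth_n length_c n_ge_3 by (auto simp: nth_tl)
  have d: "distinct (tl c)" "length (tl c) = n" using cycle length_c by (auto simp: is_cycle_def)
  have "(if i = 0 then n - 1 else i - 1) < length (tl c)" "(if j = 0 then n - 1 else j - 1) < length (tl c)"
    using assms(1,2) n_ge_3 d(2) by auto
  from nth_eq_iff_index_eq[OF d(1) this]
  have "(if i = 0 then n - 1 else i - 1) = (if j = 0 then n - 1 else j - 1)"
    using assms(3) tl[OF assms(1)] tl[OF assms(2)] by argo
  then show ?thesis using assms(1,2) by (auto split: if_splits)
qed

lemma edges_c: "path_edges c = {{c ! i, c ! Suc i} | i. i < n}"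
  by (auto simp: path_edges_def length_c)

lemma edges_c_subset: "path_edges c \<subseteq> E" using cycle by (simp add: is_cycle_def)

lemma set_c_subset: "set c \<subseteq> V" using cycle by (simp add: is_cycle_def)

lemma edge_in_c: "i < n \<Longrightarrow> {c ! i, c ! Suc i} \<in> path_edges c"
  by (subst edges_c) blast

lemma nth_Suc_neq: assumes "i < n" shows "c ! i \<noteq> c ! Suc i"
  using simple_graph_edge[OF simple subsetD[OF edges_c_subset edge_in_c[OF assms]]] by simp

lemma simple_c: "simple_graph (set c) (path_edges c)"
  unfolding simple_graph_def
proof
  fix e assume "e \<in> path_edges c"
  then obtain i where i: "i < n" "e = {c ! i, c ! Suc i}" unfolding edges_c by blast
  then have "c ! i \<in> set c" "c ! Suc i \<in> set c" using length_c by (auto intro: nth_mem)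
  moreover note i(2) nth_Suc_neq[OF i(1)]
  ultimately show "\<exists>u\<in>set c. \<exists>v\<in>set c. u \<noteq> v \<and> e = {u, v}" by blast
qed

text \<open>The unit speed parametrisation with period \<open>n\<close>, at the vertex \<open>c ! i\<close> at each time congruent to \<open>i\<close>.\<close>

definition circle :: "real \<Rightarrow> 'v \<Rightarrow> real" where
  "circle t = edge_point (c ! nat (\<lfloor>t\<rfloor> mod int n)) (c ! Suc (nat (\<lfloor>t\<rfloor> mod int n))) (frac t)"

lemma circle_edge:
  assumes i: "i < n" and r: "0 \<le> r" "r \<le> 1" and t: "t = real i + r + of_int k * real n"
  shows "circle t = edge_point (c ! i) (c ! Suc i) r"
proof (cases "r = 1")
  case False
  then have fl: "\<lfloor>t\<rfloor> = int i + k * int n" unfolding t by (intro floor_unique) (use r False in auto)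
  then have "frac t = r" unfolding frac_def fl by (simp add: t)
  moreover have "nat (\<lfloor>t\<rfloor> mod int n) = i" unfolding fl using i by simp
  ultimately show ?thesis by (simp add: circle_def)
next
  case True
  then have fl: "\<lfloor>t\<rfloor> = int (Suc i) + k * int n" unfolding t by (intro floor_unique) (use True in auto)
  then have fr: "frac t = 0" unfolding frac_def fl by (simp add: t True)
  have "nat (\<lfloor>t\<rfloor> mod int n) = (if Suc i = n then 0 else Suc i)"
    unfolding fl using i by (auto simp del: of_nat_Suc)
  then have "circle t = vertex_point (c ! (if Suc i = n then 0 else Suc i))"
    unfolding circle_def fr edge_point_0 by (simp only:)
  also have "\<dots> = vertex_point (c ! Suc i)" using nth_n by auto
  finally show ?thesis using True nth_Suc_neq[OF i] by (simp add: edge_point_1)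
qed

lemma circle_coordinates:
  obtains i r k where "i < n" "0 \<le> r" "r < 1" "t = real i + r + of_int k * real n"
proof -
  define i where "i = nat (\<lfloor>t\<rfloor> mod int n)"
  have n0: "0 < int n" using n_ge_3 by simp
  have "int i = \<lfloor>t\<rfloor> mod int n" unfolding i_def using n0 by simp
  then have fl: "\<lfloor>t\<rfloor> = int i + (\<lfloor>t\<rfloor> div int n) * int n" by simp
  have "t = of_int \<lfloor>t\<rfloor> + frac t" by (simp add: frac_def)
  also have "(of_int \<lfloor>t\<rfloor> :: real) = real i + of_int (\<lfloor>t\<rfloor> div int n) * real n"
    by (subst fl) simp
  finally have "t = real i + frac t + of_int (\<lfloor>t\<rfloor> div int n) * real n" by simp
  moreover have "i < n" unfolding i_def using n0 by (simp add: nat_less_iff)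
  ultimately show ?thesis using that frac_ge_0 frac_lt_1 by blast
qed

lemma circle_periodic: "circle (t + of_int k * real n) = circle t"
proof -
  obtain i r k' where t: "i < n" "0 \<le> r" "r < 1" "t = real i + r + of_int k' * real n"
    by (rule circle_coordinates)
  then have "t + of_int k * real n = real i + r + of_int (k' + k) * real n" by (simp add: distrib_right)
  from circle_edge[OF t(1,2) _ this] circle_edge[OF t(1,2) _ t(4)] t(3) show ?thesis by simp
qed

lemma circle_surj:
  assumes "z \<in> trace c" obtains t where "z = circle t"
proof -
  consider v where "v \<in> set c" "z = vertex_point v"
    | u v s where "{u, v} \<in> path_edges c" "0 \<le> s" "s \<le> 1" "z = edge_point u v s"
    using assms unfolding trace_def points_def by blast
  then show ?thesis
  proof cases
    case (1 v)
    then obtain i0 where i0: "i0 < Suc n" "v = c ! i0" by (auto simp: in_set_conv_nth length_c)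
    define i where "i = (if i0 = n then 0 else i0)"
    have i: "i < n" "v = c ! i" using i0 nth_n n_ge_3 by (auto simp: i_def)
    have "circle (real i) = edge_point (c ! i) (c ! Suc i) 0"
      by (rule circle_edge[where k = 0]) (use i in auto)
    then show ?thesis using i 1 that[of "real i"] by (simp add: edge_point_0)
  next
    case (2 u v s)
    then obtain i where i: "i < n" "{u, v} = {c ! i, c ! Suc i}" unfolding edges_c by blast
    from i(2) consider "u = c ! i \<and> v = c ! Suc i" | "v = c ! i \<and> u = c ! Suc i"
      by (auto simp: doubleton_eq_iff)
    then show ?thesis
    proof cases
      case 1
      have "circle (real i + s) = edge_point (c ! i) (c ! Suc i) s"
        by (rule circle_edge[where k = 0]) (use i 2 in auto)
      then show ?thesis using 1 2(4) that by metis
    next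
      case swapped: 2
      have "circle (real i + (1 - s)) = edge_point (c ! i) (c ! Suc i) (1 - s)"
        by (rule circle_edge[where k = 0]) (use i 2 in auto)
      then show ?thesis using swapped 2(4) that edge_point_commute nth_Suc_neq[OF i(1)] by metis
    qed
  qed
qed

lemma circle_in_trace: "circle t \<in> trace c"
proof -
  obtain i r k where t: "i < n" "0 \<le> r" "r < 1" "t = real i + r + of_int k * real n"
    by (rule circle_coordinates)
  note edge = edge_in_c[OF t(1)]
  then show ?thesis
    unfolding trace_def using circle_edge[OF t(1,2) _ t(4)] t(2,3) edge_pointI[OF edge] by simp
qed

lemma circle_inj:
  assumes "circle s = circle t" obtains k :: int where "s = t + of_int k * real n"
proof -
  obtain i r k where s: "i < n" "0 \<le> r" "r < 1" "s = real i + r + of_int k * real n"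
    by (rule circle_coordinates)
  obtain j q k' where t: "j < n" "0 \<le> q" "q < 1" "t = real j + q + of_int k' * real n"
    by (rule circle_coordinates)
  have eq: "edge_point (c ! i) (c ! Suc i) r = edge_point (c ! j) (c ! Suc j) q"
    using assms circle_edge[OF s(1,2) _ s(4)] circle_edge[OF t(1,2) _ t(4)] s(3) t(3) by simp
  note ni = nth_Suc_neq[OF s(1)] and nj = nth_Suc_neq[OF t(1)]
  have "0 < edge_point (c ! i) (c ! Suc i) r (c ! i)" using ni s by simp
  then have pi: "0 < edge_point (c ! j) (c ! Suc j) q (c ! i)" by (simp add: eq)
  have "0 < edge_point (c ! j) (c ! Suc j) q (c ! j)" using nj t by simp
  then have pj: "0 < edge_point (c ! i) (c ! Suc i) r (c ! j)" by (simp add: eq)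
  have "c ! i = c ! j"
  proof (rule ccontr)
    assume ne: "c ! i \<noteq> c ! j"
    have iSj: "c ! i = c ! Suc j" using pi ne edge_point_coordinates(3)[of "c ! i" "c ! j" "c ! Suc j" q] by (metis less_irrefl)
    have jSi: "c ! j = c ! Suc i" using pj ne edge_point_coordinates(3)[of "c ! j" "c ! i" "c ! Suc i" r] by (metis less_irrefl)
    have succ: "x = (if Suc y = n then 0 else Suc y)" if "x < n" "y < n" "c ! x = c ! Suc y" for x y
      using that nth_n n_ge_3 nth_inj[of x "if Suc y = n then 0 else Suc y"] by (auto split: if_splits)
    have "i = Suc j \<or> i = 0 \<and> Suc j = n" using succ[OF s(1) t(1) iSj] by argo
    moreover have "j = Suc i \<or> j = 0 \<and> Suc i = n" using succ[OF t(1) s(1) jSi] by argo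
    ultimately show False using n_ge_3 by linarith
  qed
  then have ij: "i = j" using nth_inj s(1) t(1) by blast
  have "edge_point (c ! i) (c ! Suc i) r (c ! i) = edge_point (c ! i) (c ! Suc i) q (c ! i)"
    using eq ij by simp
  then have "r = q" using ni by simp
  then have "s = t + of_int (k - k') * real n" using s(4) t(4) ij by (simp add: left_diff_distrib)
  then show ?thesis by (rule that)
qed

lemma circle_joined_unit:
  assumes "of_int j \<le> s" "s \<le> of_int j + 1" "of_int j \<le> t" "t \<le> of_int j + 1"
  shows "pl_joined (path_edges c) (circle s) (circle t) \<bar>s - t\<bar>"
proof -
  define i where "i = nat (j mod int n)"
  have n0: "0 < int n" using n_ge_3 by simp
  have i: "i < n" unfolding i_def using n0 by (simp add: nat_less_iff)
  have "int i = j mod int n" unfolding i_def using n0 by simp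
  then have "j = int i + (j div int n) * int n" by simp
  then have j: "of_int j = real i + of_int (j div int n) * real n"
    by (metis of_int_add of_int_mult of_int_of_nat_eq)
  have on: "circle x = edge_point (c ! i) (c ! Suc i) (x - of_int j)"
    if "of_int j \<le> x" "x \<le> of_int j + 1" for x
    by (rule circle_edge[where k = "j div int n"]) (use that i j in auto)
  from pl_joined_edge[OF edge_in_c[OF i], of "s - of_int j" "t - of_int j"] assms
  show ?thesis by (simp add: on)
qed

lemma circle_joined:
  assumes "s \<le> t" shows "\<exists>l\<le>t - s. pl_joined (path_edges c) (circle s) (circle t) l"
  using assms
proof (induct rule: Bolzano)
  case (trans a b d)
  then obtain l l' where l: "l \<le> b - a" "pl_joined (path_edges c) (circle a) (circle b) l"
    "l' \<le> d - b" "pl_joined (path_edges c) (circle b) (circle d) l'" by blast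
  show ?case by (rule exI[of _ "l + l'"]) (use l pl_joined_trans[OF l(2,4)] in auto)
next
  case (local x)
  \<comment> \<open>An interval around \<open>x\<close> that splits at \<open>x\<close> into two pieces, each within one edge.\<close>
  define e where "e = min (x - (of_int \<lceil>x\<rceil> - 1)) (of_int \<lfloor>x\<rfloor> + 1 - x)"
  have e: "e \<le> x - (of_int \<lceil>x\<rceil> - 1)" "e \<le> of_int \<lfloor>x\<rfloor> + 1 - x" unfolding e_def by simp_all
  have x: "x \<le> of_int \<lceil>x\<rceil>" "of_int \<lceil>x\<rceil> < x + 1" "of_int \<lfloor>x\<rfloor> \<le> x" "x < of_int \<lfloor>x\<rfloor> + 1"
    by linarith+
  have "0 < e" unfolding e_def min_less_iff_conj using x by simp
  moreover have "\<exists>l\<le>b - a. pl_joined (path_edges c) (circle a) (circle b) l"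
    if ab: "a \<le> x \<and> x \<le> b \<and> b - a < e" for a b
  proof -
    have "of_int (\<lceil>x\<rceil> - 1) \<le> a" "a \<le> of_int (\<lceil>x\<rceil> - 1) + 1" "of_int (\<lceil>x\<rceil> - 1) \<le> x" "x \<le> of_int (\<lceil>x\<rceil> - 1) + 1"
      unfolding of_int_diff of_int_1 using ab e x by linarith+
    then have "pl_joined (path_edges c) (circle a) (circle x) \<bar>a - x\<bar>" by (rule circle_joined_unit)
    moreover have "of_int \<lfloor>x\<rfloor> \<le> b" "b \<le> of_int \<lfloor>x\<rfloor> + 1" using ab e x by linarith+
    with x have "pl_joined (path_edges c) (circle x) (circle b) \<bar>x - b\<bar>"
      by (intro circle_joined_unit[of "\<lfloor>x\<rfloor>"]) auto
    ultimately have "pl_joined (path_edges c) (circle a) (circle b) (\<bar>a - x\<bar> + \<bar>x - b\<bar>)"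
      by (rule pl_joined_trans)
    then show ?thesis using ab by (intro exI[of _ "\<bar>a - x\<bar> + \<bar>x - b\<bar>"]) auto
  qed
  ultimately show ?case by blast
qed

sublocale cyc: joined_points "trace c" "path_edges c"
proof
  fix x y assume x: "x \<in> trace c" and y: "y \<in> trace c"
  obtain s where s: "x = circle s" by (rule circle_surj[OF x])
  obtain t where t: "y = circle t" by (rule circle_surj[OF y])
  note st = s t
  show "\<exists>l. pl_joined (path_edges c) x y l"
  proof (cases "s \<le> t")
    case True
    then show ?thesis using circle_joined st by blast
  next
    case False
    then obtain l where "pl_joined (path_edges c) (circle t) (circle s) l" using circle_joined[of t s] by auto
    then show ?thesis using st pl_joined_sym by blast
  qed
qed

lemma dC_le: "dC (circle s) (circle t) \<le> \<bar>s - t\<bar>"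
proof -
  have le: "dC (circle s) (circle t) \<le> t - s" if st: "s \<le> t" for s t
  proof -
    obtain l where "l \<le> t - s" "pl_joined (path_edges c) (circle s) (circle t) l"
      using circle_joined[OF st] by blast
    then show ?thesis using length_dist_le[of "path_edges c" "circle s" "circle t" l]
      by (simp add: cycle_dist_def)
  qed
  show ?thesis
  proof (cases "s \<le> t")
    case True
    then show ?thesis using le[of s t] by simp
  next
    case False
    have "dC (circle s) (circle t) = dC (circle t) (circle s)"
      unfolding cycle_dist_def by (rule cyc.dist_commute)
    then show ?thesis using le[of t s] False by simp
  qed
qed

text \<open>
  Each linear piece of a curve in the cycle lies over one edge, so it lifts to an interval of the same
  length that starts where the lift of the earlier pieces ends. This bounds distances in the cycle from below.
\<close>

lemma circle_lift:
  assumes "pl_joined (path_edges c) x y l" "x = circle s"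
  shows "\<exists>t. y = circle t \<and> \<bar>s - t\<bar> \<le> l"
  using assms
proof (induction rule: pl_joined.induct)
  case (pl_refl x)
  then show ?case by (intro exI[of _ s]) auto
next
  case (pl_step x u v a l b)
  from pl_step.IH[OF pl_step.prems] obtain t where t: "edge_point u v a = circle t" "\<bar>s - t\<bar> \<le> l" by blast
  obtain i where i: "i < n" "{u, v} = {c ! i, c ! Suc i}" using pl_step.hyps(2)[unfolded edges_c] by blast
  from i(2) have uv: "u = c ! i \<and> v = c ! Suc i \<or> v = c ! i \<and> u = c ! Suc i"
    by (auto simp: doubleton_eq_iff)
  have "\<exists>q q'. 0 \<le> q \<and> q \<le> 1 \<and> 0 \<le> q' \<and> q' \<le> 1 \<and> \<bar>q - q'\<bar> = \<bar>a - b\<bar> \<and>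
      edge_point u v a = edge_point (c ! i) (c ! Suc i) q \<and> edge_point u v b = edge_point (c ! i) (c ! Suc i) q'"
    using uv
  proof
    assume "u = c ! i \<and> v = c ! Suc i"
    then show ?thesis using pl_step.hyps(3-6) by (intro exI[of _ a] exI[of _ b]) simp
  next
    assume *: "v = c ! i \<and> u = c ! Suc i"
    then have flip: "edge_point u v z = edge_point (c ! i) (c ! Suc i) (1 - z)" for z
      using edge_point_commute[of u v z] nth_Suc_neq[OF i(1)] by simp
    show ?thesis using pl_step.hyps(3-6)
      by (intro exI[of _ "1 - a"] exI[of _ "1 - b"]) (simp add: flip)
  qed
  then obtain q q' where q: "0 \<le> q" "q \<le> 1" "0 \<le> q'" "q' \<le> 1" "\<bar>q - q'\<bar> = \<bar>a - b\<bar>"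
      "edge_point u v a = edge_point (c ! i) (c ! Suc i) q" "edge_point u v b = edge_point (c ! i) (c ! Suc i) q'"
    by blast
  have "circle (real i + q) = edge_point (c ! i) (c ! Suc i) q"
    by (rule circle_edge[where k = 0]) (use i q in auto)
  then have "circle t = circle (real i + q)" using t(1) q(6) by simp
  then obtain k where k: "t = real i + q + of_int k * real n" by (rule circle_inj)
  have "circle (real i + q' + of_int k * real n) = edge_point (c ! i) (c ! Suc i) q'"
    by (rule circle_edge) (use i q in auto)
  then have "edge_point u v b = circle (real i + q' + of_int k * real n)" by (simp only: q(7))
  moreover have "\<bar>s - (real i + q' + of_int k * real n)\<bar> \<le> l + \<bar>a - b\<bar>"
    using t(2) q(5) unfolding k by linarith
  ultimately show ?case by blast
qed

text \<open>
  The distance in the cycle is the distance of \<open>s - t\<close> from the nearest multiple of \<open>n\<close>: the lift of a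
  curve ends at some point over the same end point, and rounding picks the nearest one.
\<close>

lemma dC_circle: "dC (circle s) (circle t) = \<bar>s - t - of_int (round ((s - t) / real n)) * real n\<bar>" (is "_ = ?m")
proof (rule antisym)
  let ?k = "round ((s - t) / real n)"
  have "dC (circle s) (circle t) = dC (circle s) (circle (t + of_int ?k * real n))"
    by (simp only: circle_periodic)
  also have "\<dots> \<le> \<bar>s - (t + of_int ?k * real n)\<bar>" by (rule dC_le)
  finally show "dC (circle s) (circle t) \<le> ?m" by (simp add: algebra_simps)
  have n0: "0 < real n" using n_ge_3 by simp
  obtain l0 where "pl_joined (path_edges c) (circle s) (circle t) l0"
    using cyc.joined circle_in_trace by blast
  then show "?m \<le> dC (circle s) (circle t)"
    unfolding cycle_dist_def
  proof (rule length_dist_greatest)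
    fix l assume "pl_joined (path_edges c) (circle s) (circle t) l"
    from circle_lift[OF this refl] obtain t' where t': "circle t = circle t'" "\<bar>s - t'\<bar> \<le> l" by blast
    obtain k where k: "t' = t + of_int k * real n" using circle_inj[OF t'(1)[symmetric]] by blast
    have scale: "\<bar>s - t - of_int j * real n\<bar> = real n * \<bar>(s - t) / real n - of_int j\<bar>" for j :: int
    proof -
      have "s - t - of_int j * real n = real n * ((s - t) / real n - of_int j)"
        using n0 by (simp add: right_diff_distrib mult.commute)
      then show ?thesis using n0 by (simp add: abs_mult)
    qed
    have "?m \<le> \<bar>s - t - of_int k * real n\<bar>"
      unfolding scale using round_diff_minimal n0 by (intro mult_left_mono) auto
    also have "\<dots> = \<bar>s - t'\<bar>" unfolding k by (simp add: algebra_simps)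
    finally show "?m \<le> l" using t'(2) by simp
  qed
qed

lemma dC_le_half: "dC (circle s) (circle t) \<le> real n / 2"
proof -
  have n0: "0 < real n" using n_ge_3 by simp
  have "s - t - of_int (round ((s - t) / real n)) * real n
      = real n * ((s - t) / real n - of_int (round ((s - t) / real n)))"
    using n0 by (simp add: right_diff_distrib mult.commute)
  then have "dC (circle s) (circle t) = real n * \<bar>(s - t) / real n - of_int (round ((s - t) / real n))\<bar>"
    unfolding dC_circle using n0 by (simp add: abs_mult)
  also have "\<dots> \<le> real n * (1 / 2)"
    using of_int_round_abs_le[of "(s - t) / real n"] n0
    by (intro mult_left_mono) (auto simp: abs_minus_commute)
  finally show ?thesis by simp
qed

lemma trace_subset: "trace c \<subseteq> points V E"
  unfolding trace_def by (rule points_mono[OF set_c_subset edges_c_subset])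

lemma dist_le_dC:
  assumes "x \<in> trace c" "y \<in> trace c" shows "length_dist E x y \<le> dC x y"
proof -
  obtain l0 where "pl_joined (path_edges c) x y l0" using cyc.joined[OF assms] by blast
  then show ?thesis unfolding cycle_dist_def
    by (rule length_dist_greatest) (rule length_dist_le[OF pl_joined_mono[OF _ edges_c_subset]])
qed

end

section \<open>Reduction of a triangle to a cycle\<close>

context metric_graph
begin

lemma isometric_forward:
  assumes "isometric f A" "0 \<le> a" "a \<le> b" "b \<le> A"
  shows "isometric (\<lambda>r. f (a + r)) (b - a)" "(\<lambda>r. f (a + r)) ` {0..b - a} = f ` {a..b}"
proof -
  show im: "(\<lambda>r. f (a + r)) ` {0..b - a} = f ` {a..b}"
  proof (intro equalityI subsetI)
    fix z assume "z \<in> f ` {a..b}"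
    then obtain t where "t \<in> {a..b}" "z = f (a + (t - a))" by auto
    then show "z \<in> (\<lambda>r. f (a + r)) ` {0..b - a}" by (intro image_eqI[of _ _ "t - a"]) auto
  qed auto
  have "f ` {a..b} \<subseteq> X" using assms by (auto simp: isometric_def)
  moreover have "d (f (a + s)) (f (a + t)) = \<bar>s - t\<bar>" if "s \<in> {0..b - a}" "t \<in> {0..b - a}" for s t
    using isometric_dist[OF assms(1), of "a + s" "a + t"] that assms by simp
  ultimately show "isometric (\<lambda>r. f (a + r)) (b - a)"
    unfolding isometric_def im using assms(3) by simp
qed

lemma isometric_backward:
  assumes "isometric f A" "0 \<le> a" "a \<le> b" "b \<le> A"
  shows "isometric (\<lambda>r. f (b - r)) (b - a)" "(\<lambda>r. f (b - r)) ` {0..b - a} = f ` {a..b}"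
proof -
  show im: "(\<lambda>r. f (b - r)) ` {0..b - a} = f ` {a..b}"
  proof (intro equalityI subsetI)
    fix z assume "z \<in> f ` {a..b}"
    then obtain t where "t \<in> {a..b}" "z = f (b - (b - t))" by auto
    then show "z \<in> (\<lambda>r. f (b - r)) ` {0..b - a}" by (intro image_eqI[of _ _ "b - t"]) auto
  qed auto
  have "f ` {a..b} \<subseteq> X" using assms by (auto simp: isometric_def)
  moreover have "d (f (b - s)) (f (b - t)) = \<bar>s - t\<bar>" if "s \<in> {0..b - a}" "t \<in> {0..b - a}" for s t
    using isometric_dist[OF assms(1), of "b - s" "b - t"] that assms by simp
  ultimately show "isometric (\<lambda>r. f (b - r)) (b - a)"
    unfolding isometric_def im using assms(3) by simp
qed

lemma isometric_segment:
  assumes f: "isometric f A" and ab: "a \<in> {0..A}" "b \<in> {0..A}"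
  obtains g where "isometric g \<bar>a - b\<bar>" "g 0 = f a" "g \<bar>a - b\<bar> = f b"
    "g ` {0..\<bar>a - b\<bar>} = f ` {min a b..max a b}"
proof (cases "a \<le> b")
  case True
  then show ?thesis using isometric_forward[OF f, of a b] ab that[of "\<lambda>r. f (a + r)"] by auto
next
  case False
  then show ?thesis using isometric_backward[OF f, of b a] ab that[of "\<lambda>r. f (a - r)"] by auto
qed

lemma isometric_geodesic:
  assumes "isometric f A" shows "geodesic_between X d (f 0) (f A) (f ` {0..A})"
proof -
  have "d (f 0) (f A) = A" using isometric_dist[OF assms, of 0 A] assms by (auto simp: isometric_def)
  then show ?thesis using assms unfolding geodesic_between_def isometric_def
    by (intro exI[of _ f]) simp
qed

lemma geodesic_isometric:
  assumes "geodesic_between X d x y S" "x \<in> X" "y \<in> X"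
  obtains f A where "isometric f A" "f 0 = x" "f A = y" "f ` {0..A} = S"
proof -
  obtain f where "f 0 = x" "f (d x y) = y" "f ` {0..d x y} = S" "S \<subseteq> X"
    "\<forall>s\<in>{0..d x y}. \<forall>t\<in>{0..d x y}. d (f s) (f t) = \<bar>s - t\<bar>"
    using assms(1) unfolding geodesic_between_def by blast
  then show ?thesis using that[of f "d x y"] dist_nonneg[OF assms(2,3)] by (simp add: isometric_def)
qed

text \<open>
  A point \<open>x\<close> lies on the geodesic \<open>g\<close> only if it is \<open>g s\<close> with \<open>s\<close> its distance from the start, so
  membership is the vanishing of a continuous function.
\<close>

lemma compact_meeting_times:
  assumes f: "isometric f A" and g: "isometric g B"
  shows "compact {t \<in> {0..A}. f t \<in> g ` {0..B}}"
proof -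
  have B: "0 \<le> B" using g by (simp add: isometric_def)
  define r where "r = (\<lambda>t. min B (d (g 0) (f t)))"
  define \<phi> where "\<phi> = (\<lambda>t. d (g (r t)) (f t))"
  have g0: "g 0 \<in> X" using isometric_in[OF g] B by simp
  have fX: "f t \<in> X" if "t \<in> {0..A}" for t using isometric_in[OF f that] .
  have rB: "r t \<in> {0..B}" if "t \<in> {0..A}" for t
    using dist_nonneg[OF g0 fX[OF that]] B by (simp add: r_def)
  have gX: "g (r t) \<in> X" if "t \<in> {0..A}" for t using isometric_in[OF g rB[OF that]] .
  have r_lip: "\<bar>r s - r t\<bar> \<le> \<bar>s - t\<bar>" if st: "s \<in> {0..A}" "t \<in> {0..A}" for s t
  proof -
    have "d (g 0) (f s) \<le> d (g 0) (f t) + d (f t) (f s)" "d (g 0) (f t) \<le> d (g 0) (f s) + d (f s) (f t)"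
      using dist_triangle g0 fX st by blast+
    then show ?thesis using isometric_dist[OF f st] isometric_dist[OF f st(2,1)]
      unfolding r_def by linarith
  qed
  have \<phi>_le: "\<phi> s \<le> \<phi> t + 2 * \<bar>s - t\<bar>" if st: "s \<in> {0..A}" "t \<in> {0..A}" for s t
  proof -
    have "\<phi> s \<le> d (g (r s)) (g (r t)) + d (g (r t)) (f s)" unfolding \<phi>_def
      by (rule dist_triangle) (use gX fX st in auto)
    moreover have "d (g (r t)) (f s) \<le> \<phi> t + d (f t) (f s)" unfolding \<phi>_def
      by (rule dist_triangle) (use gX fX st in auto)
    moreover have "d (g (r s)) (g (r t)) \<le> \<bar>s - t\<bar>"
      using isometric_dist[OF g rB[OF st(1)] rB[OF st(2)]] r_lip[OF st] by simp
    moreover have "d (f t) (f s) = \<bar>s - t\<bar>"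
      using isometric_dist[OF f st(2,1)] by (simp add: abs_minus_commute)
    ultimately show ?thesis by simp
  qed
  have "continuous_on {0..A} \<phi>"
    unfolding continuous_on_iff
  proof (intro ballI allI impI)
    fix t e :: real assume t: "t \<in> {0..A}" and e: "0 < e"
    have "dist (\<phi> s) (\<phi> t) < e" if "s \<in> {0..A}" "dist s t < e / 2" for s
    proof -
      have "\<phi> s < \<phi> t + e" "\<phi> t < \<phi> s + e"
        using \<phi>_le[OF that(1) t] \<phi>_le[OF t that(1)] that(2) unfolding dist_real_def
        by (simp_all add: abs_minus_commute[of t s])
      then show ?thesis by (simp add: dist_real_def abs_less_iff)
    qed
    then show "\<exists>\<delta>>0. \<forall>s\<in>{0..A}. dist s t < \<delta> \<longrightarrow> dist (\<phi> s) (\<phi> t) < e"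
      using e by (intro exI[of _ "e / 2"]) auto
  qed
  then have "closed ({0..A} \<inter> \<phi> -` {0})" by (rule continuous_closed_preimage) auto
  moreover have "{t \<in> {0..A}. f t \<in> g ` {0..B}} = {0..A} \<inter> ({0..A} \<inter> \<phi> -` {0})"
  proof (intro equalityI subsetI)
    fix t assume "t \<in> {t \<in> {0..A}. f t \<in> g ` {0..B}}"
    then obtain s where s: "t \<in> {0..A}" "s \<in> {0..B}" "f t = g s" by blast
    have "r t = s" using isometric_dist[OF g, of 0 s] s B by (simp add: r_def)
    then have "\<phi> t = 0" using s dist_refl[OF fX[OF s(1)]] by (simp add: \<phi>_def)
    then show "t \<in> {0..A} \<inter> ({0..A} \<inter> \<phi> -` {0})" using s by simp
  next
    fix t assume "t \<in> {0..A} \<inter> ({0..A} \<inter> \<phi> -` {0})"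
    then have t: "t \<in> {0..A}" "\<phi> t = 0" by auto
    then have "f t = g (r t)" using dist_zero_iff[OF gX fX] by (simp add: \<phi>_def)
    then show "t \<in> {t \<in> {0..A}. f t \<in> g ` {0..B}}" using rB[OF t(1)] t(1) by blast
  qed
  ultimately show ?thesis using compact_Int_closed[OF compact_Icc, of "{0..A} \<inter> \<phi> -` {0}" 0 A] by simp
qed

text \<open>
  The witness is the point of \<open>\<alpha>\<close> on \<open>\<beta>\<close> closest to \<open>\<alpha> a\<close>. The two geodesics may coincide.
\<close>

lemma first_meeting:
  assumes \<alpha>: "isometric \<alpha> A" and \<beta>: "isometric \<beta> B" and meet: "\<alpha> ` {0..A} \<inter> \<beta> ` {0..B} \<noteq> {}"
  obtains t s where "t \<in> {0..A}" "s \<in> {0..B}" "\<alpha> t = \<beta> s"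
    "\<And>r. r \<in> {min t a..max t a} \<Longrightarrow> r \<in> {0..A} \<Longrightarrow> \<alpha> r \<in> \<beta> ` {0..B} \<Longrightarrow> r = t"
proof -
  let ?K = "{t \<in> {0..A}. \<alpha> t \<in> \<beta> ` {0..B}}"
  have "?K \<noteq> {}" using meet by blast
  moreover have "continuous_on ?K (\<lambda>t. \<bar>t - a\<bar>)" by (intro continuous_intros)
  ultimately obtain t where t: "t \<in> ?K" "\<And>r. r \<in> ?K \<Longrightarrow> \<bar>t - a\<bar> \<le> \<bar>r - a\<bar>"
    using continuous_attains_inf[OF compact_meeting_times[OF \<alpha> \<beta>]] by blast
  then obtain s where s: "s \<in> {0..B}" "\<alpha> t = \<beta> s" by blast
  have "r = t" if "r \<in> {min t a..max t a}" "r \<in> {0..A}" "\<alpha> r \<in> \<beta> ` {0..B}" for r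
    using t(2)[of r] that by (auto simp: min_def max_def split: if_splits)
  then show ?thesis using that[of t s] t(1) s by blast
qed

text \<open>
  Away from the vertices the pair of positive coordinates is locally constant, so a geodesic that
  meets no vertex stays inside one edge and is shorter than 1.
\<close>

lemma isometric_vertex_time:
  assumes f: "isometric f A" and ab: "0 \<le> a" "a + 1 \<le> b" "b \<le> A"
  obtains t w where "t \<in> {a..b}" "f t = vertex_point w"
proof -
  have "\<exists>t\<in>{a..b}. \<exists>w. f t = vertex_point w"
  proof (rule ccontr)
    assume no: "\<not> (\<exists>t\<in>{a..b}. \<exists>w. f t = vertex_point w)"
    have inA: "t \<in> {0..A}" if "t \<in> {a..b}" for t using that ab by auto
    have edge: "\<exists>u v s. {u, v} \<in> E \<and> u \<noteq> v \<and> 0 < s \<and> s < 1 \<and> f t = edge_point u v s" if t: "t \<in> {a..b}" for t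
      using simple isometric_in[OF f inA[OF t]]
    proof (cases rule: points_cases)
      case (vertex v)
      then show ?thesis using no t by blast
    next
      case (edge u v s)
      then show ?thesis by blast
    qed
    define supp where "supp = (\<lambda>t. {w. 0 < f t w})"
    have supp: "supp t = {u, v}" if "f t = edge_point u v s" "u \<noteq> v" "0 < s" "s < 1" for t u v s
      unfolding supp_def that(1) using that(2-4) by (auto simp: edge_point_def)
    have loc: "\<forall>x\<in>{a..b}. eventually (\<lambda>y. supp x = supp y) (at x within {a..b})"
    proof
      fix x assume x: "x \<in> {a..b}"
      obtain u v s where s: "{u, v} \<in> E" "u \<noteq> v" "0 < s" "s < 1" "f x = edge_point u v s" using edge[OF x] by blast
      have "supp x = supp y" if y: "y \<in> {a..b}" "dist y x < min s (1 - s)" for y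
      proof -
        have "\<bar>f x w - f y w\<bar> \<le> \<bar>x - y\<bar>" for w
          using dist_coordinate[OF isometric_in[OF f inA[OF x]] isometric_in[OF f inA[OF y(1)]], of w]
            isometric_dist[OF f inA[OF x] inA[OF y(1)]] by simp
        from this[of u] this[of v] have pos: "0 < f y u" "0 < f y v"
          using y(2) s by (auto simp: dist_real_def)
        obtain s' where "0 < s'" "s' < 1" "f y = edge_point u v s'"
          using points_two_coordinates[OF simple isometric_in[OF f inA[OF y(1)]] s(2) pos] by blast
        then show ?thesis using supp[of x u v s] supp[of y u v s'] s by simp
      qed
      then show "eventually (\<lambda>y. supp x = supp y) (at x within {a..b})"
        unfolding eventually_at using s by (intro exI[of _ "min s (1 - s)"]) auto
    qed
    have aI: "a \<in> {a..b}" and bI: "b \<in> {a..b}" using ab by auto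
    have con: "connected {a..b}" by (rule connected_Icc)
    have same: "supp a = supp b" by (rule connected_local_const[OF con aI bI loc])
    obtain u v s where s: "{u, v} \<in> E" "u \<noteq> v" "0 < s" "s < 1" "f a = edge_point u v s" using edge[OF aI] by blast
    have "supp b = {u, v}" using supp[OF s(5,2,3,4)] same by simp
    then have pos: "0 < f b u" "0 < f b v" unfolding supp_def by auto
    obtain s' where s': "0 < s'" "s' < 1" "f b = edge_point u v s'"
      using points_two_coordinates[OF simple isometric_in[OF f inA[OF bI]] s(2) pos] by blast
    have "d (f a) (f b) \<le> \<bar>s - s'\<bar>" unfolding s(5) s'(3)
      by (rule length_dist_le, rule pl_joined_edge) (use s s' in auto)
    then show False using isometric_dist[OF f inA[OF aI] inA[OF bI]] s s' ab by linarith
  qed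
  then show ?thesis using that by blast
qed

text \<open>
  Let \<open>[a, b]\<close> be a piece of a side whose interior avoids the other two sides. Following the other
  sides from \<open>a\<close> and from \<open>b\<close> to their first common point \<open>c\<close> closes it up to a simple closed curve, which
  is a geodesic triangle with corners \<open>a\<close>, \<open>b\<close>, \<open>c\<close>. If both \<open>a\<close> and \<open>b\<close> lie on the same
  side then \<open>c = a\<close> and the triangle is a bigon. The curve is cut at a vertex between \<open>a\<close>
  and \<open>b\<close>, as the corners may lie inside edges.
\<close>

lemma triangle_cycle_through_side:
  assumes \<gamma>: "isometric \<gamma> D" and tab: "0 \<le> ta" "ta + 2 \<le> tb" "tb \<le> D"
    and \<alpha>: "isometric \<alpha> A" "a0 \<in> {0..A}" "\<gamma> ta = \<alpha> a0"
    and \<beta>: "isometric \<beta> B" "b0 \<in> {0..B}" "\<gamma> tb = \<beta> b0"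
    and meet: "\<alpha> ` {0..A} \<inter> \<beta> ` {0..B} \<noteq> {}"
    and free: "\<And>t. t \<in> {ta<..<tb} \<Longrightarrow> \<gamma> t \<notin> \<alpha> ` {0..A} \<union> \<beta> ` {0..B}"
  obtains c R where "c \<in> triangle_cycles V E" "trace c = \<gamma> ` {ta..tb} \<union> R"
    "R \<subseteq> \<alpha> ` {0..A} \<union> \<beta> ` {0..B}" "tb - ta \<le> real (path_length c)"
proof -
  obtain tc sc where tc: "tc \<in> {0..A}" "sc \<in> {0..B}" "\<alpha> tc = \<beta> sc"
    "\<And>r. r \<in> {min tc a0..max tc a0} \<Longrightarrow> r \<in> {0..A} \<Longrightarrow> \<alpha> r \<in> \<beta> ` {0..B} \<Longrightarrow> r = tc"
    using first_meeting[OF \<alpha>(1) \<beta>(1) meet, of a0] by blast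
  define l2 where "l2 = \<bar>b0 - sc\<bar>"
  define l3 where "l3 = \<bar>tc - a0\<bar>"
  obtain g3 where g3: "isometric g3 l3" "g3 0 = \<alpha> tc" "g3 l3 = \<alpha> a0"
    "g3 ` {0..l3} = \<alpha> ` {min tc a0..max tc a0}"
    unfolding l3_def by (rule isometric_segment[OF \<alpha>(1) tc(1) \<alpha>(2)])
  obtain g2 where g2: "isometric g2 l2" "g2 0 = \<beta> b0" "g2 l2 = \<beta> sc"
    "g2 ` {0..l2} = \<beta> ` {min b0 sc..max b0 sc}"
    unfolding l2_def by (rule isometric_segment[OF \<beta>(1) \<beta>(2) tc(2)])
  have l: "0 \<le> l2" "0 \<le> l3" by (simp_all add: l2_def l3_def)
  have sub3: "{min tc a0..max tc a0} \<subseteq> {0..A}" using tc(1) \<alpha>(2) by auto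
  have sub2: "{min b0 sc..max b0 sc} \<subseteq> {0..B}" using tc(2) \<beta>(2) by auto
  have g3\<alpha>: "g3 ` {0..l3} \<subseteq> \<alpha> ` {0..A}" unfolding g3(4) using sub3 by (rule image_mono)
  have g2\<beta>: "g2 ` {0..l2} \<subseteq> \<beta> ` {0..B}" unfolding g2(4) using sub2 by (rule image_mono)
  obtain tw w where tw': "tw \<in> {ta + 1 / 2..tb - 1 / 2}" "\<gamma> tw = vertex_point w"
    by (rule isometric_vertex_time[OF \<gamma>, of "ta + 1 / 2" "tb - 1 / 2"]) (use tab in auto)
  then have tw: "ta < tw" "tw < tb" by auto
  define h1 where "h1 = (\<lambda>r. \<gamma> (tw + r))"
  define h4 where "h4 = (\<lambda>r. \<gamma> (ta + r))"
  define l1 where "l1 = tb - tw"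
  define l4 where "l4 = tw - ta"
  have h1: "isometric h1 l1" "h1 ` {0..l1} = \<gamma> ` {tw..tb}"
    unfolding h1_def l1_def using isometric_forward[OF \<gamma>, of tw tb] tw tab by auto
  have h4: "isometric h4 l4" "h4 ` {0..l4} = \<gamma> ` {ta..tw}"
    unfolding h4_def l4_def using isometric_forward[OF \<gamma>, of ta tw] tw tab by auto
  have l14: "0 < l1" "0 < l4" using tw by (auto simp: l1_def l4_def)
  have j34: "g3 l3 = h4 0" using g3(3) \<alpha>(3) by (simp add: h4_def)
  define f3 where "f3 = concat_at l3 g3 h4"
  have f30: "f3 0 = g3 0" unfolding f3_def using l by (simp add: concat_at_start)
  have arc3: "simple_arc f3 (l3 + l4)"
    unfolding f3_def
  proof (rule simple_arc_concat[OF g3(1) isometric_simple_arc[OF h4(1)] j34])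
    fix s t assume st: "s \<in> {0..l3}" "t \<in> {0..<l4}" "g3 s = h4 t"
    have "g3 s \<in> \<alpha> ` {0..A}" using g3\<alpha> st(1) by blast
    then have "\<gamma> (ta + t) \<in> \<alpha> ` {0..A}" using st(3) by (simp add: h4_def)
    then have "ta + t \<notin> {ta<..<tb}" using free by blast
    then have "t = 0" using st(2) tw by (auto simp: l4_def)
    then have "g3 s = g3 l3" using st(3) j34 by simp
    then show "s = l3" using inj_onD[OF isometric_inj[OF g3(1)]] st(1) l by auto
  qed
  have j23: "g2 l2 = f3 0" using g2(3) g3(2) tc(3) f30 by simp
  define f2 where "f2 = concat_at l2 g2 f3"
  have f20: "f2 0 = g2 0" unfolding f2_def using l by (simp add: concat_at_start)
  have arc2: "simple_arc f2 (l2 + (l3 + l4))"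
    unfolding f2_def
  proof (rule simple_arc_concat[OF g2(1) arc3 j23])
    fix s t assume st: "s \<in> {0..l2}" "t \<in> {0..<l3 + l4}" "g2 s = f3 t"
    have \<beta>s: "g2 s \<in> \<beta> ` {0..B}" using g2\<beta> st(1) by blast
    have "0 \<le> t" "t < l3 + l4" using st(2) by auto
    then show "s = l2"
    proof (cases rule: concat_at_cases[where f = g3 and g = h4])
      case 1
      then have "g2 s \<in> g3 ` {0..l3}" using st by (auto simp: f3_def)
      then obtain r where r: "r \<in> {min tc a0..max tc a0}" "g2 s = \<alpha> r" unfolding g3(4) by blast
      have "\<alpha> r \<in> \<beta> ` {0..B}" using \<beta>s r(2) by simp
      then have "r = tc" by (rule tc(4)[OF r(1) subsetD[OF sub3 r(1)]])
      then have "g2 s = g2 l2" using r(2) tc(3) g2(3) by simp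
      then show ?thesis using inj_onD[OF isometric_inj[OF g2(1)]] st(1) l by auto
    next
      case 2
      then have "\<gamma> (ta + (t - l3)) \<in> \<beta> ` {0..B}" using \<beta>s st(3) by (simp add: f3_def h4_def)
      then have "ta + (t - l3) \<notin> {ta<..<tb}" using free by blast
      then show ?thesis using 2 tw by (auto simp: l4_def)
    qed
  qed
  have j12: "h1 l1 = f2 0" using f20 g2(2) \<beta>(3) by (simp add: h1_def l1_def)
  define f1 where "f1 = concat_at l1 h1 f2"
  define L where "L = l1 + (l2 + (l3 + l4))"
  have arc1: "simple_arc f1 L"
    unfolding f1_def L_def
  proof (rule simple_arc_concat[OF h1(1) arc2 j12])
    fix s t assume st: "s \<in> {0..l1}" "t \<in> {0..<l2 + (l3 + l4)}" "h1 s = f2 t"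
    have on_sides: "s = l1" if "h1 s \<in> \<alpha> ` {0..A} \<union> \<beta> ` {0..B}"
    proof -
      have "tw + s \<notin> {ta<..<tb}" using free that unfolding h1_def by blast
      then show ?thesis using st(1) tw by (auto simp: l1_def)
    qed
    have "0 \<le> t" "t < l2 + (l3 + l4)" using st(2) by auto
    then show "s = l1"
    proof (cases rule: concat_at_cases[where f = g2 and g = f3])
      case 1
      then have "h1 s \<in> g2 ` {0..l2}" using st by (auto simp: f2_def)
      then show ?thesis using on_sides g2\<beta> by blast
    next
      case 2
      then have eq: "h1 s = f3 (t - l2)" using st(3) by (simp add: f2_def)
      from 2 have "0 \<le> t - l2" "t - l2 < l3 + l4" by auto
      then show ?thesis
      proof (cases rule: concat_at_cases[where f = g3 and g = h4])
        case 1
        then have "h1 s \<in> g3 ` {0..l3}" using eq \<open>0 \<le> t - l2\<close> by (auto simp: f3_def)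
        then show ?thesis using on_sides g3\<alpha> by blast
      next
        case late: 2
        then have "\<gamma> (tw + s) = \<gamma> (ta + (t - l2 - l3))" using eq by (simp add: f3_def h1_def h4_def)
        moreover have "tw + s \<in> {0..D}" "ta + (t - l2 - l3) \<in> {0..D}"
          using st(1) late tw tab by (auto simp: l1_def l4_def)
        ultimately have "tw + s = ta + (t - l2 - l3)" using inj_onD[OF isometric_inj[OF \<gamma>]] by blast
        then show ?thesis using late st(1) by (auto simp: l4_def)
      qed
    qed
  qed
  have e3: "f3 (l3 + l4) = h4 l4" unfolding f3_def by (rule concat_at_end) (use l14 j34 in auto)
  have e2: "f2 (l2 + (l3 + l4)) = f3 (l3 + l4)" unfolding f2_def by (rule concat_at_end) (use l l14 j23 in auto)
  have e1: "f1 L = f2 (l2 + (l3 + l4))" unfolding f1_def L_def by (rule concat_at_end) (use l l14 j12 in auto)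
  have "f1 L = vertex_point w" using e1 e2 e3 tw'(2) by (simp add: h4_def l4_def)
  moreover have "f1 0 = vertex_point w"
    unfolding f1_def using l14 tw'(2) by (simp add: concat_at_start h1_def)
  moreover have "0 < L" using l l14 by (simp add: L_def)
  ultimately obtain c where c: "is_cycle V E c" "trace c = f1 ` {0..L}" "real (path_length c) = L"
    using closed_arc_is_cycle[OF arc1] by blast
  define R where "R = g2 ` {0..l2} \<union> g3 ` {0..l3}"
  have i3: "f3 ` {0..l3 + l4} = g3 ` {0..l3} \<union> h4 ` {0..l4}"
    unfolding f3_def by (rule concat_at_image) (use l l14 j34 in auto)
  have i2: "f2 ` {0..l2 + (l3 + l4)} = g2 ` {0..l2} \<union> f3 ` {0..l3 + l4}"
    unfolding f2_def by (rule concat_at_image) (use l l14 j23 in auto)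
  have i1: "f1 ` {0..L} = h1 ` {0..l1} \<union> f2 ` {0..l2 + (l3 + l4)}"
    unfolding f1_def L_def by (rule concat_at_image) (use l l14 j12 in auto)
  have "{ta..tb} = {ta..tw} \<union> {tw..tb}" using tw by auto
  then have "\<gamma> ` {ta..tb} = h4 ` {0..l4} \<union> h1 ` {0..l1}" unfolding h1(2) h4(2) by (simp only: image_Un)
  then have tr: "trace c = \<gamma> ` {ta..tb} \<union> R" unfolding c(2) i1 i2 i3 R_def by blast
  have "geodesic_between X d (\<gamma> ta) (\<gamma> tb) (\<gamma> ` {ta..tb})"
    using isometric_geodesic[OF isometric_forward(1)[OF \<gamma>, of ta tb]] isometric_forward(2)[OF \<gamma>, of ta tb] tab
    by simp
  moreover have "geodesic_between X d (\<gamma> tb) (\<alpha> tc) (g2 ` {0..l2})"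
    using isometric_geodesic[OF g2(1)] g2(2,3) \<beta>(3) tc(3) by simp
  moreover have "geodesic_between X d (\<alpha> tc) (\<gamma> ta) (g3 ` {0..l3})"
    using isometric_geodesic[OF g3(1)] g3(2,3) \<alpha>(3) by simp
  moreover have "\<gamma> ta \<in> X" "\<gamma> tb \<in> X" "\<alpha> tc \<in> X"
    using isometric_in[OF \<gamma>] isometric_in[OF \<alpha>(1)] tc(1) tab by auto
  ultimately have "geodesic_triangle X d (\<gamma> ` {ta..tb}) (g2 ` {0..l2}) (g3 ` {0..l3})"
    unfolding geodesic_triangle_def by blast
  moreover have "trace c = \<gamma> ` {ta..tb} \<union> g2 ` {0..l2} \<union> g3 ` {0..l3}"
    using tr unfolding R_def by (simp only: Un_assoc)
  ultimately have "c \<in> triangle_cycles V E" unfolding triangle_cycles_def using c(1) by blast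
  moreover have "R \<subseteq> \<alpha> ` {0..A} \<union> \<beta> ` {0..B}" unfolding R_def using g2\<beta> g3\<alpha> by blast
  moreover have "tb - ta \<le> real (path_length c)" unfolding c(3) L_def using l by (simp add: l1_def l4_def)
  ultimately show ?thesis using that tr by blast
qed

section \<open>Dense shortcuts make triangles thin\<close>

lemma cycle_dist_isometric_le:
  assumes c: "is_cycle V E c" and \<gamma>: "isometric \<gamma> D" and sub: "0 \<le> ta" "tb \<le> D" "\<gamma> ` {ta..tb} \<subseteq> trace c"
    and st: "s \<in> {ta..tb}" "t \<in> {ta..tb}"
  shows "cycle_dist c (\<gamma> s) (\<gamma> t) \<le> \<bar>s - t\<bar>"
proof -
  interpret C: cycle_in_graph V E c by unfold_locales (use c simple in auto)
  have le: "cycle_dist c (\<gamma> x) (\<gamma> y) \<le> y - x" if xy: "x \<in> {ta..tb}" "y \<in> {ta..tb}" "x \<le> y" for x y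
  proof -
    have "\<gamma> ` {x..y} \<subseteq> points (set c) (path_edges c)"
      using sub(3) xy unfolding trace_def by auto
    moreover have "\<bar>\<gamma> p w - \<gamma> q w\<bar> \<le> \<bar>p - q\<bar>" if "p \<in> {x..y}" "q \<in> {x..y}" for p q w
    proof -
      have pq: "p \<in> {0..D}" "q \<in> {0..D}" using that xy sub by auto
      show ?thesis using dist_coordinate[OF isometric_in[OF \<gamma> pq(1)] isometric_in[OF \<gamma> pq(2)], of w]
        isometric_dist[OF \<gamma> pq] by simp
    qed
    ultimately obtain l where "l \<le> y - x" "pl_joined (path_edges c) (\<gamma> x) (\<gamma> y) l"
      using pl_joined_curve[OF C.simple_c xy(3), of \<gamma>] by blast
    then show ?thesis using length_dist_le[of "path_edges c" "\<gamma> x" "\<gamma> y" l] by (simp add: cycle_dist_def)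
  qed
  show ?thesis
  proof (cases "s \<le> t")
    case True
    then show ?thesis using le[OF st] by simp
  next
    case False
    have "cycle_dist c (\<gamma> s) (\<gamma> t) = cycle_dist c (\<gamma> t) (\<gamma> s)" unfolding cycle_dist_def by (rule C.cyc.dist_commute)
    then show ?thesis using le[OF st(2,1)] False by simp
  qed
qed

text \<open>
  A geodesic of the graph that runs inside a cycle is also a shortest curve of the cycle, so a
  shortcut never joins two of its points.
\<close>

lemma shortcut_leaves_geodesic:
  assumes c: "is_cycle V E c" and \<gamma>: "isometric \<gamma> D" and sub: "0 \<le> ta" "tb \<le> D" "\<gamma> ` {ta..tb} \<subseteq> trace c"
    and \<sigma>: "shortcut V E c \<sigma>"
  shows "vertex_point (hd \<sigma>) \<notin> \<gamma> ` {ta..tb} \<or> vertex_point (last \<sigma>) \<notin> \<gamma> ` {ta..tb}"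
proof (rule ccontr)
  assume "\<not> ?thesis"
  then obtain s t where st: "s \<in> {ta..tb}" "vertex_point (hd \<sigma>) = \<gamma> s" "t \<in> {ta..tb}" "vertex_point (last \<sigma>) = \<gamma> t"
    by blast
  have in_D: "{ta..tb} \<subseteq> {0..D}" using sub by auto
  have "cycle_dist c (\<gamma> s) (\<gamma> t) \<le> \<bar>s - t\<bar>"
    by (rule cycle_dist_isometric_le[OF c \<gamma> sub st(1,3)])
  also have "\<bar>s - t\<bar> = d (\<gamma> s) (\<gamma> t)" using isometric_dist[OF \<gamma>] st in_D by (metis subsetD)
  also have "\<dots> \<le> real (path_length \<sigma>)"
    unfolding st(2,4)[symmetric]
    by (rule length_dist_le, rule pl_joined_path)
      (use \<sigma> simple_graph_edge[OF simple] in \<open>auto simp: shortcut_def is_path_def\<close>)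
  also have "\<dots> < cycle_dist c (\<gamma> s) (\<gamma> t)" using \<sigma> st by (simp add: shortcut_def)
  finally show False by simp
qed

text \<open>
  If \<open>p\<close> were far from the other sides, it would lie deep inside one side of a long triangle that is a
  cycle. Some shortcut vertex is within \<open>\<epsilon>\<close> of \<open>p\<close>; of the two ends of its shortcut, at
  most \<open>m\<close> apart, one lies on another side. The summand \<open>k\<close> makes the cycle long enough.
\<close>

lemma chordal_side_close:
  assumes chordal: "densely_chordal_on V E \<epsilon> k m (triangle_cycles V E)" and \<epsilon>: "0 < \<epsilon>"
    and tri: "geodesic_triangle X d S1 S2 S3" and p: "p \<in> S1"
  shows "\<exists>q\<in>S2 \<union> S3. d p q \<le> \<epsilon> + real m + real k + 2"
proof (rule ccontr)
  define \<delta> where "\<delta> = \<epsilon> + real m + real k + 2"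
  assume "\<not> ?thesis"
  then have far: "\<delta> < d p q" if "q \<in> S2 \<union> S3" for q using that unfolding \<delta>_def by force
  obtain x1 x2 x3 where x: "x1 \<in> X" "x2 \<in> X" "x3 \<in> X" "geodesic_between X d x1 x2 S1"
    "geodesic_between X d x2 x3 S2" "geodesic_between X d x3 x1 S3"
    using tri unfolding geodesic_triangle_def by blast
  obtain \<gamma> D where \<gamma>: "isometric \<gamma> D" "\<gamma> 0 = x1" "\<gamma> D = x2" "\<gamma> ` {0..D} = S1"
    by (rule geodesic_isometric[OF x(4,1,2)])
  obtain g2 D2 where g2: "isometric g2 D2" "g2 0 = x2" "g2 D2 = x3" "g2 ` {0..D2} = S2"
    by (rule geodesic_isometric[OF x(5,2,3)])
  obtain g3 D3 where g3: "isometric g3 D3" "g3 0 = x3" "g3 D3 = x1" "g3 ` {0..D3} = S3"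
    by (rule geodesic_isometric[OF x(6,3,1)])
  have nn: "0 \<le> D" "0 \<le> D2" "0 \<le> D3" using \<gamma>(1) g2(1) g3(1) by (auto simp: isometric_def)
  have ends: "x1 \<in> S3" "x2 \<in> S2" "x3 \<in> S2" "x3 \<in> S3"
    unfolding g2(4)[symmetric] g3(4)[symmetric]
    using imageI[of D3 "{0..D3}" g3] imageI[of 0 "{0..D2}" g2] imageI[of D2 "{0..D2}" g2] imageI[of 0 "{0..D3}" g3]
      g2(2,3) g3(2,3) nn by simp_all
  obtain tp where tp: "tp \<in> {0..D}" "p = \<gamma> tp" using p \<gamma>(4) by blast
  define K where "K = {t \<in> {0..D}. \<gamma> t \<in> S2} \<union> {t \<in> {0..D}. \<gamma> t \<in> S3}"
  have K: "t \<in> K \<longleftrightarrow> t \<in> {0..D} \<and> \<gamma> t \<in> S2 \<union> S3" for t unfolding K_def by blast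
  have "compact {t \<in> {0..D}. \<gamma> t \<in> S2}" "compact {t \<in> {0..D}. \<gamma> t \<in> S3}"
    using compact_meeting_times[OF \<gamma>(1) g2(1)] compact_meeting_times[OF \<gamma>(1) g3(1)] g2(4) g3(4) by simp_all
  then have Kc: "compact K" unfolding K_def by (rule compact_Un)
  have "compact (K \<inter> {0..tp})" "compact (K \<inter> {tp..D})"
    using compact_Int_closed[OF Kc closed_atLeastAtMost] by blast+
  moreover have "0 \<in> K \<inter> {0..tp}" "D \<in> K \<inter> {tp..D}" using K \<gamma>(2,3) ends nn tp(1) by auto
  ultimately obtain ta tb where ta: "ta \<in> K \<inter> {0..tp}" "\<And>t. t \<in> K \<inter> {0..tp} \<Longrightarrow> t \<le> ta"
      and tb: "tb \<in> K \<inter> {tp..D}" "\<And>t. t \<in> K \<inter> {tp..D} \<Longrightarrow> tb \<le> t"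
    using compact_attains_sup[of "K \<inter> {0..tp}"] compact_attains_inf[of "K \<inter> {tp..D}"] by blast
  have far_a: "\<delta> < tp - ta" using far[of "\<gamma> ta"] isometric_dist[OF \<gamma>(1) tp(1), of ta] ta(1) K tp(2) by auto
  have far_b: "\<delta> < tb - tp" using far[of "\<gamma> tb"] isometric_dist[OF \<gamma>(1) tp(1), of tb] tb(1) K tp(2) by auto
  have free: "\<gamma> t \<notin> S2 \<union> S3" if t: "t \<in> {ta<..<tb}" for t
  proof
    assume "\<gamma> t \<in> S2 \<union> S3"
    moreover have "t \<in> {0..D}" using t ta(1) tb(1) by auto
    ultimately have "t \<in> K" using K by blast
    then show False using ta(2)[of t] tb(2)[of t] t \<open>t \<in> {0..D}\<close> by (cases "t \<le> tp") auto
  qed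
  have pick: "\<exists>g B s. isometric g B \<and> g ` {0..B} \<in> {S2, S3} \<and> s \<in> {0..B} \<and> \<gamma> t = g s" if "t \<in> K" for t
  proof -
    have "\<gamma> t \<in> S2 \<or> \<gamma> t \<in> S3" using that K by blast
    then show ?thesis
    proof
      assume "\<gamma> t \<in> S2"
      then obtain s where "s \<in> {0..D2}" "\<gamma> t = g2 s" unfolding g2(4)[symmetric] by blast
      then show ?thesis using g2(1,4) by blast
    next
      assume "\<gamma> t \<in> S3"
      then obtain s where "s \<in> {0..D3}" "\<gamma> t = g3 s" unfolding g3(4)[symmetric] by blast
      then show ?thesis using g3(1,4) by blast
    qed
  qed
  obtain \<alpha> A a0 where \<alpha>: "isometric \<alpha> A" "\<alpha> ` {0..A} \<in> {S2, S3}" "a0 \<in> {0..A}" "\<gamma> ta = \<alpha> a0"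
    using pick[of ta] ta(1) by blast
  obtain \<beta> B b0 where \<beta>: "isometric \<beta> B" "\<beta> ` {0..B} \<in> {S2, S3}" "b0 \<in> {0..B}" "\<gamma> tb = \<beta> b0"
    using pick[of tb] tb(1) by blast
  have "x3 \<in> \<alpha> ` {0..A}" using \<alpha>(2) ends(3,4) by auto
  moreover have "x3 \<in> \<beta> ` {0..B}" using \<beta>(2) ends(3,4) by auto
  ultimately have meet: "\<alpha> ` {0..A} \<inter> \<beta> ` {0..B} \<noteq> {}" by blast
  have sides: "\<alpha> ` {0..A} \<union> \<beta> ` {0..B} \<subseteq> S2 \<union> S3" using \<alpha>(2) \<beta>(2) by auto
  have \<delta>2: "2 \<le> \<delta>" unfolding \<delta>_def using \<epsilon> by simp
  have tab: "0 \<le> ta" "ta + 2 \<le> tb" "tb \<le> D" using ta(1) tb(1) far_a far_b \<delta>2 by auto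
  have free': "\<gamma> t \<notin> \<alpha> ` {0..A} \<union> \<beta> ` {0..B}" if "t \<in> {ta<..<tb}" for t
    using free[OF that] sides by blast
  obtain c R where c: "c \<in> triangle_cycles V E" "trace c = \<gamma> ` {ta..tb} \<union> R"
      "R \<subseteq> \<alpha> ` {0..A} \<union> \<beta> ` {0..B}" "tb - ta \<le> real (path_length c)"
    by (rule triangle_cycle_through_side[OF \<gamma>(1) tab \<alpha>(1,3,4) \<beta>(1,3,4) meet free'])
  have cyc: "is_cycle V E c" using c(1) by (simp add: triangle_cycles_def)
  interpret C: cycle_in_graph V E c by unfold_locales (use cyc simple in auto)
  have "real k \<le> real (path_length c)" using c(4) far_a far_b \<delta>2 \<epsilon> unfolding \<delta>_def by linarith
  then have "k \<le> path_length c" by simp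
  from chordal[unfolded densely_chordal_on_def, rule_format, OF c(1) this] obtain \<Sigma> where
      \<Sigma>1: "\<forall>\<sigma>\<in>\<Sigma>. strict_shortcut V E c \<sigma> \<and> path_length \<sigma> \<le> m"
      and \<Sigma>2: "eps_dense (trace c) (cycle_dist c) \<epsilon> (\<Union>\<sigma>\<in>\<Sigma>. shortcut_vertices \<sigma>)"
    by blast
  have pc: "p \<in> trace c" unfolding c(2) using tp(2) far_a far_b \<delta>2 by auto
  obtain v \<sigma> where v: "\<sigma> \<in> \<Sigma>" "v \<in> shortcut_vertices \<sigma>" "cycle_dist c v p < \<epsilon>"
    using bspec[OF conjunct2[OF \<Sigma>2[unfolded eps_dense_def]] pc] by blast
  have \<sigma>: "shortcut V E c \<sigma>" "path_length \<sigma> \<le> m" using bspec[OF \<Sigma>1 v(1)] by (auto simp: strict_shortcut_def)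
  have on_c: "vertex_point (hd \<sigma>) \<in> trace c" "vertex_point (last \<sigma>) \<in> trace c"
    using \<sigma>(1) unfolding shortcut_def trace_def by (auto intro: vertex_pointI)
  have vc: "v \<in> trace c" using v(2) on_c by (auto simp: shortcut_vertices_def)
  have pX: "p \<in> X" "v \<in> X" "vertex_point (hd \<sigma>) \<in> X" "vertex_point (last \<sigma>) \<in> X"
    using C.trace_subset pc vc on_c by auto
  have pv: "d p v < \<epsilon>" using C.dist_le_dC[OF vc pc] v(3) dist_commute[of p v] by simp
  have len: "d (vertex_point (hd \<sigma>)) (vertex_point (last \<sigma>)) \<le> real m"
  proof -
    have "d (vertex_point (hd \<sigma>)) (vertex_point (last \<sigma>)) \<le> real (path_length \<sigma>)"
      by (rule length_dist_le, rule pl_joined_path)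
        (use \<sigma> simple_graph_edge[OF simple] in \<open>auto simp: shortcut_def is_path_def\<close>)
    then show ?thesis using \<sigma>(2) by linarith
  qed
  have near: "d p y \<le> \<epsilon> + real m" if "y = vertex_point (hd \<sigma>) \<or> y = vertex_point (last \<sigma>)" for y
  proof -
    have "d v y \<le> real m"
      using v(2) that len dist_refl pX dist_commute[of "vertex_point (hd \<sigma>)" "vertex_point (last \<sigma>)"]
      by (auto simp: shortcut_vertices_def)
    moreover have "d p y \<le> d p v + d v y" by (rule dist_triangle) (use pX that in auto)
    ultimately show ?thesis using pv by simp
  qed
  have "vertex_point (hd \<sigma>) \<notin> \<gamma> ` {ta..tb} \<or> vertex_point (last \<sigma>) \<notin> \<gamma> ` {ta..tb}"
    by (rule shortcut_leaves_geodesic[OF cyc \<gamma>(1) _ _ _ \<sigma>(1)]) (use ta(1) tb(1) c(2) in auto)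
  then obtain y where y: "y = vertex_point (hd \<sigma>) \<or> y = vertex_point (last \<sigma>)" "y \<notin> \<gamma> ` {ta..tb}" by blast
  then have "y \<in> R" using on_c c(2) by auto
  then have "\<delta> < d p y" using far c(3) sides by blast
  then show False using near[OF y(1)] unfolding \<delta>_def by simp
qed

theorem chordal_imp_hyperbolic:
  assumes "densely_chordal_on V E \<epsilon> k m (triangle_cycles V E)" "0 < \<epsilon>"
  shows "hyperbolic_graph V E (\<epsilon> + real m + real k + 2)"
  unfolding hyperbolic_graph_def hyperbolic_def thin_triangle_def
proof (intro allI impI)
  fix S1 S2 S3 assume tri: "geodesic_triangle X d S1 S2 S3"
  have *: "S \<subseteq> neighborhood X d (\<epsilon> + real m + real k + 2) (S' \<union> S'')"
    if "geodesic_triangle X d S S' S''" for S S' S''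
    unfolding neighborhood_def using chordal_side_close[OF assms that] geodesic_triangle_in_points[OF that] by blast
  show "S1 \<subseteq> neighborhood X d (\<epsilon> + real m + real k + 2) (S2 \<union> S3) \<and>
      S2 \<subseteq> neighborhood X d (\<epsilon> + real m + real k + 2) (S3 \<union> S1) \<and>
      S3 \<subseteq> neighborhood X d (\<epsilon> + real m + real k + 2) (S1 \<union> S2)"
    using *[OF tri] *[OF geodesic_triangle_rotate[OF tri]] *[OF geodesic_triangle_rotate[OF geodesic_triangle_rotate[OF tri]]]
    by blast
qed

end

section \<open>A triangle that is a cycle consists of three consecutive arcs\<close>

lemma (in cycle_in_graph) dC_circle_shift:
  obtains k :: int where "dC (circle s) (circle t) = \<bar>s - t - of_int k * real n\<bar>"
  using dC_circle by blast

locale cycle_in_metric_graph = metric_graph V E for V :: "'v set" and E :: "'v set set" +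
  fixes c :: "'v list"
  assumes is_cycle: "is_cycle V E c"
begin

sublocale C: cycle_in_graph V E c
  by unfold_locales (use simple is_cycle in auto)

abbreviation n :: nat where "n \<equiv> path_length c"
abbreviation dC :: "('v \<Rightarrow> real) \<Rightarrow> ('v \<Rightarrow> real) \<Rightarrow> real" where "dC \<equiv> cycle_dist c"

lemma dC_isometric:
  assumes f: "isometric f A" "f ` {0..A} \<subseteq> trace c" and st: "s \<in> {0..A}" "t \<in> {0..A}"
  shows "dC (f s) (f t) = \<bar>s - t\<bar>"
proof (rule antisym)
  show "dC (f s) (f t) \<le> \<bar>s - t\<bar>" by (rule cycle_dist_isometric_le[OF is_cycle f(1) _ _ f(2) st]) auto
  have "f s \<in> trace c" "f t \<in> trace c" using f(2) st by auto
  then show "\<bar>s - t\<bar> \<le> dC (f s) (f t)" using C.dist_le_dC isometric_dist[OF f(1) st] by metis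
qed

text \<open>
  The point at distance \<open>t\<close> from the start is one of two points of the circle. The midpoint of the
  geodesic fixes the choice; the exception \<open>t = n / 2\<close> does no harm since the two points then agree.
\<close>

lemma isometric_on_circle:
  assumes f: "isometric f A" "f ` {0..A} \<subseteq> trace c" and f0: "f 0 = C.circle a"
  shows "A \<le> real n / 2" "\<exists>\<sigma>\<in>{-1, 1}. \<forall>t\<in>{0..A}. f t = C.circle (a + \<sigma> * t)"
proof -
  have A: "0 \<le> A" using f by (simp add: isometric_def)
  have n3: "3 \<le> real n" using C.n_ge_3 by simp
  have half: "t \<le> real n / 2" if t: "t \<in> {0..A}" for t
  proof -
    have "f 0 \<in> trace c" "f t \<in> trace c" using f(2) t A by auto
    then obtain b where b: "f t = C.circle b" using C.circle_surj by blast
    have "t = dC (f 0) (f t)" using dC_isometric[OF f, of 0 t] t by simp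
    then show ?thesis using C.dC_le_half[of a b] b f0 by simp
  qed
  then show "A \<le> real n / 2" using A by simp
  have either: "\<exists>\<sigma>\<in>{-1, 1}. f t = C.circle (a + \<sigma> * t)" if t: "t \<in> {0..A}" for t
  proof -
    have "f t \<in> trace c" using f(2) t by auto
    then obtain b where b: "f t = C.circle b" using C.circle_surj by blast
    obtain k where k: "dC (C.circle a) (C.circle b) = \<bar>a - b - of_int k * real n\<bar>"
      by (rule C.dC_circle_shift)
    have "dC (f 0) (f t) = t" using dC_isometric[OF f, of 0 t] t by simp
    then have "\<bar>a - b - of_int k * real n\<bar> = t" using k b f0 by simp
    then have "b + of_int k * real n = a + -1 * t \<or> b + of_int k * real n = a + 1 * t" by linarith
    then show ?thesis using C.circle_periodic[of b k] b by auto
  qed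
  show "\<exists>\<sigma>\<in>{-1, 1}. \<forall>t\<in>{0..A}. f t = C.circle (a + \<sigma> * t)"
  proof (cases "A = 0")
    case True
    then show ?thesis using f0 by auto
  next
    case False
    define t0 where "t0 = A / 2"
    have t0: "t0 \<in> {0..A}" "0 < t0" "A = 2 * t0" using A False by (auto simp: t0_def)
    have t0n: "4 * t0 \<le> real n" using half[of A] A t0(3) by simp
    obtain \<sigma> where \<sigma>: "\<sigma> \<in> {-1, 1}" "f t0 = C.circle (a + \<sigma> * t0)" using either[OF t0(1)] by blast
    have "f t = C.circle (a + \<sigma> * t)" if t: "t \<in> {0..A}" for t
    proof (rule ccontr)
      assume not: "f t \<noteq> C.circle (a + \<sigma> * t)"
      obtain \<sigma>' where \<sigma>': "\<sigma>' \<in> {-1, 1}" "f t = C.circle (a + \<sigma>' * t)" using either[OF t] by blast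
      then have ft: "f t = C.circle (a - \<sigma> * t)" using not \<sigma>(1) by auto
      obtain k where k: "dC (C.circle (a - \<sigma> * t)) (C.circle (a + \<sigma> * t0)) = \<bar>a - \<sigma> * t - (a + \<sigma> * t0) - of_int k * real n\<bar>"
        by (rule C.dC_circle_shift)
      have "\<exists>j::int. \<bar>a - \<sigma> * t - (a + \<sigma> * t0) - of_int k * real n\<bar> = \<bar>t + t0 - of_int j * real n\<bar>"
      proof -
        from \<sigma>(1) consider "\<sigma> = 1" | "\<sigma> = -1" by blast
        then show ?thesis
        proof cases
          case 1
          then show ?thesis by (intro exI[of _ "- k"]) simp
        next
          case 2
          then show ?thesis by (intro exI[of _ k]) simp
        qed
      qed
      then obtain j :: int where j: "\<bar>t - t0\<bar> = \<bar>t + t0 - of_int j * real n\<bar>"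
        using dC_isometric[OF f t t0(1)] ft \<sigma>(2) k by auto
      have bounds: "0 \<le> t" "t \<le> 2 * t0" "0 < t0" "4 * t0 \<le> real n" using t t0 t0n by auto
      consider "j \<le> -1" | "j = 0" | "j = 1" | "2 \<le> j" by linarith
      then show False
      proof cases
        case 1
        then have "of_int j * real n \<le> - 1 * real n" by (intro mult_right_mono) auto
        then show False using j bounds n3 by linarith
      next
        case 2
        then have "t = 0" using j bounds by simp
        then show False using not f0 by simp
      next
        case 3
        then have "2 * t = real n" using j bounds n3 by (auto simp: abs_if split: if_splits)
        then have "a - \<sigma> * t = a + \<sigma> * t - \<sigma> * real n" by (simp flip: \<open>2 * t = real n\<close>)
        then have "a - \<sigma> * t = a + \<sigma> * t + of_int (if \<sigma> = 1 then -1 else 1) * real n" using \<sigma>(1) by auto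
        then have "C.circle (a - \<sigma> * t) = C.circle (a + \<sigma> * t)"
          using C.circle_periodic[of "a + \<sigma> * t" "if \<sigma> = 1 then -1 else 1"] by (simp only:)
        then show False using not ft by simp
      next
        case 4
        then have "2 * real n \<le> of_int j * real n" by (intro mult_right_mono) auto
        then show False using j bounds n3 by linarith
      qed
    qed
    then show ?thesis using \<sigma>(1) by blast
  qed
qed

text \<open>
  Lifted to the line, the three sides form a path whose end differs from its start by \<open>k n\<close>. For
  \<open>k = 0\<close> it stays in an interval of length at most \<open>n / 2\<close> and cannot cover the circle.
  Otherwise \<open>k = 1\<close> or \<open>k = -1\<close>, and since no side is longer than \<open>n / 2\<close>, none of them runs backwards.
\<close>

lemma triangle_on_circle:
  assumes tri: "geodesic_triangle X d S1 S2 S3" and tr: "trace c = S1 \<union> S2 \<union> S3"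
  obtains a \<sigma> b1 b2 where "\<sigma> \<in> {-1, 1}" "0 \<le> b1" "b1 \<le> b2" "b2 \<le> real n"
    "S1 = (\<lambda>t. C.circle (a + \<sigma> * t)) ` {0..b1}"
    "S2 = (\<lambda>t. C.circle (a + \<sigma> * t)) ` {b1..b2}"
    "S3 = (\<lambda>t. C.circle (a + \<sigma> * t)) ` {b2..real n}"
proof -
  obtain x1 x2 x3 where x: "x1 \<in> X" "x2 \<in> X" "x3 \<in> X" "geodesic_between X d x1 x2 S1"
    "geodesic_between X d x2 x3 S2" "geodesic_between X d x3 x1 S3"
    using tri unfolding geodesic_triangle_def by blast
  obtain f1 l1 where f1: "isometric f1 l1" "f1 0 = x1" "f1 l1 = x2" "f1 ` {0..l1} = S1"
    by (rule geodesic_isometric[OF x(4,1,2)])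
  obtain f2 l2 where f2: "isometric f2 l2" "f2 0 = x2" "f2 l2 = x3" "f2 ` {0..l2} = S2"
    by (rule geodesic_isometric[OF x(5,2,3)])
  obtain f3 l3 where f3: "isometric f3 l3" "f3 0 = x3" "f3 l3 = x1" "f3 ` {0..l3} = S3"
    by (rule geodesic_isometric[OF x(6,3,1)])
  have l: "0 \<le> l1" "0 \<le> l2" "0 \<le> l3" using f1(1) f2(1) f3(1) by (auto simp: isometric_def)
  have n3: "3 \<le> real n" using C.n_ge_3 by simp
  have sub: "f1 ` {0..l1} \<subseteq> trace c" "f2 ` {0..l2} \<subseteq> trace c" "f3 ` {0..l3} \<subseteq> trace c"
    using tr f1(4) f2(4) f3(4) by auto
  have "x1 \<in> trace c" using sub(1) f1(2) l by force
  then obtain a where a: "x1 = C.circle a" using C.circle_surj by blast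
  note c1 = isometric_on_circle[OF f1(1) sub(1) f1(2)[unfolded a]]
  obtain \<sigma>1 where \<sigma>1: "\<sigma>1 \<in> {-1, 1}" "\<And>t. t \<in> {0..l1} \<Longrightarrow> f1 t = C.circle (a + \<sigma>1 * t)"
    using c1(2) by blast
  define e1 where "e1 = \<sigma>1 * l1"
  have x2: "f2 0 = C.circle (a + e1)" using \<sigma>1(2)[of l1] f1(3) f2(2) l by (simp add: e1_def)
  note c2 = isometric_on_circle[OF f2(1) sub(2) x2]
  obtain \<sigma>2 where \<sigma>2: "\<sigma>2 \<in> {-1, 1}" "\<And>t. t \<in> {0..l2} \<Longrightarrow> f2 t = C.circle (a + e1 + \<sigma>2 * t)"
    using c2(2) by blast
  define e2 where "e2 = \<sigma>2 * l2"
  have x3: "f3 0 = C.circle (a + e1 + e2)" using \<sigma>2(2)[of l2] f2(3) f3(2) l by (simp add: e2_def)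
  note c3 = isometric_on_circle[OF f3(1) sub(3) x3]
  obtain \<sigma>3 where \<sigma>3: "\<sigma>3 \<in> {-1, 1}" "\<And>t. t \<in> {0..l3} \<Longrightarrow> f3 t = C.circle (a + e1 + e2 + \<sigma>3 * t)"
    using c3(2) by blast
  define e3 where "e3 = \<sigma>3 * l3"
  have "C.circle (a + e1 + e2 + e3) = C.circle a" using \<sigma>3(2)[of l3] f3(3) a l by (simp add: e3_def)
  then obtain k :: int where "a + e1 + e2 + e3 = a + of_int k * real n" by (rule C.circle_inj)
  then have k: "e1 + e2 + e3 = of_int k * real n" by simp
  have e: "\<bar>e1\<bar> = l1" "\<bar>e2\<bar> = l2" "\<bar>e3\<bar> = l3"
    using \<sigma>1(1) \<sigma>2(1) \<sigma>3(1) l by (auto simp: e1_def e2_def e3_def)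
  have e_le: "\<bar>e1\<bar> \<le> real n / 2" "\<bar>e2\<bar> \<le> real n / 2" "\<bar>e3\<bar> \<le> real n / 2" using e c1(1) c2(1) c3(1) by auto
  have k2: "k < 2"
  proof (rule ccontr)
    assume "\<not> k < 2"
    then have "2 * real n \<le> of_int k * real n" by (intro mult_right_mono) auto
    then show False using k e_le n3 by linarith
  qed
  have k_2: "-2 < k"
  proof (rule ccontr)
    assume "\<not> -2 < k"
    then have "of_int k * real n \<le> -2 * real n" by (intro mult_right_mono) auto
    then show False using k e_le n3 by linarith
  qed
  have k0: "k \<noteq> 0"
  proof
    assume "k = 0"
    then have sum0: "e1 + e2 + e3 = 0" using k by simp
    define lo where "lo = min 0 (min e1 (e1 + e2))"
    define hi where "hi = max 0 (max e1 (e1 + e2))"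
    have pts: "lo \<le> 0" "0 \<le> hi" "lo \<le> e1" "e1 \<le> hi" "lo \<le> e1 + e2" "e1 + e2 \<le> hi"
      by (auto simp: lo_def hi_def)
    have width: "hi - lo \<le> real n / 2"
      unfolding lo_def hi_def using e_le sum0 by (auto simp: min_def max_def abs_if split: if_splits)
    \<comment> \<open>The middle of the gap between the interval and its next translate.\<close>
    define y where "y = hi + (real n - (hi - lo)) / 2"
    have "C.circle (a + y) \<in> S1 \<union> S2 \<union> S3" using C.circle_in_trace tr by blast
    then obtain z where z: "C.circle (a + y) = C.circle (a + z)" "lo \<le> z" "z \<le> hi"
    proof (elim UnE)
      assume "C.circle (a + y) \<in> S1"
      then obtain t where t: "t \<in> {0..l1}" "C.circle (a + y) = f1 t" unfolding f1(4)[symmetric] by blast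
      have "lo \<le> \<sigma>1 * t" "\<sigma>1 * t \<le> hi" using t(1) pts \<sigma>1(1) by (auto simp: e1_def)
      then show thesis using that t(2) \<sigma>1(2)[OF t(1)] by simp
    next
      assume "C.circle (a + y) \<in> S2"
      then obtain t where t: "t \<in> {0..l2}" "C.circle (a + y) = f2 t" unfolding f2(4)[symmetric] by blast
      have "lo \<le> e1 + \<sigma>2 * t" "e1 + \<sigma>2 * t \<le> hi" using t(1) pts \<sigma>2(1) by (auto simp: e2_def)
      then show thesis using that[of "e1 + \<sigma>2 * t"] t(2) \<sigma>2(2)[OF t(1)] by (simp add: add.assoc)
    next
      assume "C.circle (a + y) \<in> S3"
      then obtain t where t: "t \<in> {0..l3}" "C.circle (a + y) = f3 t" unfolding f3(4)[symmetric] by blast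
      have "lo \<le> e1 + e2 + \<sigma>3 * t" "e1 + e2 + \<sigma>3 * t \<le> hi"
        using t(1) pts \<sigma>3(1) sum0 by (auto simp: e3_def)
      then show thesis using that[of "e1 + e2 + \<sigma>3 * t"] t(2) \<sigma>3(2)[OF t(1)] by (simp add: add.assoc)
    qed
    obtain j :: int where "a + y = a + z + of_int j * real n" using C.circle_inj[OF z(1)] by blast
    then have j: "y - z = of_int j * real n" by simp
    have "0 < y - z" "y - z < real n" using z(2,3) width pts n3 unfolding y_def by (simp_all add: field_simps)
    then have "0 < of_int j * real n" "of_int j * real n < 1 * real n" using j by auto
    then have "0 < (of_int j :: real)" "(of_int j :: real) < 1"
      using n3 by (auto simp: zero_less_mult_iff mult_less_cancel_right)
    then show False by simp
  qed
  define \<sigma> where "\<sigma> = real_of_int k"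
  have \<sigma>: "\<sigma> \<in> {-1, 1}" using k2 k_2 k0 unfolding \<sigma>_def by auto
  have kn: "e1 + e2 + e3 = \<sigma> * real n" using k by (simp add: \<sigma>_def)
  have es: "e1 = \<sigma> * l1" "e2 = \<sigma> * l2" "e3 = \<sigma> * l3"
    using \<sigma> kn e e_le by (auto simp: abs_if split: if_splits)
  have same: "\<sigma>1 * t = \<sigma> * t" if "t \<in> {0..l1}" for t
    using es(1) that \<sigma>1(1) \<sigma> by (auto simp: e1_def)
  have same2: "\<sigma>2 * t = \<sigma> * t" if "t \<in> {0..l2}" for t
    using es(2) that \<sigma>2(1) \<sigma> by (auto simp: e2_def)
  have same3: "\<sigma>3 * t = \<sigma> * t" if "t \<in> {0..l3}" for t
    using es(3) that \<sigma>3(1) \<sigma> by (auto simp: e3_def)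
  let ?\<psi> = "\<lambda>t. C.circle (a + \<sigma> * t)"
  have total: "l1 + l2 + l3 = real n" using kn es \<sigma> by auto
  have shift: "{b..b + l} = (+) b ` {0..l}" for b l :: real by simp
  have S1: "S1 = ?\<psi> ` {0..l1}" unfolding f1(4)[symmetric] using \<sigma>1(2) same by (intro image_cong) auto
  have S2: "S2 = ?\<psi> ` {l1..l1 + l2}"
    unfolding f2(4)[symmetric] shift image_image
    using \<sigma>2(2) same2 es(1) by (intro image_cong) (auto simp: distrib_left add.assoc)
  have "S3 = ?\<psi> ` {l1 + l2..l1 + l2 + l3}"
    unfolding f3(4)[symmetric] shift image_image
    using \<sigma>3(2) same3 es(1,2) by (intro image_cong) (auto simp: distrib_left add.assoc)
  then have S3: "S3 = ?\<psi> ` {l1 + l2..real n}" using total by simp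
  show ?thesis by (rule that[OF \<sigma> l(1) _ _ S1 S2 S3]) (use l total in auto)
qed

end

section \<open>Thin triangles have dense shortcuts\<close>

text \<open>
  The candidates are \<open>2 R\<close> apart, so each element of \<open>B\<close> is closer than \<open>R\<close> to at most one of them, and
  there are more candidates than elements.
\<close>

lemma spread_point:
  fixes B :: "real set"
  assumes "finite B" "card B \<le> N" "0 < R"
  shows "\<exists>j\<le>N. \<forall>b\<in>B. R \<le> \<bar>x + 2 * R * real j - b\<bar>"
proof (rule ccontr)
  assume "\<not> ?thesis"
  then have "\<forall>j\<in>{..N}. \<exists>b\<in>B. \<bar>x + 2 * R * real j - b\<bar> < R" by (meson atMost_iff not_le)
  then obtain g where g: "\<And>j. j \<in> {..N} \<Longrightarrow> g j \<in> B \<and> \<bar>x + 2 * R * real j - g j\<bar> < R" by metis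
  have "inj_on g {..N}"
  proof (rule inj_onI)
    fix i j assume ij: "i \<in> {..N}" "j \<in> {..N}" "g i = g j"
    then have "\<bar>2 * R * real i - 2 * R * real j\<bar> < 2 * R" using g[of i] g[of j] by linarith
    then have "2 * R * \<bar>real i - real j\<bar> < 2 * R * 1"
      using assms(3) by (simp add: abs_mult flip: right_diff_distrib)
    then have "\<bar>real i - real j\<bar> < 1" using assms(3) by (simp only: mult_less_cancel_left_pos)
    then show "i = j" by linarith
  qed
  then have "card {..N} \<le> card B" using g assms(1) by (intro card_inj_on_le) auto
  then show False using assms(2) by simp
qed

context cycle_in_metric_graph
begin

text \<open>
  Of the eight points at distances \<open>0, 2 R, \<dots>, 14 R\<close> after \<open>x\<close> on the circle, one stays \<open>R\<close> away from the
  corners, since the corners have at most seven lifts to the two windings \<open>[0, 2 n]\<close> that contain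
  these points. Thinness connects it to another side, which is far along the cycle.
\<close>

lemma thin_pair_near:
  assumes tri: "geodesic_triangle X d S1 S2 S3" and tr: "trace c = S1 \<union> S2 \<union> S3"
    and hyp: "hyperbolic_graph V E \<delta>" and R: "0 < R" "14 * R < real n" and x: "x \<in> trace c"
  shows "\<exists>p\<in>trace c. \<exists>q\<in>trace c. dC x p \<le> 14 * R \<and> d p q \<le> \<delta> \<and> R \<le> dC p q"
proof -
  obtain a \<sigma> b1 b2 where \<sigma>: "\<sigma> \<in> {-1, 1}" and b: "0 \<le> b1" "b1 \<le> b2" "b2 \<le> real n"
    and S: "S1 = (\<lambda>t. C.circle (a + \<sigma> * t)) ` {0..b1}"
      "S2 = (\<lambda>t. C.circle (a + \<sigma> * t)) ` {b1..b2}"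
      "S3 = (\<lambda>t. C.circle (a + \<sigma> * t)) ` {b2..real n}"
    by (rule triangle_on_circle[OF tri tr])
  define \<psi> where "\<psi> = (\<lambda>t. C.circle (a + \<sigma> * t))"
  have n0: "0 < real n" using C.n_ge_3 by simp
  have \<psi>_trace: "\<psi> t \<in> trace c" for t unfolding \<psi>_def by (rule C.circle_in_trace)
  have \<psi>_periodic: "\<psi> (t + of_int k * real n) = \<psi> t" for t k
  proof -
    from \<sigma> consider "\<sigma> = 1" | "\<sigma> = -1" by blast
    then show ?thesis
    proof cases
      case 1
      then show ?thesis using C.circle_periodic[of "a + t" k] by (simp add: \<psi>_def add.assoc)
    next
      case 2
      then show ?thesis using C.circle_periodic[of "a - t" "- k"] by (simp add: \<psi>_def algebra_simps)
    qed
  qed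
  have \<psi>_dist_le: "dC (\<psi> s) (\<psi> t) \<le> \<bar>s - t\<bar>" for s t
    using C.dC_le[of "a + \<sigma> * s" "a + \<sigma> * t"] \<sigma> by (auto simp: \<psi>_def abs_minus_commute)
  have \<psi>_dist: "\<exists>k::int. dC (\<psi> s) (\<psi> t) = \<bar>s - t - of_int k * real n\<bar>" for s t
  proof -
    obtain k where k: "dC (\<psi> s) (\<psi> t) = \<bar>a + \<sigma> * s - (a + \<sigma> * t) - of_int k * real n\<bar>"
      unfolding \<psi>_def by (rule C.dC_circle_shift)
    from \<sigma> consider "\<sigma> = 1" | "\<sigma> = -1" by blast
    then show ?thesis
    proof cases
      case 1
      then show ?thesis using k by (intro exI[of _ k]) simp
    next
      case 2
      then show ?thesis using k by (intro exI[of _ "- k"]) simp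
    qed
  qed
  obtain \<tau>0 where \<tau>0: "0 \<le> \<tau>0" "\<tau>0 < real n" "x = \<psi> \<tau>0"
  proof -
    obtain s where s: "x = C.circle s" by (rule C.circle_surj[OF x])
    define y where "y = \<sigma> * (s - a)"
    have "a + \<sigma> * y = s" using \<sigma> by (auto simp: y_def)
    then have "x = \<psi> y" using s by (simp add: \<psi>_def)
    also have "\<dots> = \<psi> (y + of_int (- \<lfloor>y / real n\<rfloor>) * real n)" by (simp only: \<psi>_periodic)
    finally have "x = \<psi> (y - of_int \<lfloor>y / real n\<rfloor> * real n)" by simp
    moreover have "0 \<le> y - of_int \<lfloor>y / real n\<rfloor> * real n"
      using pos_le_divide_eq[OF n0, THEN iffD1, OF of_int_floor_le, of y] by simp
    moreover have "y - of_int \<lfloor>y / real n\<rfloor> * real n < real n"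
    proof -
      have "y / real n < of_int \<lfloor>y / real n\<rfloor> + 1" by linarith
      from pos_divide_less_eq[OF n0, THEN iffD1, OF this] show ?thesis by (simp add: distrib_right)
    qed
    ultimately show ?thesis using that by blast
  qed
  define B where "B = {0, b1, b2, real n, real n + b1, real n + b2, 2 * real n}"
  have "finite B" "card B \<le> 7" unfolding B_def by (auto simp: card_insert_if)
  from spread_point[OF this R(1), of \<tau>0] obtain j where j: "j \<le> 7" "\<And>z. z \<in> B \<Longrightarrow> R \<le> \<bar>\<tau>0 + 2 * R * real j - z\<bar>"
    by blast
  define \<tau> where "\<tau> = \<tau>0 + 2 * R * real j"
  have jR: "0 \<le> R * real j" "R * real j \<le> R * 7" using R(1) j(1) by (auto intro!: mult_left_mono)
  have \<tau>: "\<tau>0 \<le> \<tau>" "\<tau> - \<tau>0 \<le> 14 * R" "\<tau> < 2 * real n" using jR \<tau>0 R(2) unfolding \<tau>_def by linarith+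
  define \<tau>' where "\<tau>' = (if \<tau> < real n then \<tau> else \<tau> - real n)"
  have \<tau>': "0 \<le> \<tau>'" "\<tau>' \<le> real n" using \<tau> \<tau>0 by (auto simp: \<tau>'_def)
  have away: "R \<le> \<bar>\<tau>' - z\<bar>" if "z \<in> {0, b1, b2, real n}" for z
  proof (cases "\<tau> < real n")
    case True
    then show ?thesis using j(2)[of z] that by (auto simp: B_def \<tau>'_def \<tau>_def)
  next
    case False
    then have "\<tau>' - z = \<tau>0 + 2 * R * real j - (real n + z)" by (simp add: \<tau>'_def \<tau>_def)
    moreover have "real n + z \<in> B" using that by (auto simp: B_def)
    ultimately show ?thesis using j(2) by metis
  qed
  define p where "p = \<psi> \<tau>'"
  have "p = \<psi> \<tau>" unfolding p_def \<tau>'_def using \<psi>_periodic[of \<tau> "-1"] by simp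
  then have xp: "dC x p \<le> 14 * R" using \<psi>_dist_le[of \<tau>0 \<tau>] \<tau>0(3) \<tau>(1,2) by simp
  \<comment> \<open>The side of \<open>p\<close> is the arc \<open>{lo..hi}\<close>; all lifts of the other sides avoid its interior.\<close>
  have separated: "R \<le> dC p (\<psi> u)"
    if I: "0 \<le> lo" "hi \<le> real n" "lo + R \<le> \<tau>'" "\<tau>' \<le> hi - R" and u: "0 \<le> u" "u \<le> real n" "u \<le> lo \<or> hi \<le> u" for lo hi u
  proof -
    obtain k :: int where k: "dC p (\<psi> u) = \<bar>\<tau>' - u - of_int k * real n\<bar>" unfolding p_def using \<psi>_dist by blast
    consider "k \<le> -1" | "k = 0" | "1 \<le> k" by linarith
    then show ?thesis
    proof cases
      case 1
      then have "of_int k * real n \<le> - 1 * real n" by (intro mult_right_mono) auto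
      then show ?thesis unfolding k using I u by linarith
    next
      case 2
      then show ?thesis unfolding k using I u(3) by auto
    next
      case 3
      then have "1 * real n \<le> of_int k * real n" by (intro mult_right_mono) auto
      then show ?thesis unfolding k using I u by linarith
    qed
  qed
  have thin: "thin_triangle X d \<delta> S1 S2 S3"
    using hyp tri unfolding hyperbolic_graph_def hyperbolic_def by blast
  have S': "S1 = \<psi> ` {0..b1}" "S2 = \<psi> ` {b1..b2}" "S3 = \<psi> ` {b2..real n}" unfolding \<psi>_def by (rule S)+
  have glue: "{b1..b2} \<union> {b2..real n} = {b1..real n}" "{0..b1} \<union> {b1..b2} = {0..b2}" using b by auto
  consider "\<tau>' \<le> b1" | "b1 \<le> \<tau>'" "\<tau>' \<le> b2" | "b2 \<le> \<tau>'" by linarith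
  then have "\<exists>q\<in>trace c. d p q \<le> \<delta> \<and> R \<le> dC p q"
  proof cases
    case 1
    then have "p \<in> S1" unfolding S'(1) p_def using \<tau>'(1) by auto
    then obtain q where q: "q \<in> S2 \<union> S3" "d p q \<le> \<delta>" using thin unfolding thin_triangle_def neighborhood_def by blast
    then obtain u where u: "u \<in> {b1..real n}" "q = \<psi> u" unfolding S'(2,3) image_Un[symmetric] glue by blast
    have "0 + R \<le> \<tau>'" "\<tau>' \<le> b1 - R" using away[of 0] away[of b1] 1 \<tau>' by auto
    then have "R \<le> dC p q" unfolding u(2) by (rule separated[of 0 b1, rotated 2]) (use u b in auto)
    then show ?thesis using q(2) u(2) \<psi>_trace by blast
  next
    case 2
    then have "p \<in> S2" unfolding S'(2) p_def by auto
    then obtain q where q: "q \<in> S3 \<union> S1" "d p q \<le> \<delta>" using thin unfolding thin_triangle_def neighborhood_def by blast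
    then obtain u where u: "u \<in> {0..b1} \<union> {b2..real n}" "q = \<psi> u" unfolding S'(1,3) by blast
    have "b1 + R \<le> \<tau>'" "\<tau>' \<le> b2 - R" using away[of b1] away[of b2] 2 by auto
    then have "R \<le> dC p q" unfolding u(2) by (rule separated[of b1 b2, rotated 2]) (use u b in auto)
    then show ?thesis using q(2) u(2) \<psi>_trace by blast
  next
    case 3
    then have "p \<in> S3" unfolding S'(3) p_def using \<tau>'(2) by auto
    then obtain q where q: "q \<in> S1 \<union> S2" "d p q \<le> \<delta>" using thin unfolding thin_triangle_def neighborhood_def by blast
    then obtain u where u: "u \<in> {0..b2}" "q = \<psi> u" unfolding S'(1,2) image_Un[symmetric] glue by blast
    have "b2 + R \<le> \<tau>'" "\<tau>' \<le> real n - R" using away[of b2] away[of "real n"] 3 \<tau>' by auto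
    then have "R \<le> dC p q" unfolding u(2) by (rule separated[of b2 "real n", rotated 2]) (use u b in auto)
    then show ?thesis using q(2) u(2) \<psi>_trace by blast
  qed
  moreover have "p \<in> trace c" unfolding p_def by (rule \<psi>_trace)
  ultimately show ?thesis using xp by blast
qed

lemma vertex_near:
  assumes "p \<in> trace c" obtains v where "v \<in> set c" "dC p (vertex_point v) \<le> 1"
proof -
  obtain t where t: "p = C.circle t" by (rule C.circle_surj[OF assms])
  obtain i r k where i: "i < n" "0 \<le> r" "r < 1" "t = real i + r + of_int k * real n"
    by (rule C.circle_coordinates)
  have "C.circle (real i + of_int k * real n) = edge_point (c ! i) (c ! Suc i) 0"
    by (rule C.circle_edge[OF i(1), where k = k]) auto
  then have "vertex_point (c ! i) = C.circle (real i + of_int k * real n)" by (simp add: edge_point_0)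
  then have "dC p (vertex_point (c ! i)) \<le> \<bar>t - (real i + of_int k * real n)\<bar>"
    using t C.dC_le by simp
  also have "\<dots> \<le> 1" using i by simp
  finally show ?thesis using that[of "c ! i"] i(1) C.length_c by simp
qed

text \<open>
  Along a path between points of the cycle that are closer in the graph than in the cycle, let \<open>P ! i\<close> be
  the last vertex on the cycle up to which the path has gained nothing. The stretch from there to the next
  vertex on the cycle is a strict shortcut.
\<close>

lemma strict_shortcut_on_path:
  assumes P: "is_path V E P" "hd P \<in> set c" "last P \<in> set c"
    and gain: "real (path_length P) < dC (vertex_point (hd P)) (vertex_point (last P))"
  obtains \<sigma> where "strict_shortcut V E c \<sigma>" "path_length \<sigma> \<le> path_length P"
    "dC (vertex_point (hd P)) (vertex_point (hd \<sigma>)) \<le> real (path_length P)"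
proof -
  define N where "N = path_length P"
  have ne: "P \<noteq> []" using P(1) by (simp add: is_path_def)
  then have len: "length P = Suc N" by (simp add: N_def path_length_def)
  have hd: "hd P = P ! 0" and last: "last P = P ! N" using ne len by (simp_all add: hd_conv_nth last_conv_nth)
  define D where "D = (\<lambda>i. dC (vertex_point (P ! 0)) (vertex_point (P ! i)))"
  have in_trace: "vertex_point v \<in> trace c" if "v \<in> set c" for v
    unfolding trace_def using that by (rule vertex_pointI)
  define I where "I = {i. i \<le> N \<and> P ! i \<in> set c \<and> D i \<le> real i}"
  have "D 0 = 0" unfolding D_def cycle_dist_def using C.cyc.dist_refl in_trace P(2) hd by simp
  then have "0 \<in> I" unfolding I_def using P(2) hd by simp
  moreover have finI: "finite I" unfolding I_def by simp
  ultimately have I: "Max I \<in> I" by (intro Max_in) auto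
  define i where "i = Max I"
  have i: "i \<le> N" "P ! i \<in> set c" "D i \<le> real i" using I unfolding i_def I_def by auto
  have "i \<noteq> N" using i(3) gain unfolding D_def hd last N_def by auto
  define J where "J = {j. i < j \<and> j \<le> N \<and> P ! j \<in> set c}"
  have "N \<in> J" using \<open>i \<noteq> N\<close> i(1) P(3) last by (simp add: J_def)
  moreover have finJ: "finite J" unfolding J_def by simp
  ultimately have J: "Min J \<in> J" by (intro Min_in) auto
  define j where "j = Min J"
  have j: "i < j" "j \<le> N" "P ! j \<in> set c" using J unfolding j_def J_def by auto
  have between: "P ! l \<notin> set c" if "i < l" "l < j" for l
  proof
    assume "P ! l \<in> set c"
    then have "l \<in> J" using that j by (simp add: J_def)
    then show False using Min_le[OF finJ] that unfolding j_def by fastforce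
  qed
  have "j \<notin> I" using Max_ge[OF finI, of j] j(1) unfolding i_def by auto
  then have Dj: "real j < D j" using j unfolding I_def by auto
  have "D j \<le> D i + dC (vertex_point (P ! i)) (vertex_point (P ! j))"
    unfolding D_def cycle_dist_def by (rule C.cyc.dist_triangle) (use in_trace P(2) hd i j in auto)
  then have gain_ij: "real (j - i) < dC (vertex_point (P ! i)) (vertex_point (P ! j))"
    using Dj i(3) j(1) by (simp add: of_nat_diff)
  define \<sigma> where "\<sigma> = take (Suc (j - i)) (drop i P)"
  have jP: "i \<le> j" "j < length P" using j len by auto
  note seg = is_path_segment[OF P(1) jP \<sigma>_def]
  have \<sigma>_ne: "\<sigma> \<noteq> []" using seg(2) by auto
  have hd\<sigma>: "hd \<sigma> = P ! i" using seg(3)[of 0] \<sigma>_ne by (simp add: hd_conv_nth)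
  have last\<sigma>: "last \<sigma> = P ! j" using seg(2) seg(3)[of "j - i"] \<sigma>_ne j(1) by (simp add: last_conv_nth)
  have len\<sigma>: "path_length \<sigma> = j - i" using seg(2) by (simp add: path_length_def)
  have set\<sigma>: "\<exists>l. i \<le> l \<and> l \<le> j \<and> v = P ! l" if v: "v \<in> set \<sigma>" for v
  proof -
    obtain k where k: "k < length \<sigma>" "\<sigma> ! k = v" using v[unfolded in_set_conv_nth] by blast
    then have "k \<le> j - i" using seg(2) by simp
    then show ?thesis using k(2) seg(3)[of k] jP by (intro exI[of _ "i + k"]) simp
  qed
  have ends: "v = P ! i \<or> v = P ! j" if v\<sigma>: "v \<in> set \<sigma>" and vc: "v \<in> set c" for v
  proof -
    obtain l where l: "i \<le> l" "l \<le> j" "v = P ! l" using set\<sigma>[OF v\<sigma>] by blast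
    then have "\<not> (i < l \<and> l < j)" using between[of l] vc by blast
    then have "l = i \<or> l = j" using l(1,2) by linarith
    then show ?thesis using l(3) by blast
  qed
  have short: "shortcut V E c \<sigma>"
    unfolding shortcut_def hd\<sigma> last\<sigma> len\<sigma> using seg(1) i(2) j(3) gain_ij by blast
  have vertex_case: "vertex_point v \<in> shortcut_vertices \<sigma>"
    if v: "v \<in> set \<sigma>" "vertex_point v \<in> trace c" for v
  proof -
    have "v \<in> set c" using v(2) vertex_point_in_points_iff[OF C.simple_c] unfolding trace_def by blast
    then show ?thesis using ends[OF v(1)] unfolding shortcut_vertices_def hd\<sigma> last\<sigma> by blast
  qed
  have "trace \<sigma> \<inter> trace c = shortcut_vertices \<sigma>"
  proof (intro equalityI subsetI)
    fix z assume "z \<in> trace \<sigma> \<inter> trace c"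
    then have z: "z \<in> trace \<sigma>" "z \<in> trace c" by auto
    from z(1) consider v where "v \<in> set \<sigma>" "z = vertex_point v"
      | u v s where "{u, v} \<in> path_edges \<sigma>" "0 \<le> s" "s \<le> 1" "z = edge_point u v s"
      unfolding trace_def points_def by blast
    then show "z \<in> shortcut_vertices \<sigma>"
    proof cases
      case (1 v)
      then show ?thesis using vertex_case z(2) by blast
    next
      case (2 u v s)
      obtain k where k: "Suc k < length \<sigma>" "{u, v} = {\<sigma> ! k, \<sigma> ! Suc k}"
        using 2(1) unfolding path_edges_def by blast
      have uv\<sigma>: "u \<in> set \<sigma>" "v \<in> set \<sigma>"
      proof -
        have "\<sigma> ! k \<in> set \<sigma>" "\<sigma> ! Suc k \<in> set \<sigma>" using k(1) by auto
        then show "u \<in> set \<sigma>" "v \<in> set \<sigma>" using k(2) by (auto simp: doubleton_eq_iff)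
      qed
      have "{u, v} \<in> E" using 2(1) seg(1) unfolding is_path_def by blast
      then have "u \<noteq> v" using simple_graph_edge[OF simple] by blast
      consider "s = 0" | "s = 1" | "0 < s \<and> s < 1" using 2 by linarith
      then show ?thesis
      proof cases
        case 1
        then show ?thesis using vertex_case[OF uv\<sigma>(1)] z(2) 2(4) by (simp add: edge_point_0)
      next
        case 2
        then show ?thesis using vertex_case[OF uv\<sigma>(2)] z(2) \<open>z = edge_point u v s\<close> \<open>u \<noteq> v\<close>
          by (simp add: edge_point_1)
      next
        \<comment> \<open>An inner point of an edge of the cycle: that edge would be all of \<open>\<sigma>\<close> and no shortcut.\<close>
        case 3
        then have pos: "0 < z u" "0 < z v" using \<open>z = edge_point u v s\<close> \<open>u \<noteq> v\<close> by auto
        have "{u, v} \<in> path_edges c"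
          using points_two_coordinates[OF C.simple_c z(2)[unfolded trace_def] \<open>u \<noteq> v\<close> pos] by blast
        note uv = this simple_graph_edge[OF C.simple_c this]
        have "u = P ! i \<and> v = P ! j \<or> u = P ! j \<and> v = P ! i"
          using ends[OF uv\<sigma>(1)] ends[OF uv\<sigma>(2)] uv \<open>u \<noteq> v\<close> by blast
        then have "pl_joined (path_edges c) (vertex_point (P ! i)) (vertex_point (P ! j)) 1"
          using pl_joined_edge[OF uv(1), of 0 1] pl_joined_edge[OF uv(1), of 1 0] \<open>u \<noteq> v\<close>
          by (auto simp: edge_point_0 edge_point_1)
        then have "dC (vertex_point (P ! i)) (vertex_point (P ! j)) \<le> 1"
          unfolding cycle_dist_def by (rule length_dist_le)
        then show ?thesis using gain_ij j(1) by linarith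
      qed
    qed
  next
    fix z assume z: "z \<in> shortcut_vertices \<sigma>"
    then have "z \<in> trace c" using in_trace i(2) j(3) unfolding shortcut_vertices_def hd\<sigma> last\<sigma> by blast
    moreover have "z \<in> trace \<sigma>"
      using z \<sigma>_ne unfolding shortcut_vertices_def trace_def by (auto intro: vertex_pointI)
    ultimately show "z \<in> trace \<sigma> \<inter> trace c" by blast
  qed
  then have "strict_shortcut V E c \<sigma>" unfolding strict_shortcut_def using short by blast
  moreover have "path_length \<sigma> \<le> path_length P" unfolding len\<sigma> N_def[symmetric] using j by simp
  moreover have "dC (vertex_point (hd P)) (vertex_point (hd \<sigma>)) \<le> real (path_length P)"
    using i unfolding hd hd\<sigma> D_def N_def[symmetric] by linarith
  ultimately show ?thesis by (rule that)
qed

text \<open>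
  Passing from \<open>p\<close> and \<open>q\<close> to vertices of the cycle changes each of the two distances by at most 2; a gap
  of 5 therefore leaves a shortest path between vertices that is shorter than the way along the cycle.
\<close>

lemma strict_shortcut_near:
  assumes p: "p \<in> trace c" and q: "q \<in> trace c" and near: "d p q \<le> \<delta>" and far: "\<delta> + 5 \<le> dC p q"
  obtains \<sigma> where "strict_shortcut V E c \<sigma>" "real (path_length \<sigma>) \<le> \<delta> + 2"
    "dC (vertex_point (hd \<sigma>)) p \<le> \<delta> + 3"
proof -
  obtain u where u: "u \<in> set c" "dC p (vertex_point u) \<le> 1" by (rule vertex_near[OF p])
  obtain v where v: "v \<in> set c" "dC q (vertex_point v) \<le> 1" by (rule vertex_near[OF q])
  have tr: "vertex_point u \<in> trace c" "vertex_point v \<in> trace c"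
    unfolding trace_def using u v by (auto intro: vertex_pointI)
  have X: "p \<in> X" "q \<in> X" "vertex_point u \<in> X" "vertex_point v \<in> X"
    using C.trace_subset p q tr by auto
  have comm: "dC x y = dC y x" for x y unfolding cycle_dist_def by (rule C.cyc.dist_commute)
  have tri: "dC x z \<le> dC x y + dC y z" if "x \<in> trace c" "y \<in> trace c" "z \<in> trace c" for x y z
    unfolding cycle_dist_def using that by (rule C.cyc.dist_triangle)
  have "d (vertex_point u) (vertex_point v) \<le> d (vertex_point u) p + (d p q + d q (vertex_point v))"
    using dist_triangle[OF X(3,1,4)] dist_triangle[OF X(1,2,4)] by linarith
  also have "\<dots> \<le> \<delta> + 2"
    using C.dist_le_dC[OF tr(1) p] C.dist_le_dC[OF q tr(2)] comm[of p "vertex_point u"] u(2) v(2) near by linarith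
  finally have uv: "d (vertex_point u) (vertex_point v) \<le> \<delta> + 2" .
  have "dC p q \<le> dC p (vertex_point u) + (dC (vertex_point u) (vertex_point v) + dC (vertex_point v) q)"
    using tri[OF p tr(1) q] tri[OF tr(1,2) q] by linarith
  then have uvC: "\<delta> + 3 \<le> dC (vertex_point u) (vertex_point v)"
    using far u(2) v(2) comm[of q "vertex_point v"] by linarith
  have "u \<in> V" "v \<in> V" using u v C.set_c_subset by auto
  then obtain P where P: "is_path V E P" "hd P = u" "last P = v"
    "real (path_length P) \<le> d (vertex_point u) (vertex_point v)"
    by (rule shortest_path_exists[OF connected])
  have "real (path_length P) < dC (vertex_point (hd P)) (vertex_point (last P))"
    using P uv uvC by simp
  then obtain \<sigma> where \<sigma>: "strict_shortcut V E c \<sigma>" "path_length \<sigma> \<le> path_length P"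
    "dC (vertex_point (hd P)) (vertex_point (hd \<sigma>)) \<le> real (path_length P)"
    using strict_shortcut_on_path[OF P(1)] P(2,3) u(1) v(1) by blast
  have \<sigma>c: "vertex_point (hd \<sigma>) \<in> trace c"
    using \<sigma>(1) unfolding strict_shortcut_def shortcut_def trace_def by (auto intro: vertex_pointI)
  have "dC (vertex_point (hd \<sigma>)) p \<le> dC (vertex_point (hd \<sigma>)) (vertex_point u) + dC (vertex_point u) p"
    by (rule tri[OF \<sigma>c tr(1) p])
  also have "\<dots> \<le> \<delta> + 3"
    using \<sigma>(3) P(2,4) uv u(2) comm[of p "vertex_point u"] comm[of "vertex_point u" "vertex_point (hd \<sigma>)"] by simp
  finally show ?thesis using that[OF \<sigma>(1)] \<sigma>(2) P(4) uv by linarith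
qed

end

context metric_graph
begin

text \<open>
  One shortcut for each vertex of the cycle that starts one gives a finite family. Density adds up the
  \<open>14 (\<delta> + 5)\<close> from a point to a suitable pair and the \<open>\<delta> + 3\<close> from there to the start of a shortcut.
\<close>

theorem hyperbolic_imp_chordal:
  assumes hyp: "hyperbolic_graph V E \<delta>" and \<delta>: "0 \<le> \<delta>"
    and m: "\<delta> + 2 \<le> real m" and k: "14 * (\<delta> + 5) < real k"
  shows "densely_chordal_on V E (15 * (\<delta> + 5)) k m (triangle_cycles V E)"
  unfolding densely_chordal_on_def
proof (intro ballI impI)
  fix c assume c: "c \<in> triangle_cycles V E" and kc: "k \<le> path_length c"
  then obtain S1 S2 S3 where tri: "is_cycle V E c" "geodesic_triangle X d S1 S2 S3" "trace c = S1 \<union> S2 \<union> S3"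
    unfolding triangle_cycles_def by blast
  interpret cycle_in_metric_graph V E c by unfold_locales (rule tri(1))
  have R: "0 < \<delta> + 5" "14 * (\<delta> + 5) < real n" using \<delta> k kc by linarith+
  define ok where "ok = (\<lambda>\<sigma>. strict_shortcut V E c \<sigma> \<and> path_length \<sigma> \<le> m)"
  define W where "W = {v \<in> set c. \<exists>\<sigma>. ok \<sigma> \<and> hd \<sigma> = v}"
  define pick where "pick = (\<lambda>v. SOME \<sigma>. ok \<sigma> \<and> hd \<sigma> = v)"
  have pick: "ok (pick v) \<and> hd (pick v) = v" if "v \<in> W" for v
    unfolding pick_def by (rule someI_ex) (use that in \<open>auto simp: W_def\<close>)
  let ?\<Sigma> = "pick ` W"
  have on_c: "shortcut_vertices \<sigma> \<subseteq> trace c" if "ok \<sigma>" for \<sigma>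
    using that unfolding ok_def strict_shortcut_def shortcut_def shortcut_vertices_def trace_def
    by (auto intro: vertex_pointI)
  have near: "\<exists>y\<in>(\<Union>\<sigma>\<in>?\<Sigma>. shortcut_vertices \<sigma>). dC y x < 15 * (\<delta> + 5)" if x: "x \<in> trace c" for x
  proof -
    obtain p q where pq: "p \<in> trace c" "q \<in> trace c" "dC x p \<le> 14 * (\<delta> + 5)" "d p q \<le> \<delta>" "\<delta> + 5 \<le> dC p q"
      using thin_pair_near[OF tri(2,3) hyp R x] by blast
    obtain \<sigma> where \<sigma>: "strict_shortcut V E c \<sigma>" "real (path_length \<sigma>) \<le> \<delta> + 2"
      "dC (vertex_point (hd \<sigma>)) p \<le> \<delta> + 3"
      by (rule strict_shortcut_near[OF pq(1,2,4,5)])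
    have "ok \<sigma>" using \<sigma>(1,2) m unfolding ok_def by simp
    moreover have "hd \<sigma> \<in> set c" using \<sigma>(1) by (simp add: strict_shortcut_def shortcut_def)
    ultimately have W: "hd \<sigma> \<in> W" unfolding W_def by blast
    have "vertex_point (hd \<sigma>) \<in> shortcut_vertices (pick (hd \<sigma>))"
      using pick[OF W] by (simp add: shortcut_vertices_def)
    moreover have "dC (vertex_point (hd \<sigma>)) x < 15 * (\<delta> + 5)"
    proof -
      have "vertex_point (hd \<sigma>) \<in> trace c" unfolding trace_def using \<open>hd \<sigma> \<in> set c\<close> by (rule vertex_pointI)
      then have "dC (vertex_point (hd \<sigma>)) x \<le> dC (vertex_point (hd \<sigma>)) p + dC p x"
        unfolding cycle_dist_def by (rule C.cyc.dist_triangle) (use pq x in auto)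
      also have "dC p x = dC x p" unfolding cycle_dist_def by (rule C.cyc.dist_commute)
      also have "dC (vertex_point (hd \<sigma>)) p + dC x p \<le> (\<delta> + 3) + 14 * (\<delta> + 5)"
        by (rule add_mono[OF \<sigma>(3) pq(3)])
      also have "\<dots> < 15 * (\<delta> + 5)" by simp
      finally show ?thesis .
    qed
    ultimately show ?thesis using W by blast
  qed
  have "finite ?\<Sigma>" unfolding W_def by simp
  moreover have "\<forall>\<sigma>\<in>?\<Sigma>. strict_shortcut V E c \<sigma> \<and> path_length \<sigma> \<le> m"
    using pick unfolding ok_def by blast
  moreover have "eps_dense (trace c) dC (15 * (\<delta> + 5)) (\<Union>\<sigma>\<in>?\<Sigma>. shortcut_vertices \<sigma>)"
    unfolding eps_dense_def using near on_c pick by blast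
  ultimately show "\<exists>\<Sigma>. finite \<Sigma> \<and> (\<forall>\<sigma>\<in>\<Sigma>. strict_shortcut V E c \<sigma> \<and> path_length \<sigma> \<le> m) \<and>
      eps_dense (trace c) (cycle_dist c) (15 * (\<delta> + 5)) (\<Union>\<sigma>\<in>\<Sigma>. shortcut_vertices \<sigma>)"
    by blast
qed

end

section \<open>Hyperbolicity and dense chordality\<close>

theorem theorem3p10:
  fixes V :: "'v set" and E :: "'v set set"
  assumes "connected_graph V E"
  shows "(\<exists>\<delta>\<ge>0. hyperbolic_graph V E \<delta>) \<longleftrightarrow>
    (\<exists>(\<epsilon>::real) (k::nat) (m::nat). \<epsilon> > 0 \<and> k \<ge> 4 \<and> k \<ge> 2 * m \<and>
       densely_chordal_on V E \<epsilon> k m (triangle_cycles V E))"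
proof
  interpret metric_graph V E by unfold_locales (rule assms)
  assume "\<exists>\<delta>\<ge>0. hyperbolic_graph V E \<delta>"
  then obtain \<delta> where \<delta>: "0 \<le> \<delta>" "hyperbolic_graph V E \<delta>" by blast
  define m where "m = nat \<lceil>\<delta> + 2\<rceil>"
  define k where "k = 4 + 2 * m + nat \<lceil>14 * (\<delta> + 5)\<rceil>"
  have "\<delta> + 2 \<le> real m" unfolding m_def by linarith
  moreover have "14 * (\<delta> + 5) < real k" unfolding k_def by linarith
  ultimately have "densely_chordal_on V E (15 * (\<delta> + 5)) k m (triangle_cycles V E)"
    by (rule hyperbolic_imp_chordal[OF \<delta>(2,1)])
  moreover have "0 < 15 * (\<delta> + 5)" "4 \<le> k" "2 * m \<le> k" using \<delta>(1) by (auto simp: k_def)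
  ultimately show "\<exists>(\<epsilon>::real) (k::nat) (m::nat). \<epsilon> > 0 \<and> k \<ge> 4 \<and> k \<ge> 2 * m \<and>
      densely_chordal_on V E \<epsilon> k m (triangle_cycles V E)" by blast
next
  interpret metric_graph V E by unfold_locales (rule assms)
  assume "\<exists>(\<epsilon>::real) (k::nat) (m::nat). \<epsilon> > 0 \<and> k \<ge> 4 \<and> k \<ge> 2 * m \<and>
      densely_chordal_on V E \<epsilon> k m (triangle_cycles V E)"
  then obtain \<epsilon> :: real and k m :: nat
    where *: "0 < \<epsilon>" "densely_chordal_on V E \<epsilon> k m (triangle_cycles V E)" by blast
  have "hyperbolic_graph V E (\<epsilon> + real m + real k + 2)" by (rule chordal_imp_hyperbolic[OF *(2,1)])
  moreover have "0 \<le> \<epsilon> + real m + real k + 2" using *(1) by simp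
  ultimately show "\<exists>\<delta>\<ge>0. hyperbolic_graph V E \<delta>" by blast
qed

end
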